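(* Fix a finite token set $\Sigma$. Encoder--decoder transformers with non-strict causal masking (without final $\mathrm{softmax}$), tuples of $\Sigma$-formulae of the logic $\mathrm{GPTL}^{-}_2$, and $\mathrm{CPG}'$-automata over $\Sigma$ have the same expressive power: for any two of these classes, every object of the first class has an equivalent object in the second.
   Context: Floating-point numbers: for $p,q\in\mathbb{Z}_+$ a float is a bit string $b_0\cdots b_{q+p}$ (sign, $q$-bit exponent value $e$, $p$-bit significand value $s$) representing $(-1)^{b_0}\frac{s}{2^{p-1}}2^{e-(2^{q-1}-1)}$, except significand $0^p$ with exponent $1^q$ represents $\pm\infty$. $\mathcal F(p,q)$: normalised and subnormalised floats plus $\infty,-\infty,\mathrm{NaN}$; arithmetic rounds exact results to nearest (overflow to $\pm\infty$, NaN for undefined operations); $\exp$ approximated within the format; sums of multisets computed in increasing order. Two-sorted graphs: $\mathrm{BOS}\notin\Sigma$; $\mathcal{G}=(V,E,\lambda)$, $V=[n]$, $E=\{(i,i+1)\}$, $\lambda:V\to\Sigma\cup\{\mathrm{BOS}\}$ with exactly one vertex $w$ labelled $\mathrm{BOS}$; prefix $\mathcal G_p$ = vertices $1,\dots,w-1$; suffix $\mathcal G_s$ = vertices $w,\dots,n$. Encoder--decoder transformer with non-strict causal masking, over $\mathcal F$, dimensions $(d,d_k,d_v,d_{ff},d_{\text{out}})$, all arithmetic in $\mathcal F$: embedding $\mathrm{em}:\Sigma\cup\{\mathrm{BOS}\}\to\mathcal F^d$ vertex-wise; the non-strict mask sets entry $(i,j)$ of a square matrix to $-\infty$ if $j>i$;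 $\mathrm{softmax}(\mathbf x)_i=e^{x_i-\beta}/\sum_je^{x_j-\beta}$, $\beta=\max x_j$, $\mathrm{softmax}(-\infty,\dots,-\infty)=0$; attention head $(X,Y)\mapsto\mathrm{softmax}((YW^Q)(XW^K)^\top/\sqrt{d_k})(XW^V)$ row-wise (masked heads mask before softmax); multi-head $\mathrm{concat}(H^{(1)},\dots,H^{(h)})W^O$; MLP $M(\mathbf x)=\mathrm{ReLU}(\mathbf xW_1+b_1)W_2+b_2$; encoder layer $\mathsf{EL}(X)=M(X')+X'$, $X'=\mathsf{MHSA}(X)+X$ (unmasked self-attention); decoder layer $\mathsf{DL}(X,Y)=M(Y'')+Y''$, $Y''=\mathsf{MHCA}(X,Y')+Y'$ (unmasked cross-attention), $Y'=\mathsf{MHSA}_{\mathrm{mask}}(Y)+Y$ (masked self-attention); encoder/decoder are stacks of such layers ($\mathsf D(X,Y)=\mathsf{DL}_{L_2}(X,\dots\mathsf{DL}_1(X,Y)\dots)$); output head $\mathrm{Out}(Y)=YW^{\mathrm{out}}+b^{\mathrm{out}}$; $T(\mathcal G)=\mathrm{Out}(\mathsf D(\mathsf E(\mathrm{em}(\mathcal G_p)),\mathrm{em}(\mathcal G_s)))$, row of suffix vertex $v$ = output at $v$. Bit-wise interpretation: concatenation of the bit strings of the floats; feature-wise interpretation (entries all representing $0$ or $1$): bit $i$ is $1$ iff entry $i$ represents $1$. Logic $\mathrm{GPTL}^{-}_2$: $\varphi::=\bot\mid p\mid\neg\varphi\mid(\varphi\wedge\varphi)\mid\langle G\rangle^{\text{pre}}_{\ge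 k}\varphi\mid\langle P\rangle^{\text{suf}}_{\ge k}\varphi$ ($p\in\Sigma$, $k\in\mathbb N$); $p$ holds iff the label is $p$; $\langle G\rangle^{\text{pre}}_{\ge k}\varphi$ holds iff at least $k$ prefix vertices satisfy $\varphi$; $\mathcal G,w'\models\langle P\rangle^{\text{suf}}_{\ge k}\varphi$ iff $|\{u\in V(\mathcal G_s)\mid u\le w',\ \mathcal G,u\models\varphi\}|\ge k$. A tuple outputs the bit string of truth values. $\mathrm{CPG}'$-automaton: $(Q,\pi,\delta,n,b)$ with finite nonempty $Q\subseteq\{0,1\}^m$, $\pi:\Sigma\cup\{\mathrm{BOS}\}\to Q$, $\delta:Q\times\mathcal M_k(Q)\times\mathcal M_k(Q)\to Q$ ($k$-capped multisets), $n\in\mathbb N$, $b\in\mathbb Z_+$; $x^0_v=\pi(\lambda(v))$, $x^{t+1}_v=\delta(x^t_v,\{\{x^t_u\mid u<w\}\}_{|k},\{\{x^t_u\mid w\le u\le v\}\}_{|k})$; output at $(\mathcal G,v)$ = length-$b$ prefix of $x^n_v$. Equivalence: same output at every $(\mathcal G,v)$ with $v$ a suffix vertex, a transformer's output being read bit-wise when translating from a transformer and feature-wise when translating into a transformer.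
   Formalization: In masked heads, masked positions are left out of the weighted sum of values instead of contributing 0 times the value: otherwise an infinite or NaN value at a later vertex gives NaN at earlier ones, and the claim fails. *)

theory Defs
  imports Complex_Main "HOL-Library.Multiset" "Jordan_Normal_Form.Matrix"
begin

section \<open>Floating-point formats\<close>

record fmt =
  prec :: nat
  ebits :: nat

definition valid_fmt :: "fmt \<Rightarrow> bool" where
  "valid_fmt F \<longleftrightarrow> 1 \<le> prec F \<and> 1 \<le> ebits F"

definition bias :: "fmt \<Rightarrow> int" where
  "bias F = 2 ^ (ebits F - 1) - 1"

text \<open>\<open>Fin b e s\<close> has sign bit \<open>b\<close>, exponent value \<open>e\<close> and significand value \<open>s\<close>;
  \<open>+0\<close> and \<open>-0\<close> are different floats.\<close>

datatype fp = Fin (neg: bool) (expo: nat) (signif: nat) | Inf (neg: bool) | NaN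

fun fp_val :: "fmt \<Rightarrow> fp \<Rightarrow> real" where
  "fp_val F (Fin b e s) =
     (- 1) ^ of_bool b * (real s / 2 ^ (prec F - 1)) * 2 powi (int e - bias F)"

definition represents :: "fmt \<Rightarrow> fp \<Rightarrow> real \<Rightarrow> bool" where
  "represents F x r \<longleftrightarrow> (case x of Fin b e s \<Rightarrow> fp_val F (Fin b e s) = r | _ \<Rightarrow> False)"

text \<open>The last conjunct says normalised (leading significand bit 1) or subnormalised
  (leading significand bit 0 and exponent 0).\<close>

definition fin_floats :: "fmt \<Rightarrow> fp set" where
  "fin_floats F = {Fin b e s | b e s.
     e < 2 ^ ebits F \<and> s < 2 ^ prec F \<and> (2 ^ (prec F - 1) \<le> s \<or> e = 0)}"

definition floats :: "fmt \<Rightarrow> fp set" where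
  "floats F = fin_floats F \<union> {Inf False, Inf True, NaN}"

abbreviation fp_zero :: fp where
  "fp_zero \<equiv> Fin False 0 0"

definition fp_one :: "fmt \<Rightarrow> fp" where
  "fp_one F = Fin False (nat (bias F)) (2 ^ (prec F - 1))"

definition bin :: "nat \<Rightarrow> nat \<Rightarrow> bool list" where
  "bin k n = map (bit n) (rev [0..<k])"

text \<open>The format reserves no bit string for \<open>NaN\<close>, so the string standing for it is a parameter.\<close>

fun fp_bits :: "(fmt \<Rightarrow> bool list) \<Rightarrow> fmt \<Rightarrow> fp \<Rightarrow> bool list" where
  "fp_bits nanb F (Fin b e s) = b # bin (ebits F) e @ bin (prec F) s"
| "fp_bits nanb F (Inf b) = b # replicate (ebits F) True @ replicate (prec F) False"
| "fp_bits nanb F NaN = nanb F"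

section \<open>Rounding and arithmetic\<close>

text \<open>Magnitude from which results overflow: the largest finite float plus half a unit in its
  last place.\<close>

definition overflow_bound :: "fmt \<Rightarrow> real" where
  "overflow_bound F =
     (2 ^ prec F - 1 / 2) * 2 powi (2 ^ ebits F - 1 - bias F - (int (prec F) - 1))"

definition nearest :: "fmt \<Rightarrow> bool \<Rightarrow> real \<Rightarrow> fp set" where
  "nearest F b r = {x \<in> fin_floats F. neg x = b \<and>
     (\<forall>y\<in>fin_floats F. \<bar>fp_val F x - r\<bar> \<le> \<bar>fp_val F y - r\<bar>)}"

text \<open>Round to nearest, ties to even. Two neighbours with odd significands occur only for
  precision 1; then the tie goes to the larger magnitude. The argument \<open>z\<close> is the sign of an exact
  zero result.\<close>

definition fp_round :: "fmt \<Rightarrow> bool \<Rightarrow> real \<Rightarrow> fp" where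
  "fp_round F z r =
     (if overflow_bound F \<le> \<bar>r\<bar> then Inf (r < 0)
      else let N = nearest F (if r = 0 then z else r < 0) r in
        SOME x. x \<in> N \<and>
          (even (signif x) \<or> (\<forall>y\<in>N. odd (signif y) \<and> \<bar>fp_val F y\<bar> \<le> \<bar>fp_val F x\<bar>)))"

fun fp_uminus :: "fp \<Rightarrow> fp" where
  "fp_uminus (Fin b e s) = Fin (\<not> b) e s"
| "fp_uminus (Inf b) = Inf (\<not> b)"
| "fp_uminus NaN = NaN"

fun fp_add :: "fmt \<Rightarrow> fp \<Rightarrow> fp \<Rightarrow> fp" where
  "fp_add F NaN y = NaN"
| "fp_add F x NaN = NaN"
| "fp_add F (Inf a) (Inf b) = (if a = b then Inf a else NaN)"
| "fp_add F (Inf a) y = Inf a"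
| "fp_add F x (Inf b) = Inf b"
| "fp_add F x y = fp_round F (neg x \<and> neg y) (fp_val F x + fp_val F y)"

definition fp_sub :: "fmt \<Rightarrow> fp \<Rightarrow> fp \<Rightarrow> fp" where
  "fp_sub F x y = fp_add F x (fp_uminus y)"

fun fp_mult :: "fmt \<Rightarrow> fp \<Rightarrow> fp \<Rightarrow> fp" where
  "fp_mult F NaN y = NaN"
| "fp_mult F x NaN = NaN"
| "fp_mult F (Inf a) (Inf b) = Inf (a \<noteq> b)"
| "fp_mult F (Inf a) (Fin b e s) = (if s = 0 then NaN else Inf (a \<noteq> b))"
| "fp_mult F (Fin a e s) (Inf b) = (if s = 0 then NaN else Inf (a \<noteq> b))"
| "fp_mult F x y = fp_round F (neg x \<noteq> neg y) (fp_val F x * fp_val F y)"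

fun fp_div :: "fmt \<Rightarrow> fp \<Rightarrow> fp \<Rightarrow> fp" where
  "fp_div F NaN y = NaN"
| "fp_div F x NaN = NaN"
| "fp_div F (Inf a) (Inf b) = NaN"
| "fp_div F (Inf a) (Fin b e s) = (if s = 0 then NaN else Inf (a \<noteq> b))"
| "fp_div F (Fin a e s) (Inf b) = Fin (a \<noteq> b) 0 0"
| "fp_div F (Fin a e s) (Fin b e' s') =
     (if s' = 0 then NaN
      else fp_round F (a \<noteq> b) (fp_val F (Fin a e s) / fp_val F (Fin b e' s')))"

fun fp_relu :: "fp \<Rightarrow> fp" where
  "fp_relu NaN = NaN"
| "fp_relu x = (if neg x then fp_zero else x)"

text \<open>Unit in the last place at a positive real.\<close>

definition ulp :: "fmt \<Rightarrow> real \<Rightarrow> real" where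
  "ulp F r = 2 powi (max (- bias F) \<lfloor>log 2 r\<rfloor> - (int (prec F) - 1))"

text \<open>\<open>ex\<close> approximates the exponential function within \<open>F\<close>: it is exact where the exponential has
  an exact value in the format and otherwise off by at most \<open>c\<close> units in the last place.\<close>

definition exp_approx :: "nat \<Rightarrow> fmt \<Rightarrow> (fp \<Rightarrow> fp) \<Rightarrow> bool" where
  "exp_approx c F ex \<longleftrightarrow>
     ex NaN = NaN \<and> ex (Inf False) = Inf False \<and> ex (Inf True) = fp_zero \<and>
     ex (Fin False 0 0) = fp_one F \<and> ex (Fin True 0 0) = fp_one F \<and>
     (\<forall>x\<in>fin_floats F. let r = exp (fp_val F x) in
        (ex x \<in> fin_floats F \<and> \<not> neg (ex x) \<and> \<bar>fp_val F (ex x) - r\<bar> \<le> c * ulp F r) \<or>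
        (ex x = Inf False \<and> overflow_bound F - c * ulp F r \<le> r))"

text \<open>Order embedding of the format into the integers:
  \<open>-\<infinity> < \<dots> < -0 < +0 < \<dots> < \<infinity> < NaN\<close>.\<close>

fun fp_key :: "fmt \<Rightarrow> fp \<Rightarrow> int" where
  "fp_key F (Fin b e s) =
     (let m = int e * 2 ^ prec F + int s in if b then - m - 1 else m)"
| "fp_key F (Inf b) = (let m = 2 ^ (prec F + ebits F) in if b then - m - 1 else m)"
| "fp_key F NaN = 2 ^ (prec F + ebits F) + 1"

text \<open>Sum of the multiset of entries, computed in increasing order; the list order is irrelevant.\<close>

definition fp_sum :: "fmt \<Rightarrow> fp list \<Rightarrow> fp" where
  "fp_sum F xs = foldl (fp_add F) fp_zero (sort_key (fp_key F) xs)"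

definition fp_max :: "fmt \<Rightarrow> fp list \<Rightarrow> fp" where
  "fp_max F xs = arg_max_on (fp_key F) (set xs)"

definition softmax :: "(fmt \<Rightarrow> fp \<Rightarrow> fp) \<Rightarrow> fmt \<Rightarrow> fp list \<Rightarrow> fp list" where
  "softmax fexp F xs =
     (if set xs \<subseteq> {Inf True} then map (\<lambda>_. fp_zero) xs
      else let es = map (\<lambda>x. fexp F (fp_sub F x (fp_max F xs))) xs
           in map (\<lambda>e. fp_div F e (fp_sum F es)) es)"

section \<open>Matrices of floats\<close>

definition fmat :: "fmt \<Rightarrow> nat \<Rightarrow> nat \<Rightarrow> fp mat set" where
  "fmat F n m = {A \<in> carrier_mat n m. elements_mat A \<subseteq> floats F}"

definition fvec :: "fmt \<Rightarrow> nat \<Rightarrow> fp vec set" where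
  "fvec F n = {v \<in> carrier_vec n. set\<^sub>v v \<subseteq> floats F}"

text \<open>Product in which row \<open>i\<close> of the left factor is restricted to the columns \<open>j\<close> with
  \<open>keep i j\<close>.\<close>

definition fmat_mult_on :: "(nat \<Rightarrow> nat \<Rightarrow> bool) \<Rightarrow> fmt \<Rightarrow> fp mat \<Rightarrow> fp mat \<Rightarrow> fp mat" where
  "fmat_mult_on keep F A B = mat (dim_row A) (dim_col B) (\<lambda>(i, l).
     fp_sum F (map (\<lambda>j. fp_mult F (A $$ (i, j)) (B $$ (j, l)))
       (filter (keep i) [0..<dim_row B])))"

abbreviation everywhere :: "nat \<Rightarrow> nat \<Rightarrow> bool" where
  "everywhere \<equiv> \<lambda>i j. True"

abbreviation causal :: "nat \<Rightarrow> nat \<Rightarrow> bool" where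
  "causal \<equiv> \<lambda>i j. j \<le> i"

definition fmat_mult :: "fmt \<Rightarrow> fp mat \<Rightarrow> fp mat \<Rightarrow> fp mat" where
  "fmat_mult = fmat_mult_on everywhere"

definition fmat_add :: "fmt \<Rightarrow> fp mat \<Rightarrow> fp mat \<Rightarrow> fp mat" where
  "fmat_add F A B = mat (dim_row A) (dim_col A) (\<lambda>ij. fp_add F (A $$ ij) (B $$ ij))"

definition fmat_add_row :: "fmt \<Rightarrow> fp mat \<Rightarrow> fp vec \<Rightarrow> fp mat" where
  "fmat_add_row F A b = mat (dim_row A) (dim_col A) (\<lambda>(i, j). fp_add F (A $$ (i, j)) (b $ j))"

definition softmax_rows :: "(fmt \<Rightarrow> fp \<Rightarrow> fp) \<Rightarrow> fmt \<Rightarrow> fp mat \<Rightarrow> fp mat" where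
  "softmax_rows fexp F A =
     mat (dim_row A) (dim_col A) (\<lambda>(i, j). softmax fexp F (list_of_vec (row A i)) ! j)"

definition mask :: "(nat \<Rightarrow> nat \<Rightarrow> bool) \<Rightarrow> fp mat \<Rightarrow> fp mat" where
  "mask keep A =
     mat (dim_row A) (dim_col A) (\<lambda>(i, j). if keep i j then A $$ (i, j) else Inf True)"

section \<open>Two-sorted graphs\<close>

text \<open>A graph on \<open>V = [n]\<close> with edges \<open>(i, i+1)\<close> is given by its list of labels; \<open>None\<close> is the label
  BOS, and vertices are numbered from 0.\<close>

type_synonym 'a graph = "'a option list"

definition labels :: "'a set \<Rightarrow> 'a option set" where
  "labels \<Sigma> = insert None (Some ` \<Sigma>)"

definition two_sorted :: "'a set \<Rightarrow> 'a graph \<Rightarrow> bool" where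
  "two_sorted \<Sigma> G \<longleftrightarrow> set G \<subseteq> labels \<Sigma> \<and> (\<exists>!w. w < length G \<and> G ! w = None)"

definition bos :: "'a graph \<Rightarrow> nat" where
  "bos G = (THE w. w < length G \<and> G ! w = None)"

definition suffix_vertices :: "'a graph \<Rightarrow> nat set" where
  "suffix_vertices G = {bos G..<length G}"

section \<open>Encoder--decoder transformers\<close>

record head =
  wQ :: "fp mat"
  wK :: "fp mat"
  wV :: "fp mat"

record attention =
  heads :: "head list"
  wO :: "fp mat"

record mlp =
  w1 :: "fp mat"
  b1 :: "fp vec"
  w2 :: "fp mat"
  b2 :: "fp vec"

record enc_layer =
  enc_self :: attention
  enc_mlp :: mlp

record dec_layer =
  dec_self :: attention
  dec_cross :: attention
  dec_mlp :: mlp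

record 'a transformer =
  tfmt :: fmt
  dim_model :: nat
  dim_key :: nat
  dim_val :: nat
  dim_ff :: nat
  dim_out :: nat
  emb :: "'a option \<Rightarrow> fp vec"
  encoder :: "enc_layer list"
  decoder :: "dec_layer list"
  w_out :: "fp mat"
  b_out :: "fp vec"

definition wf_attention :: "'a transformer \<Rightarrow> attention \<Rightarrow> bool" where
  "wf_attention T A \<longleftrightarrow>
     heads A \<noteq> [] \<and>
     (\<forall>H\<in>set (heads A).
        wQ H \<in> fmat (tfmt T) (dim_model T) (dim_key T) \<and>
        wK H \<in> fmat (tfmt T) (dim_model T) (dim_key T) \<and>
        wV H \<in> fmat (tfmt T) (dim_model T) (dim_val T)) \<and>
     wO A \<in> fmat (tfmt T) (length (heads A) * dim_val T) (dim_model T)"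

definition wf_mlp :: "'a transformer \<Rightarrow> mlp \<Rightarrow> bool" where
  "wf_mlp T M \<longleftrightarrow>
     w1 M \<in> fmat (tfmt T) (dim_model T) (dim_ff T) \<and> b1 M \<in> fvec (tfmt T) (dim_ff T) \<and>
     w2 M \<in> fmat (tfmt T) (dim_ff T) (dim_model T) \<and> b2 M \<in> fvec (tfmt T) (dim_model T)"

definition is_transformer :: "'a set \<Rightarrow> 'a transformer \<Rightarrow> bool" where
  "is_transformer \<Sigma> T \<longleftrightarrow>
     valid_fmt (tfmt T) \<and>
     1 \<le> dim_model T \<and> 1 \<le> dim_key T \<and> 1 \<le> dim_val T \<and> 1 \<le> dim_ff T \<and> 1 \<le> dim_out T \<and>
     emb T ` labels \<Sigma> \<subseteq> fvec (tfmt T) (dim_model T) \<and>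
     encoder T \<noteq> [] \<and>
     (\<forall>L\<in>set (encoder T). wf_attention T (enc_self L) \<and> wf_mlp T (enc_mlp L)) \<and>
     decoder T \<noteq> [] \<and>
     (\<forall>L\<in>set (decoder T). wf_attention T (dec_self L) \<and> wf_attention T (dec_cross L) \<and>
        wf_mlp T (dec_mlp L)) \<and>
     w_out T \<in> fmat (tfmt T) (dim_model T) (dim_out T) \<and>
     b_out T \<in> fvec (tfmt T) (dim_out T)"

text \<open>A masked entry contributes nothing to the weighted sum of values. Multiplying its weight 0 by
  the value would give the same result, except that a value \<open>\<plusminus>\<infinity>\<close> or \<open>NaN\<close> at a masked (later) vertex
  would turn the entry into \<open>NaN\<close> and leak through the mask; hence the restricted product.\<close>

definition eval_head ::
  "(nat \<Rightarrow> nat \<Rightarrow> bool) \<Rightarrow> (fmt \<Rightarrow> fp \<Rightarrow> fp) \<Rightarrow> 'a transformer \<Rightarrow> head \<Rightarrow> fp mat \<Rightarrow> fp mat \<Rightarrow> fp mat"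
  where
  "eval_head keep fexp T H X Y =
     (let F = tfmt T;
          QK = fmat_mult F (fmat_mult F Y (wQ H)) (transpose_mat (fmat_mult F X (wK H)));
          S = map_mat (\<lambda>x. fp_div F x (fp_round F False (sqrt (real (dim_key T))))) QK
      in fmat_mult_on keep F (softmax_rows fexp F (mask keep S)) (fmat_mult F X (wV H)))"

definition eval_attention ::
  "(nat \<Rightarrow> nat \<Rightarrow> bool) \<Rightarrow> (fmt \<Rightarrow> fp \<Rightarrow> fp) \<Rightarrow> 'a transformer \<Rightarrow> attention \<Rightarrow> fp mat \<Rightarrow> fp mat \<Rightarrow> fp mat"
  where
  "eval_attention keep fexp T A X Y =
     (let Hs = map (\<lambda>H. eval_head keep fexp T H X Y) (heads A);
          C = mat (dim_row Y) (length Hs * dim_val T)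
                (\<lambda>(i, j). (Hs ! (j div dim_val T)) $$ (i, j mod dim_val T))
      in fmat_mult (tfmt T) C (wO A))"

definition eval_mlp :: "fmt \<Rightarrow> mlp \<Rightarrow> fp mat \<Rightarrow> fp mat" where
  "eval_mlp F M X =
     fmat_add_row F
       (fmat_mult F (map_mat fp_relu (fmat_add_row F (fmat_mult F X (w1 M)) (b1 M))) (w2 M))
       (b2 M)"

definition eval_enc_layer ::
  "(fmt \<Rightarrow> fp \<Rightarrow> fp) \<Rightarrow> 'a transformer \<Rightarrow> enc_layer \<Rightarrow> fp mat \<Rightarrow> fp mat" where
  "eval_enc_layer fexp T L X =
     (let F = tfmt T;
          X' = fmat_add F (eval_attention everywhere fexp T (enc_self L) X X) X
      in fmat_add F (eval_mlp F (enc_mlp L) X') X')"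

definition eval_dec_layer ::
  "(fmt \<Rightarrow> fp \<Rightarrow> fp) \<Rightarrow> 'a transformer \<Rightarrow> dec_layer \<Rightarrow> fp mat \<Rightarrow> fp mat \<Rightarrow> fp mat" where
  "eval_dec_layer fexp T L X Y =
     (let F = tfmt T;
          Y' = fmat_add F (eval_attention causal fexp T (dec_self L) Y Y) Y;
          Y'' = fmat_add F (eval_attention everywhere fexp T (dec_cross L) X Y') Y'
      in fmat_add F (eval_mlp F (dec_mlp L) Y'') Y'')"

definition embed :: "'a transformer \<Rightarrow> 'a option list \<Rightarrow> fp mat" where
  "embed T xs = mat (length xs) (dim_model T) (\<lambda>(i, j). emb T (xs ! i) $ j)"

definition eval_transformer ::
  "(fmt \<Rightarrow> fp \<Rightarrow> fp) \<Rightarrow> 'a transformer \<Rightarrow> 'a graph \<Rightarrow> fp mat" where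
  "eval_transformer fexp T G =
     (let F = tfmt T;
          X = fold (eval_enc_layer fexp T) (encoder T) (embed T (take (bos G) G));
          Y = fold (\<lambda>L. eval_dec_layer fexp T L X) (decoder T) (embed T (drop (bos G) G))
      in fmat_add_row F (fmat_mult F Y (w_out T)) (b_out T))"

definition transformer_output ::
  "(fmt \<Rightarrow> fp \<Rightarrow> fp) \<Rightarrow> 'a transformer \<Rightarrow> 'a graph \<Rightarrow> nat \<Rightarrow> fp list" where
  "transformer_output fexp T G v = list_of_vec (row (eval_transformer fexp T G) (v - bos G))"

definition bitwise :: "(fmt \<Rightarrow> bool list) \<Rightarrow> fmt \<Rightarrow> fp list \<Rightarrow> bool list" where
  "bitwise nanb F xs = concat (map (fp_bits nanb F) xs)"

text \<open>Defined only when every entry represents 0 or 1.\<close>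

definition featurewise :: "fmt \<Rightarrow> fp list \<Rightarrow> bool list option" where
  "featurewise F xs =
     (if \<forall>x\<in>set xs. represents F x 0 \<or> represents F x 1
      then Some (map (\<lambda>x. represents F x 1) xs) else None)"

section \<open>The logic\<close>

datatype 'a gptl =
    Bot
  | Atom 'a
  | Neg "'a gptl"
  | And "'a gptl" "'a gptl"
  | GPre nat "'a gptl"
  | PSuf nat "'a gptl"

text \<open>The set function \<open>set_gptl\<close> collects the tokens occurring in a formula.\<close>

definition is_formula_tuple :: "'a set \<Rightarrow> 'a gptl list \<Rightarrow> bool" where
  "is_formula_tuple \<Sigma> \<phi>s \<longleftrightarrow> \<phi>s \<noteq> [] \<and> (\<forall>\<phi>\<in>set \<phi>s. set_gptl \<phi> \<subseteq> \<Sigma>)"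

primrec sat :: "'a graph \<Rightarrow> nat \<Rightarrow> 'a gptl \<Rightarrow> bool" where
  "sat G v Bot \<longleftrightarrow> False"
| "sat G v (Atom a) \<longleftrightarrow> G ! v = Some a"
| "sat G v (Neg \<phi>) \<longleftrightarrow> \<not> sat G v \<phi>"
| "sat G v (And \<phi> \<psi>) \<longleftrightarrow> sat G v \<phi> \<and> sat G v \<psi>"
| "sat G v (GPre k \<phi>) \<longleftrightarrow> k \<le> card {u. u < bos G \<and> sat G u \<phi>}"
| "sat G v (PSuf k \<phi>) \<longleftrightarrow> k \<le> card {u \<in> suffix_vertices G. u \<le> v \<and> sat G u \<phi>}"

definition tuple_output :: "'a gptl list \<Rightarrow> 'a graph \<Rightarrow> nat \<Rightarrow> bool list" where
  "tuple_output \<phi>s G v = map (sat G v) \<phi>s"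

section \<open>CPG'-automata\<close>

definition cap :: "nat \<Rightarrow> 'b multiset \<Rightarrow> 'b multiset" where
  "cap k M = (\<Sum>x\<in>set_mset M. replicate_mset (min k (count M x)) x)"

definition capped_msets :: "nat \<Rightarrow> 'b set \<Rightarrow> 'b multiset set" where
  "capped_msets k Q = {M. set_mset M \<subseteq> Q \<and> (\<forall>x. count M x \<le> k)}"

record 'a automaton =
  width :: nat
  states :: "bool list set"
  cap_bound :: nat
  init_state :: "'a option \<Rightarrow> bool list"
  delta :: "bool list \<Rightarrow> bool list multiset \<Rightarrow> bool list multiset \<Rightarrow> bool list"
  rounds :: nat
  outlen :: nat

definition is_automaton :: "'a set \<Rightarrow> 'a automaton \<Rightarrow> bool" where
  "is_automaton \<Sigma> A \<longleftrightarrow>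
     finite (states A) \<and> states A \<noteq> {} \<and> (\<forall>x\<in>states A. length x = width A) \<and>
     init_state A ` labels \<Sigma> \<subseteq> states A \<and>
     (\<forall>x\<in>states A. \<forall>M\<in>capped_msets (cap_bound A) (states A). \<forall>N\<in>capped_msets (cap_bound A) (states A).
        delta A x M N \<in> states A) \<and>
     1 \<le> outlen A \<and> outlen A \<le> width A"

primrec run_state :: "'a automaton \<Rightarrow> 'a graph \<Rightarrow> nat \<Rightarrow> nat \<Rightarrow> bool list" where
  "run_state A G 0 = (\<lambda>v. init_state A (G ! v))"
| "run_state A G (Suc t) = (\<lambda>v. delta A (run_state A G t v)
     (cap (cap_bound A) (image_mset (run_state A G t) (mset_set {..<bos G})))
     (cap (cap_bound A) (image_mset (run_state A G t) (mset_set {bos G..v}))))"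

definition automaton_output :: "'a automaton \<Rightarrow> 'a graph \<Rightarrow> nat \<Rightarrow> bool list" where
  "automaton_output A G v = take (outlen A) (run_state A G (rounds A) v)"

section \<open>Equivalence\<close>

definition equivalent ::
  "'a set \<Rightarrow> ('a graph \<Rightarrow> nat \<Rightarrow> 'b) \<Rightarrow> ('a graph \<Rightarrow> nat \<Rightarrow> 'b) \<Rightarrow> bool" where
  "equivalent \<Sigma> f g \<longleftrightarrow>
     (\<forall>G. two_sorted \<Sigma> G \<longrightarrow> (\<forall>v\<in>suffix_vertices G. f G v = g G v))"

definition bitwise_output ::
  "(fmt \<Rightarrow> fp \<Rightarrow> fp) \<Rightarrow> (fmt \<Rightarrow> bool list) \<Rightarrow> 'a transformer \<Rightarrow> 'a graph \<Rightarrow> nat \<Rightarrow> bool list" where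
  "bitwise_output fexp nanb T G v = bitwise nanb (tfmt T) (transformer_output fexp T G v)"

definition featurewise_output ::
  "(fmt \<Rightarrow> fp \<Rightarrow> fp) \<Rightarrow> 'a transformer \<Rightarrow> 'a graph \<Rightarrow> nat \<Rightarrow> bool list option" where
  "featurewise_output fexp T G v = featurewise (tfmt T) (transformer_output fexp T G v)"

end

theory Submission
  imports Defs
begin

text \<open>
  Everything passes through the logic. Call a function of pointed graphs definable if it has finitely
  many values and each of them is defined by a formula. Definable functions are closed under
  composition with arbitrary functions and under taking capped multisets of values over the prefix or
  over the suffix up to the current vertex, so automata are definable round by round. For transformers
  one needs in addition that a floating-point sum depends only on the capped multiset of its summands:
  adding the same float over and over moves monotonically through a finite set and therefore becomes
  constant, with a bound independent of the number of summands. Masked positions are harmless because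
  their softmax weight is exactly \<open>+0\<close>.

  Conversely, a transformer evaluates one subformula per layer. To compare the number \<open>n\<close> of marked
  rows with \<open>k\<close>, a head gives the other rows the score \<open>-\<infinity>\<close>, produced by overflow, so every marked row
  gets a weight close to \<open>1 / n\<close>. Multiplying this weight with about \<open>k / 2\<close> times the least positive float
  rounds to an integral multiple \<open>m\<close> of that float, and \<open>N = n * m\<close> satisfies \<open>1 \<le> N < k\<close> for
  \<open>1 \<le> n < k\<close> but \<open>N = 0\<close> or \<open>N \<ge> k\<close> for \<open>n \<ge> k\<close>. This only uses the exponential at \<open>0\<close> and
  \<open>-\<infinity>\<close>, where it is exact.
\<close>

section \<open>Floats, rounding and sums\<close>

text \<open>A fixed format has to count arbitrarily many rows, yet sums of ones saturate and rounded
  weights have no exact sum. The construction lets rounding work in its favour. With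
  \<open>t = (k + 1) div 2\<close> the quotient \<open>t / n\<close> stays above 1 / 2 for
  \<open>n < k\<close>, so it is not rounded to 0, while for \<open>n \<ge> k\<close> any
  \<open>m \<ge> 1\<close> gives \<open>n * m \<ge> k\<close> for free. Equal summands that are
  small multiples of the least positive float add up without error. What remains ambiguous is
  \<open>N = 0\<close>, which occurs for no marked row and for very many. A second value column adds
  up the bare weights; monotone rounding keeps this sum \<open>S\<close> at least as large as each
  weight, so \<open>S = 0\<close> singles out the empty case. In the other direction the obstacle is
  that equal values need not be equal floats: stability of repeated addition has to be proved for
  the signs of zeros as well. Residual connections never erase anything, so every subformula gets
  private coordinates that are still 0 when they are written; this makes each of these additions
  exact.\<close>

text \<open>The weight of the last significand bit at exponent \<open>e\<close>; \<open>mag F 0\<close> is the least positive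
  float.\<close>

definition mag :: "fmt \<Rightarrow> nat \<Rightarrow> real" where
  "mag F e = 2 powi (int e - bias F - (int (prec F) - 1))"

lemma mag_pos [simp]: "mag F e > 0"
  by (simp add: mag_def)

lemma mag_Suc: "mag F (Suc e) = 2 * mag F e"
proof -
  have "int (Suc e) - bias F - (int (prec F) - 1) = (int e - bias F - (int (prec F) - 1)) + 1"
    by simp
  then show ?thesis
    unfolding mag_def by (simp only:) (subst power_int_add, auto)
qed

lemma mag_power: "mag F (e + n) = 2 ^ n * mag F e"
  by (induction n) (simp_all add: mag_Suc)

lemma fp_val_Fin:
  assumes "1 \<le> prec F"
  shows "fp_val F (Fin b e s) = (if b then - 1 else 1) * (real s * mag F e)"
proof -
  have "mag F e = 2 powi (int e - bias F) / 2 ^ (prec F - 1)"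
    using assms by (simp add: mag_def power_int_diff of_nat_diff flip: power_int_of_nat)
  then show ?thesis by simp
qed

declare fp_val.simps [simp del]

text \<open>Signed zeros are identified: both have the value 0.\<close>

definition fv :: "fmt \<Rightarrow> fp \<Rightarrow> real \<Rightarrow> bool" where
  "fv F x r \<longleftrightarrow> x \<in> fin_floats F \<and> fp_val F x = r"

definition representable :: "fmt \<Rightarrow> real \<Rightarrow> bool" where
  "representable F r \<longleftrightarrow> (\<exists>x. fv F x r)"

lemma fvD: "fv F x r \<Longrightarrow> x \<in> fin_floats F" "fv F x r \<Longrightarrow> fp_val F x = r"
  by (auto simp: fv_def)

lemma fv_unique: "fv F x r \<Longrightarrow> fv F x s \<Longrightarrow> r = s"
  by (simp add: fv_def)

lemma fv_self: "x \<in> fin_floats F \<Longrightarrow> fv F x (fp_val F x)"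
  by (simp add: fv_def)

lemma representableI: "fv F x r \<Longrightarrow> representable F r"
  by (auto simp: representable_def)

lemma finite_fin_floats: "finite (fin_floats F)"
proof (rule finite_subset)
  show "fin_floats F \<subseteq> (\<lambda>(b, e, s). Fin b e s) ` (UNIV \<times> {..<2 ^ ebits F} \<times> {..<2 ^ prec F})"
  proof
    fix x assume "x \<in> fin_floats F"
    then obtain b e s where "x = Fin b e s" "e < 2 ^ ebits F" "s < 2 ^ prec F"
      unfolding fin_floats_def by blast
    then show "x \<in> (\<lambda>(b, e, s). Fin b e s) ` (UNIV \<times> {..<2 ^ ebits F} \<times> {..<2 ^ prec F})"
      by (intro image_eqI[of _ _ "(b, e, s)"]) auto
  qed
qed auto

lemma finite_floats: "finite (floats F)"
  by (simp add: floats_def finite_fin_floats)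

lemma fin_floats_subset: "fin_floats F \<subseteq> floats F"
  by (auto simp: floats_def)

lemma zero_fin_floats [simp]: "Fin b 0 0 \<in> fin_floats F"
  by (simp add: fin_floats_def)

lemma fp_val_zero [simp]: "fp_val F (Fin b e 0) = 0"
  by (simp add: fp_val.simps)

lemma fv_zero [simp]: "fv F (Fin b 0 0) 0"
  by (simp add: fv_def)

lemma representable_zero [simp]: "representable F 0"
  using fv_zero representableI by blast

lemma fin_floatsE:
  assumes "x \<in> fin_floats F"
  obtains b e s where "x = Fin b e s" "e < 2 ^ ebits F" "s < 2 ^ prec F"
    "2 ^ (prec F - 1) \<le> s \<or> e = 0"
  using assms by (auto simp: fin_floats_def)

lemma fp_uminus_fv: "fv F x r \<Longrightarrow> fv F (fp_uminus x) (- r)"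
  by (cases x) (auto simp: fv_def fin_floats_def fp_val.simps)

lemma representable_uminus: "representable F r \<Longrightarrow> representable F (- r)"
  unfolding representable_def using fp_uminus_fv by blast

lemma representable_uminus_iff [simp]: "representable F (- r) \<longleftrightarrow> representable F r"
  using representable_uminus[of F r] representable_uminus[of F "- r"] by auto

lemma fp_uminus_floats: "x \<in> floats F \<Longrightarrow> fp_uminus x \<in> floats F"
  by (cases x) (auto simp: floats_def fin_floats_def)

section \<open>Finite floats: signs, range and rounding\<close>

context
  fixes F :: fmt
  assumes F: "valid_fmt F"
begin

lemma prec_pos: "1 \<le> prec F" and ebits_pos: "1 \<le> ebits F"
  using F by (auto simp: valid_fmt_def)

lemma two_pow_ebits: "(2::int) ^ ebits F = 2 * bias F + 2"
proof -
  have "ebits F = Suc (ebits F - 1)" using ebits_pos by simp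
  then have "(2::int) ^ ebits F = 2 * 2 ^ (ebits F - 1)" by (metis power_Suc)
  then show ?thesis by (simp add: bias_def)
qed

lemma bias_nonneg: "0 \<le> bias F"
  by (simp add: bias_def)

lemma fp_val_sign:
  assumes "x \<in> fin_floats F"
  shows "neg x \<Longrightarrow> fp_val F x \<le> 0" "\<not> neg x \<Longrightarrow> 0 \<le> fp_val F x"
  using assms prec_pos by (auto simp: fin_floats_def fp_val_Fin less_imp_le)

lemma fp_val_eq_zero:
  assumes "fv F x 0" shows "\<exists>b. x = Fin b 0 0"
proof -
  from assms obtain b e s where x: "x = Fin b e s" "2 ^ (prec F - 1) \<le> s \<or> e = 0"
    unfolding fv_def by (auto elim!: fin_floatsE)
  have "real s * mag F e = 0"
    using assms prec_pos by (auto simp: fv_def x fp_val_Fin split: if_splits)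
  then have "s = 0" by (simp add: mag_pos[THEN less_imp_neq, symmetric])
  with x show ?thesis by auto
qed

lemma mag_max: "2 powi (2 ^ ebits F - 1 - bias F - (int (prec F) - 1)) = mag F (2 ^ ebits F - 1)"
proof -
  have "int (2 ^ ebits F - 1) = 2 ^ ebits F - 1"
    by (simp add: of_nat_diff)
  then show ?thesis unfolding mag_def by presburger
qed

lemma mag_mono: "e \<le> e' \<Longrightarrow> mag F e \<le> mag F e'"
  unfolding mag_def by (intro power_int_increasing) auto

lemma fp_val_less_overflow:
  assumes "x \<in> fin_floats F"
  shows "\<bar>fp_val F x\<bar> < overflow_bound F"
proof -
  from assms obtain b e s where x: "x = Fin b e s" "e < 2 ^ ebits F" "s < 2 ^ prec F"
    by (auto elim!: fin_floatsE)
  have "real s \<le> 2 ^ prec F - 1"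
  proof -
    have "s + 1 \<le> 2 ^ prec F" using x by simp
    then have "real (s + 1) \<le> real (2 ^ prec F)" by (rule of_nat_mono)
    then show ?thesis by simp
  qed
  moreover have "mag F e \<le> mag F (2 ^ ebits F - 1)"
    using x by (intro mag_mono) simp
  ultimately have "real s * mag F e \<le> (2 ^ prec F - 1) * mag F (2 ^ ebits F - 1)"
    by (intro mult_mono) (auto simp: less_imp_le)
  also have "\<dots> < (2 ^ prec F - 1 / 2) * mag F (2 ^ ebits F - 1)"
    by simp
  finally have "real s * mag F e < overflow_bound F"
    by (simp only: overflow_bound_def mag_max)
  moreover have "\<bar>fp_val F x\<bar> = real s * mag F e"
    using prec_pos by (simp add: x fp_val_Fin abs_mult less_imp_le)
  ultimately show ?thesis by simp
qed

lemma fv_less_overflow: "fv F x r \<Longrightarrow> \<bar>r\<bar> < overflow_bound F"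
  using fp_val_less_overflow by (auto simp: fv_def)

text \<open>A closest float may carry the wrong sign. Then it and \<open>r\<close> do not lie
  strictly on the same side of 0, so the zero with sign \<open>b\<close> is at least as close and
  takes its place.\<close>

lemma nearest_nonempty:
  assumes "r = 0 \<or> b = (r < 0)"
  shows "nearest F b r \<noteq> {}"
proof -
  define y where "y = arg_min_on (\<lambda>x. \<bar>fp_val F x - r\<bar>) (fin_floats F)"
  have ne: "fin_floats F \<noteq> {}" using zero_fin_floats by blast
  have y: "y \<in> fin_floats F" "\<And>x. x \<in> fin_floats F \<Longrightarrow> \<bar>fp_val F y - r\<bar> \<le> \<bar>fp_val F x - r\<bar>"
    unfolding y_def using finite_fin_floats ne
    by (auto intro: arg_min_if_finite arg_min_least)
  show ?thesis
  proof (cases "neg y = b")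
    case True
    then show ?thesis using y by (auto simp: nearest_def)
  next
    case False
    have "\<bar>fp_val F (Fin b 0 0) - r\<bar> \<le> \<bar>fp_val F y - r\<bar>"
      using fp_val_sign[OF y(1)] False assms by (cases b) auto
    then have "Fin b 0 0 \<in> nearest F b r"
      using y(2) by (auto simp: nearest_def intro: order_trans)
    then show ?thesis by blast
  qed
qed

text \<open>The choice in \<open>fp_round\<close> has a witness: if no candidate has an even
  significand, a candidate of largest magnitude satisfies the second disjunct.\<close>

lemma fp_round_nearest:
  assumes "\<bar>r\<bar> < overflow_bound F"
  shows "fp_round F z r \<in> nearest F (if r = 0 then z else r < 0) r"
proof -
  define N where "N = nearest F (if r = 0 then z else r < 0) r"
  have fin: "finite N" unfolding N_def nearest_def by (simp add: finite_fin_floats)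
  have ne: "N \<noteq> {}" unfolding N_def by (rule nearest_nonempty) auto
  have "\<exists>x. x \<in> N \<and> (even (signif x) \<or> (\<forall>y\<in>N. odd (signif y) \<and> \<bar>fp_val F y\<bar> \<le> \<bar>fp_val F x\<bar>))"
  proof (cases "\<exists>x\<in>N. even (signif x)")
    case False
    define m where "m = Max ((\<lambda>y. \<bar>fp_val F y\<bar>) ` N)"
    have "m \<in> (\<lambda>y. \<bar>fp_val F y\<bar>) ` N" unfolding m_def using fin ne by (intro Max_in) auto
    then obtain x where "x \<in> N" "m = \<bar>fp_val F x\<bar>" by auto
    moreover have "\<bar>fp_val F y\<bar> \<le> m" if "y \<in> N" for y
      unfolding m_def using fin that by auto
    ultimately show ?thesis using False by auto
  qed auto
  from someI_ex[OF this] show ?thesis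
    using assms unfolding fp_round_def N_def Let_def by simp
qed

lemma fp_round_fin:
  assumes "\<bar>r\<bar> < overflow_bound F"
  shows "fp_round F z r \<in> fin_floats F"
    and "neg (fp_round F z r) = (if r = 0 then z else r < 0)"
    and "representable F y \<Longrightarrow> \<bar>fp_val F (fp_round F z r) - r\<bar> \<le> \<bar>y - r\<bar>"
  using fp_round_nearest[OF assms, of z] unfolding nearest_def representable_def fv_def by auto

lemma fp_round_floats [simp]: "fp_round F z r \<in> floats F"
proof (cases "\<bar>r\<bar> < overflow_bound F")
  case True
  then show ?thesis using fp_round_fin(1) fin_floats_subset by blast
next
  case False
  then show ?thesis by (auto simp: fp_round_def floats_def)
qed

lemma fp_round_exact: "representable F r \<Longrightarrow> fv F (fp_round F z r) r"
proof -
  assume r: "representable F r"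
  then have "\<bar>r\<bar> < overflow_bound F" unfolding representable_def using fv_less_overflow by blast
  with fp_round_fin(1)[OF this] fp_round_fin(3)[OF this r] show ?thesis
    by (simp add: fv_def)
qed

lemma fp_round_le:
  assumes "representable F y" "r \<le> y" "\<bar>r\<bar> < overflow_bound F"
  shows "fp_val F (fp_round F z r) \<le> y"
  using fp_round_fin(3)[OF assms(3,1), of z] assms(2) by auto

lemma fp_round_ge:
  assumes "representable F y" "y \<le> r" "\<bar>r\<bar> < overflow_bound F"
  shows "y \<le> fp_val F (fp_round F z r)"
  using fp_round_fin(3)[OF assms(3,1), of z] assms(2) by auto

lemma fp_add_floats: "x \<in> floats F \<Longrightarrow> y \<in> floats F \<Longrightarrow> fp_add F x y \<in> floats F"
  using fp_round_floats by (cases x; cases y) (auto simp: floats_def)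

lemma fp_mult_floats: "x \<in> floats F \<Longrightarrow> y \<in> floats F \<Longrightarrow> fp_mult F x y \<in> floats F"
  using fp_round_floats by (cases x; cases y) (auto simp: floats_def)

lemma fp_div_floats: "x \<in> floats F \<Longrightarrow> y \<in> floats F \<Longrightarrow> fp_div F x y \<in> floats F"
  using fp_round_floats by (cases x; cases y) (auto simp: floats_def)

lemma fp_sub_floats: "x \<in> floats F \<Longrightarrow> y \<in> floats F \<Longrightarrow> fp_sub F x y \<in> floats F"
  by (simp add: fp_sub_def fp_add_floats fp_uminus_floats)

lemma fp_relu_floats: "x \<in> floats F \<Longrightarrow> fp_relu x \<in> floats F"
  by (cases x) (auto simp: floats_def)

lemma fp_add_fin:
  assumes "x \<in> fin_floats F" "y \<in> fin_floats F"
  shows "fp_add F x y = fp_round F (neg x \<and> neg y) (fp_val F x + fp_val F y)"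
  using assms by (auto simp: fin_floats_def)

lemma fp_mult_fin:
  assumes "x \<in> fin_floats F" "y \<in> fin_floats F"
  shows "fp_mult F x y = fp_round F (neg x \<noteq> neg y) (fp_val F x * fp_val F y)"
  using assms by (auto simp: fin_floats_def)

lemma fp_div_fin:
  assumes "x \<in> fin_floats F" "y \<in> fin_floats F" "fp_val F y \<noteq> 0"
  shows "fp_div F x y = fp_round F (neg x \<noteq> neg y) (fp_val F x / fp_val F y)"
  using assms by (auto simp: fin_floats_def)

lemma fv_add:
  assumes "fv F x a" "fv F y b" "representable F (a + b)"
  shows "fv F (fp_add F x y) (a + b)"
  using assms fp_round_exact by (auto simp: fv_def fp_add_fin)

lemma fv_mult:
  assumes "fv F x a" "fv F y b" "representable F (a * b)"
  shows "fv F (fp_mult F x y) (a * b)"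
  using assms fp_round_exact by (auto simp: fv_def fp_mult_fin)

lemma fv_div:
  assumes "fv F x a" "fv F y b" "b \<noteq> 0" "representable F (a / b)"
  shows "fv F (fp_div F x y) (a / b)"
  using assms fp_round_exact by (auto simp: fv_def fp_div_fin)

lemma fp_relu_fv:
  assumes "fv F x a" shows "fv F (fp_relu x) (max 0 a)"
proof -
  have x: "x \<in> fin_floats F" "fp_val F x = a" using assms by (auto simp: fv_def)
  then obtain b e s where "x = Fin b e s" by (auto elim: fin_floatsE)
  with fp_val_sign[OF x(1)] x show ?thesis
    by (cases "neg x") (auto simp: fv_def)
qed

text \<open>A significand without its leading bit is doubled while the exponent drops by one; this
  ends at a normalised float or at exponent 0, where no leading bit is demanded.\<close>

lemma representable_mag: "s < 2 ^ prec F \<Longrightarrow> e < 2 ^ ebits F \<Longrightarrow> representable F (real s * mag F e)"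
proof (induction e arbitrary: s)
  case 0
  then have "fv F (Fin False 0 s) (real s * mag F 0)"
    using prec_pos by (auto simp: fv_def fin_floats_def fp_val_Fin)
  then show ?case by (rule representableI)
next
  case (Suc e)
  show ?case
  proof (cases "2 ^ (prec F - 1) \<le> s")
    case True
    then have "fv F (Fin False (Suc e) s) (real s * mag F (Suc e))"
      using Suc.prems prec_pos by (auto simp: fv_def fin_floats_def fp_val_Fin)
    then show ?thesis by (rule representableI)
  next
    case False
    have "prec F = Suc (prec F - 1)" using prec_pos by simp
    then have "(2::nat) ^ prec F = 2 * 2 ^ (prec F - 1)" by (metis power_Suc)
    with False have "2 * s < 2 ^ prec F" by simp
    from Suc.IH[OF this] Suc.prems show ?thesis by (simp add: mag_Suc algebra_simps)
  qed
qed

text \<open>The bound \<open>2 ^ prec F\<close> is inclusive: that significand is halved and the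
  exponent raised by one, and the upper bound on \<open>a\<close> leaves room for this.\<close>

lemma representable_grid_nat:
  assumes "s \<le> 2 ^ prec F" "- bias F - int (prec F) + 1 \<le> a" "a \<le> bias F + 1 - int (prec F)"
  shows "representable F (real s * 2 powi a)"
proof -
  define e where "e = nat (a + bias F + int (prec F) - 1)"
  have e: "int e = a + bias F + int (prec F) - 1" using assms(2) by (simp add: e_def)
  have "int e + 1 < 2 ^ ebits F" using assms(3) two_pow_ebits by (simp add: e)
  then have e2: "Suc e < 2 ^ ebits F"
    by (metis Suc_eq_plus1 of_nat_1 of_nat_add of_nat_less_iff of_nat_numeral of_nat_power)
  have mag: "mag F e = 2 powi a" by (simp add: mag_def e)
  show ?thesis
  proof (cases "s = 2 ^ prec F")
    case True
    have p: "prec F = Suc (prec F - 1)" using prec_pos by simp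
    have "representable F (real (2 ^ (prec F - 1)) * mag F (Suc e))"
      using e2 prec_pos by (intro representable_mag) auto
    moreover have "real (2 ^ (prec F - 1)) * mag F (Suc e) = real s * 2 powi a"
      unfolding True mag[symmetric] mag_Suc by (subst (2) p) simp
    ultimately show ?thesis by simp
  next
    case False
    then show ?thesis using representable_mag[of s e] assms(1) e2 mag by simp
  qed
qed

lemma representable_grid:
  assumes "\<bar>i\<bar> \<le> 2 ^ prec F" "- bias F - int (prec F) + 1 \<le> a" "a \<le> bias F + 1 - int (prec F)"
  shows "representable F (of_int i * 2 powi a)"
proof -
  have "nat \<bar>i\<bar> \<le> nat (2 ^ prec F)" using assms(1) by linarith
  then have "nat \<bar>i\<bar> \<le> 2 ^ prec F" by (simp add: nat_power_eq)
  from representable_grid_nat[OF this assms(2,3)]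
  have *: "representable F (of_int \<bar>i\<bar> * 2 powi a)" by simp
  show ?thesis
  proof (cases "0 \<le> i")
    case True then show ?thesis using * by simp
  next
    case False
    then have "of_int i * 2 powi a = - (of_int \<bar>i\<bar> * 2 powi a :: real)" by simp
    then show ?thesis using * by (metis representable_uminus_iff)
  qed
qed

lemma fp_val_multiple_mag0:
  assumes "x \<in> fin_floats F" shows "\<exists>i::int. fp_val F x = of_int i * mag F 0"
proof -
  from assms obtain b e s where x: "x = Fin b e s" by (auto elim: fin_floatsE)
  have "mag F e = 2 ^ e * mag F 0" using mag_power[of F 0 e] by simp
  then have "fp_val F x = of_int ((if b then -1 else 1) * (int s * 2 ^ e)) * mag F 0"
    using prec_pos by (simp add: x fp_val_Fin)
  then show ?thesis by blast
qed

text \<open>A float above \<open>2 ^ p * mag e\<close> has an exponent larger than \<open>e\<close>.\<close>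

lemma fp_val_gap:
  assumes "x \<in> fin_floats F" "2 ^ prec F * mag F e < fp_val F x"
  shows "2 ^ prec F * mag F e + 2 * mag F e \<le> fp_val F x"
proof -
  from assms(1) obtain b e' s where x: "x = Fin b e' s" "s < 2 ^ prec F" by (auto elim: fin_floatsE)
  have "0 < fp_val F x"
    by (rule le_less_trans[OF _ assms(2)]) (simp add: less_imp_le)
  then have b: "\<not> b" using fp_val_sign(1)[OF assms(1)] x by auto
  have val: "fp_val F x = real s * mag F e'" using b x prec_pos by (simp add: fp_val_Fin)
  have "e < e'"
  proof (rule ccontr)
    assume "\<not> e < e'"
    then have "mag F e' \<le> mag F e" by (intro mag_mono) simp
    moreover have "real s \<le> 2 ^ prec F" using x(2)
      by (metis less_imp_le of_nat_le_iff of_nat_numeral of_nat_power)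
    ultimately have "real s * mag F e' \<le> 2 ^ prec F * mag F e"
      by (intro mult_mono) (auto simp: less_imp_le)
    with assms(2) val show False by simp
  qed
  then obtain n where e': "e' = e + Suc n" using less_imp_Suc_add by auto
  have m: "mag F e' = 2 ^ n * (2 * mag F e)" unfolding e' mag_power by simp
  have p: "prec F = Suc (prec F - 1)" using prec_pos by simp
  have "(2::real) ^ prec F = 2 ^ (prec F - 1) * 2" by (metis p power_Suc2)
  then have pm: "2 ^ prec F * mag F e = real (2 ^ (prec F - 1)) * (2 * mag F e)" by simp
  moreover have sm: "real s * mag F e' = real (s * 2 ^ n) * (2 * mag F e)" by (simp add: m)
  ultimately have "real (2 ^ (prec F - 1)) * (2 * mag F e) < real (s * 2 ^ n) * (2 * mag F e)"
    using assms(2) by (simp only: val)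
  then have "real (2 ^ (prec F - 1)) < real (s * 2 ^ n)" 
    by (subst (asm) mult_less_cancel_right_pos) auto
  then have "2 ^ (prec F - 1) + 1 \<le> s * 2 ^ n" by (subst (asm) of_nat_less_iff) simp
  then have "real (2 ^ (prec F - 1) + 1) \<le> real (s * 2 ^ n)" by (rule of_nat_mono)
  then have "real (2 ^ (prec F - 1) + 1) * (2 * mag F e) \<le> real (s * 2 ^ n) * (2 * mag F e)"
    by (rule mult_right_mono) (simp add: less_imp_le)
  moreover have "2 ^ prec F * mag F e + 2 * mag F e = real (2 ^ (prec F - 1) + 1) * (2 * mag F e)"
    unfolding pm by (simp add: distrib_right)
  ultimately show ?thesis by (simp only: val sm)
qed

section \<open>The integer key of a float and sorting by it\<close>

lemma fp_key_mag_less: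
  assumes "e < 2 ^ ebits F" "s < 2 ^ prec F"
  shows "int e * 2 ^ prec F + int s < 2 ^ (prec F + ebits F)"
proof -
  have "e * 2 ^ prec F + s < (e + 1) * 2 ^ prec F" using assms(2) by simp
  also have "\<dots> \<le> 2 ^ ebits F * 2 ^ prec F" using assms(1) by (intro mult_right_mono) auto
  finally have "int (e * 2 ^ prec F + s) < int (2 ^ ebits F * 2 ^ prec F)" by (subst of_nat_less_iff)
  then show ?thesis by (simp add: power_add mult.commute)
qed

lemma fp_key_fin_bounds:
  assumes "x \<in> fin_floats F"
  shows "- (2 ^ (prec F + ebits F)) \<le> fp_key F x" "fp_key F x < 2 ^ (prec F + ebits F)"
proof -
  define P :: int where "P = 2 ^ (prec F + ebits F)"
  from assms obtain b e s where x: "x = Fin b e s" "e < 2 ^ ebits F" "s < 2 ^ prec F"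
    by (auto elim: fin_floatsE)
  define m where "m = int e * 2 ^ prec F + int s"
  have m: "0 \<le> m" "m < P" using fp_key_mag_less[OF x(2,3)] by (auto simp: m_def P_def)
  have "fp_key F x = (if b then - m - 1 else m)" by (simp add: x m_def Let_def)
  with m show "- (2 ^ (prec F + ebits F)) \<le> fp_key F x" "fp_key F x < 2 ^ (prec F + ebits F)"
    unfolding P_def[symmetric] by (simp_all split: if_splits)
qed

text \<open>Division with remainder by \<open>2 ^ prec F\<close> recovers exponent and significand,
  the shift to \<open>- m - 1\<close> separates \<open>-0\<close> from \<open>+0\<close>, and the
  keys of the infinities and of \<open>NaN\<close> lie outside the range of the finite keys.\<close>

lemma fp_key_inj: "inj_on (fp_key F) (floats F)"
proof -
  define m where "m e s = int e * 2 ^ prec F + int s" for e s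
  have m: "0 \<le> m e s" "m e s < 2 ^ (prec F + ebits F)"
    "m e s div 2 ^ prec F = int e" "m e s mod 2 ^ prec F = int s"
    if "e < 2 ^ ebits F" "s < 2 ^ prec F" for e s
  proof -
    have s: "int s < 2 ^ prec F" using that(2) by (metis of_nat_less_iff of_nat_numeral of_nat_power)
    show "m e s < 2 ^ (prec F + ebits F)"
      using fp_key_mag_less[OF that] by (simp add: m_def)
    show "0 \<le> m e s" by (simp add: m_def)
    show "m e s div 2 ^ prec F = int e" "m e s mod 2 ^ prec F = int s"
      using s by (simp_all add: m_def)
  qed
  have key: "fp_key F (Fin b e s) = (if b then - m e s - 1 else m e s)" for b e s
    by (simp add: m_def Let_def)
  show ?thesis
  proof (rule inj_onI)
    fix x y assume xy: "x \<in> floats F" "y \<in> floats F" "fp_key F x = fp_key F y"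
    have fin: "\<exists>b e s. z = Fin b e s \<and> e < 2 ^ ebits F \<and> s < 2 ^ prec F" 
      if "z \<in> fin_floats F" for z using that by (auto elim: fin_floatsE)
    show "x = y"
    proof (cases "x \<in> fin_floats F \<and> y \<in> fin_floats F")
      case True
      then have "x \<in> fin_floats F" "y \<in> fin_floats F" by auto
      from fin[OF this(1)] fin[OF this(2)]
      obtain b e s b' e' s' where *: "x = Fin b e s" "e < 2 ^ ebits F" "s < 2 ^ prec F"
        "y = Fin b' e' s'" "e' < 2 ^ ebits F" "s' < 2 ^ prec F"
        by blast
      have "b = b' \<and> m e s = m e' s'"
        using xy(3) m(1)[OF *(2,3)] m(1)[OF *(5,6)] by (auto simp: * key simp del: fp_key.simps(1) split: if_splits)
      then show ?thesis using m(3,4)[OF *(2,3)] m(3,4)[OF *(5,6)] * by auto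
    next
      case False
      define P :: int where "P = 2 ^ (prec F + ebits F)"
      have P: "0 < P" by (simp add: P_def)
      have key: "fp_key F (Inf b) = (if b then - P - 1 else P)" "fp_key F NaN = P + 1" for b
        by (simp_all add: P_def Let_def)
      from False P xy fp_key_fin_bounds[of x] fp_key_fin_bounds[of y] show ?thesis
        unfolding floats_def P_def[symmetric] by (auto simp: key simp del: fp_key.simps)
    qed
  qed
qed

lemma fp_key_minus_infinity:
  assumes "x \<in> floats F"
  shows "x \<noteq> Inf True \<Longrightarrow> fp_key F (Inf True) < fp_key F x"
proof -
  define P :: int where "P = 2 ^ (prec F + ebits F)"
  have P: "0 < P" by (simp add: P_def)
  have key: "fp_key F (Inf b) = (if b then - P - 1 else P)" "fp_key F NaN = P + 1" for b
    by (simp_all add: P_def Let_def)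
  show "x \<noteq> Inf True \<Longrightarrow> fp_key F (Inf True) < fp_key F x"
    using assms P fp_key_fin_bounds[of x] unfolding floats_def P_def[symmetric]
    by (auto simp: key simp del: fp_key.simps)
qed

text \<open>Elements with equal keys could keep their input order under sorting; injectivity of the
  key on floats excludes such ties.\<close>

lemma sort_fp_key_cong:
  assumes "mset xs = mset ys" "set xs \<subseteq> floats F"
  shows "sort_key (fp_key F) xs = sort_key (fp_key F) ys"
proof -
  have 1: "map (fp_key F) (sort_key (fp_key F) zs) = sort (map (fp_key F) zs)" for zs
    by (rule properties_for_sort[symmetric]) auto
  have s: "set ys = set xs" using assms(1) by (metis set_mset_mset)
  have "map (fp_key F) (sort_key (fp_key F) xs) = map (fp_key F) (sort_key (fp_key F) ys)"
    unfolding 1 using assms(1) by (intro properties_for_sort) auto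
  then show ?thesis
    by (rule map_inj_on) (use fp_key_inj assms(2) s in \<open>auto intro: inj_on_subset\<close>)
qed

lemma fp_sum_cong_mset:
  "mset xs = mset ys \<Longrightarrow> set xs \<subseteq> floats F \<Longrightarrow> fp_sum F xs = fp_sum F ys"
  unfolding fp_sum_def by (simp add: sort_fp_key_cong)

lemma foldl_fp_add_floats:
  "a \<in> floats F \<Longrightarrow> set xs \<subseteq> floats F \<Longrightarrow> foldl (fp_add F) a xs \<in> floats F"
  by (induction xs arbitrary: a) (auto simp: fp_add_floats)

lemma zero_floats [simp]: "Fin b 0 0 \<in> floats F"
  using zero_fin_floats fin_floats_subset by blast

lemma fp_sum_floats: "set xs \<subseteq> floats F \<Longrightarrow> fp_sum F xs \<in> floats F"
  unfolding fp_sum_def by (intro foldl_fp_add_floats) auto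

section \<open>Repeated addition of the same float\<close>

text \<open>Rounding never crosses a representable number, so adding \<open>z\<close> moves the
  value of the accumulator in one direction only, and on a cycle the values are constant. What may
  still vary is the sign of a zero, and that is settled after one step.\<close>

lemma fp_add_fin_no_cycle:
  assumes z: "z \<in> fin_floats F" and n: "0 < n"
    and fin: "\<And>j. ((\<lambda>a. fp_add F a z) ^^ j) a \<in> fin_floats F"
    and cyc: "((\<lambda>a. fp_add F a z) ^^ n) a = a"
  shows "fp_add F a z = a"
proof -
  define f where "f = (\<lambda>a. fp_add F a z)"
  define o' where "o' j = (f ^^ j) a" for j
  have o'_fin: "o' j \<in> fin_floats F" for j using fin by (simp add: o'_def f_def)
  have o'_Suc: "o' (Suc j) = fp_round F (neg (o' j) \<and> neg z) (fp_val F (o' j) + fp_val F z)" for j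
    using fp_add_fin[OF o'_fin[of j] z] by (simp add: o'_def f_def)
  have cyc': "o' (j + n * i) = o' j" for i j
  proof (induction i)
    case (Suc i)
    have "o' (j + n * Suc i) = (f ^^ (j + n * i)) ((f ^^ n) a)"
      unfolding o'_def mult_Suc_right add.commute[of n] add.assoc[symmetric] funpow_add[of _ n] comp_apply ..
    then show ?case using Suc cyc by (simp add: o'_def f_def)
  qed simp
  have novf: "\<bar>fp_val F (o' j) + fp_val F z\<bar> < overflow_bound F" for j
  proof (rule ccontr)
    assume "\<not> ?thesis"
    then have "o' (Suc j) = Inf (fp_val F (o' j) + fp_val F z < 0)"
      unfolding o'_Suc by (simp add: fp_round_def)
    then show False using o'_fin[of "Suc j"] by (auto simp: fin_floats_def)
  qed
  have rep: "representable F (fp_val F (o' j))" for j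
    using fv_self[OF o'_fin] representableI by blast
  have const: "fp_val F (o' j) = fp_val F a" for j
  proof -
    define v where "v j = fp_val F (o' j)" for j
    have per: "v (j + n * i) = v j" for i j by (simp add: v_def cyc')
    have "mono v \<or> antimono v"
    proof (cases "0 \<le> fp_val F z")
      case True
      then have "v j \<le> v (Suc j)" for j
        unfolding v_def by (subst o'_Suc) (rule fp_round_ge[OF rep _ novf], simp)
      then show ?thesis by (simp add: mono_iff_le_Suc)
    next
      case False
      then have "v (Suc j) \<le> v j" for j
        unfolding v_def by (subst o'_Suc) (rule fp_round_le[OF rep _ novf], simp)
      then show ?thesis by (simp add: antimono_iff_le_Suc)
    qed
    moreover have "j \<le> 0 + n * j" using n by simp
    ultimately have "v j = v 0"
      using per[of 0 j] by (auto simp: mono_def antimono_def dest: spec[of _ j]) 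
        (metis \<open>j \<le> 0 + n * j\<close> add_0 antisym le0)+
    then show ?thesis by (simp add: v_def o'_def)
  qed
  \<comment> \<open>Constant values do not tell \<open>+0\<close> from \<open>-0\<close>. An exact
    zero sum is negative only if both summands are, so with \<open>neg z\<close> the sign never
    changes, and otherwise it is positive from the first step on.\<close>
  have "o' (Suc j) = o' (Suc 0)" for j
  proof (cases "fp_val F a + fp_val F z = 0")
    case False
    then show ?thesis unfolding o'_Suc const by (simp add: fp_round_def)
  next
    case True
    have sgn: "neg (o' (Suc j)) = (neg (o' j) \<and> neg z)" for j
      using fp_round_fin(2)[OF novf[of j]] True by (simp add: o'_Suc const)
    show ?thesis
    proof (cases "neg z")
      case True
      then have "neg (o' j) = neg a" for j by (induction j) (simp_all add: sgn, simp add: o'_def)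
      then show ?thesis unfolding o'_Suc const by simp
    next
      case False
      then show ?thesis unfolding o'_Suc const by simp
    qed
  qed
  from this[of "n - 1"] n have "o' n = f a" by (simp add: o'_def)
  with cyc show ?thesis by (simp add: o'_def f_def)
qed

text \<open>A non-finite \<open>z\<close> forces the sum into an absorbing value at once. For finite
  \<open>z\<close> an orbit that leaves the finite floats stays where it lands, and returning to
  \<open>a\<close> forces \<open>a\<close> to be that value.\<close>

lemma fp_add_no_cycle:
  assumes z: "z \<in> floats F" and a: "a \<in> floats F" and n: "0 < n"
    and cyc: "((\<lambda>a. fp_add F a z) ^^ n) a = a"
  shows "fp_add F a z = a"
proof -
  let ?f = "\<lambda>a. fp_add F a z"
  obtain n' where n': "n = Suc n'" using n gr0_implies_Suc by blast
  have img: "a = ?f ((?f ^^ n') a)" using cyc by (simp add: n')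
  have fl: "(?f ^^ j) a \<in> floats F" for j by (induction j) (auto simp: a z fp_add_floats)
  show ?thesis
  proof (cases "z \<in> fin_floats F")
    case False
    then consider "z = NaN" | b where "z = Inf b" using z by (auto simp: floats_def)
    then show ?thesis
    proof cases
      case 1
      then have "fp_add F x z = NaN" for x by (cases x) auto
      then show ?thesis using img by metis
    next
      case 2
      then have "fp_add F x z \<in> {Inf b, NaN}" for x by (cases x) auto
      then have "a \<in> {Inf b, NaN}" using img by metis
      then show ?thesis using 2 by auto
    qed
  next
    case True
    show ?thesis
    proof (cases "\<forall>j. (?f ^^ j) a \<in> fin_floats F")
      case True
      then show ?thesis using fp_add_fin_no_cycle[OF \<open>z \<in> fin_floats F\<close> n _ cyc] by blast
    next
      case False
      have fixp: "?f x = x" if "x \<in> floats F - fin_floats F" for x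
        using that True by (cases z) (auto simp: floats_def fin_floats_def)
      from False obtain j where j: "(?f ^^ j) a \<in> floats F - fin_floats F" using fl by blast
      have stay: "(?f ^^ (i + j)) a = (?f ^^ j) a" for i
        using fixp[OF j] by (induction i) auto
      have "(?f ^^ (n * i)) a = a" for i
        using cyc by (induction i) (auto simp: funpow_add)
      then have "a = (?f ^^ (n * j)) a" by simp
      also have "\<dots> = (?f ^^ ((n * j - j) + j)) a" using n by (simp add: n' add.commute)
      also have "\<dots> = (?f ^^ j) a" by (rule stay)
      finally show ?thesis using fixp[OF j] by simp
    qed
  qed
qed

text \<open>Among \<open>card (floats F) + 1\<close> iterates two coincide by the pigeonhole
  principle; they span a cycle, hence a fixed point, and everything after it is constant.\<close>

lemma fp_add_iter_stable:
  assumes z: "z \<in> floats F" and a: "a \<in> floats F" and n: "card (floats F) \<le> n"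
  shows "((\<lambda>a. fp_add F a z) ^^ n) a = ((\<lambda>a. fp_add F a z) ^^ card (floats F)) a"
proof -
  let ?f = "\<lambda>a. fp_add F a z" and ?K = "card (floats F)"
  have fl: "(?f ^^ j) a \<in> floats F" for j by (induction j) (auto simp: a z fp_add_floats)
  have "\<not> inj_on (\<lambda>j. (?f ^^ j) a) {..?K}"
  proof
    assume "inj_on (\<lambda>j. (?f ^^ j) a) {..?K}"
    then have "card {..?K} \<le> ?K"
      using fl by (intro card_inj_on_le[where f = "\<lambda>j. (?f ^^ j) a"]) (auto simp: finite_floats)
    then show False by simp
  qed
  then obtain i j where ij: "i < j" "j \<le> ?K" "(?f ^^ i) a = (?f ^^ j) a"
    unfolding inj_on_def by (metis atMost_iff linorder_neqE_nat)
  have "(?f ^^ (j - i)) ((?f ^^ i) a) = (?f ^^ i) a"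
    using ij funpow_add[of "j - i" i ?f] by (metis comp_apply le_add_diff_inverse2 less_imp_le)
  then have fixp: "?f ((?f ^^ i) a) = (?f ^^ i) a"
    using ij by (intro fp_add_no_cycle[OF z fl, of "j - i"]) auto
  have "(?f ^^ (l + i)) a = (?f ^^ i) a" for l
    using fixp by (induction l) auto
  from this[of "n - i"] this[of "?K - i"] ij n show ?thesis by simp
qed

text \<open>Summation in increasing order visits equal floats consecutively. Along a sorted
  enumeration \<open>L\<close> of the whole format it becomes one iterated addition per float, whose
  length is the multiplicity.\<close>

lemma fp_sum_eq_counts:
  assumes "set xs \<subseteq> floats F" and L: "set L = floats F" "sorted (map (fp_key F) L)" "distinct L"
  shows "fp_sum F xs = foldl (\<lambda>a z. ((\<lambda>a. fp_add F a z) ^^ count (mset xs) z) a) fp_zero L"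
proof -
  define ys where "ys = concat (map (\<lambda>z. replicate (count (mset xs) z) z) L)"
  have count: "count (mset (concat (map (\<lambda>z. replicate (c z) z) L'))) x = (if x \<in> set L' then c x else 0)"
    if "distinct L'" for L' c x
    using that by (induction L') auto
  have "mset xs = mset ys"
    unfolding ys_def using assms(1) L(1)
    by (intro multiset_eqI) (auto simp: count[OF L(3)] count_eq_zero_iff)
  have "sorted (map (fp_key F) (concat (map (\<lambda>z. replicate (c z) z) L')))"
    if "sorted (map (fp_key F) L')" for c L'
    using that by (induction L') (auto simp: sorted_append)
  then have "sort_key (fp_key F) ys = ys"
    unfolding ys_def using L(2) by (intro sort_key_id_if_sorted) auto
  moreover have "foldl (fp_add F) a (concat (map (\<lambda>z. replicate (c z) z) L')) =
    foldl (\<lambda>a z. ((\<lambda>a. fp_add F a z) ^^ c z) a) a L'" for a c L'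
  proof (induction L' arbitrary: a)
    case (Cons z L')
    have "foldl (fp_add F) a (replicate n z) = ((\<lambda>a. fp_add F a z) ^^ n) a" for a n
      by (induction n arbitrary: a) (simp_all add: funpow_Suc_right del: funpow.simps(2))
    then show ?case using Cons by simp
  qed simp
  ultimately show ?thesis
    using fp_sum_cong_mset[OF \<open>mset xs = mset ys\<close> assms(1)] by (simp add: fp_sum_def ys_def)
qed

end

section \<open>Equality of multisets up to a cap on multiplicities\<close>

definition cap_eq :: "nat \<Rightarrow> 'b multiset \<Rightarrow> 'b multiset \<Rightarrow> bool" where
  "cap_eq k M N \<longleftrightarrow> (\<forall>x. min k (count M x) = min k (count N x))"

lemma cap_eq_set_mset:
  assumes "1 \<le> k" "cap_eq k M N"
  shows "set_mset M = set_mset N"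
proof -
  from \<open>1 \<le> k\<close> have mem: "x \<in># M \<longleftrightarrow> min k (count M x) \<noteq> 0" for M and x :: 'a
    using count_eq_zero_iff[of M x] by (auto simp: min_def)
  show ?thesis
  proof (rule Set.set_eqI)
    fix x show "x \<in># M \<longleftrightarrow> x \<in># N"
      using assms(2) unfolding mem cap_eq_def by metis
  qed
qed

text \<open>A multiplicity in the image is a sum of multiplicities over a fibre, and addition
  respects equality up to the cap.\<close>

lemma cap_eq_image_mset:
  assumes "1 \<le> k" "cap_eq k M N" shows "cap_eq k (image_mset f M) (image_mset f N)"
proof -
  have *: "min k (sum c S) = min k (sum c' S)"
    if "finite S" "\<And>x. x \<in> S \<Longrightarrow> min k (c x) = min k (c' x)" for S and c c' :: "'a \<Rightarrow> nat"
    using that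
  proof (induction S)
    case (insert x S)
    then have "min k (sum c S) = min k (sum c' S)" "min k (c x) = min k (c' x)" by auto
    then show ?case using insert(1,2) by (auto simp: min_def split: if_splits)
  qed simp
  show ?thesis
    using assms(2) unfolding cap_eq_def count_image_mset cap_eq_set_mset[OF assms]
    by (auto intro!: *)
qed

text \<open>The same bound serves every block of equal summands, whatever accumulator the block
  starts from, so the blocks can be compared one after the other.\<close>

lemma fp_sum_cap_eq:
  assumes F: "valid_fmt F" and k: "card (floats F) \<le> k" and eq: "cap_eq k (mset xs) (mset ys)"
    and fl: "set xs \<subseteq> floats F" "set ys \<subseteq> floats F"
  shows "fp_sum F xs = fp_sum F ys"
proof -
  define L where "L = sort_key (fp_key F) (SOME L. set L = floats F \<and> distinct L)"
  have "\<exists>L. set L = floats F \<and> distinct L" using finite_distinct_list[OF finite_floats] by auto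
  from someI_ex[OF this] have L: "set L = floats F" "sorted (map (fp_key F) L)" "distinct L"
    unfolding L_def by auto
  have "foldl (\<lambda>a z. ((\<lambda>a. fp_add F a z) ^^ count (mset xs) z) a) a L' =
        foldl (\<lambda>a z. ((\<lambda>a. fp_add F a z) ^^ count (mset ys) z) a) a L'"
    if "a \<in> floats F" "set L' \<subseteq> floats F" for a L'
    using that
  proof (induction L' arbitrary: a)
    case (Cons z L')
    have z: "z \<in> floats F" using Cons.prems by simp
    have "((\<lambda>a. fp_add F a z) ^^ n) a = ((\<lambda>a. fp_add F a z) ^^ min k n) a" for n
      using fp_add_iter_stable[OF F z Cons.prems(1), of n] fp_add_iter_stable[OF F z Cons.prems(1), of k] k
      by (cases "n \<le> k") (auto simp: min_def)
    then have step: "((\<lambda>a. fp_add F a z) ^^ count (mset xs) z) a = ((\<lambda>a. fp_add F a z) ^^ count (mset ys) z) a"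
      using eq unfolding cap_eq_def by metis
    have "((\<lambda>a. fp_add F a z) ^^ n) a \<in> floats F" for n
      using Cons.prems(1) z by (induction n) (auto simp: fp_add_floats[OF F])
    then show ?case using Cons step by simp
  qed simp
  then show ?thesis
    unfolding fp_sum_eq_counts[OF F fl(1) L] fp_sum_eq_counts[OF F fl(2) L]
    using L(1) zero_floats[OF F] by simp
qed

lemma fp_sum_map_cap_eq:
  assumes F: "valid_fmt F" and k: "card (floats F) \<le> k" and eq: "cap_eq k (mset xs) (mset ys)"
    and fl: "\<And>x. x \<in> set xs \<Longrightarrow> g x \<in> floats F"
  shows "fp_sum F (map g xs) = fp_sum F (map g ys)"
proof -
  have "floats F \<noteq> {}" by (auto simp: floats_def)
  then have k1: "1 \<le> k" using k finite_floats[of F] by (metis One_nat_def Suc_leI card_gt_0_iff order_trans)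
  have "set xs = set ys" using cap_eq_set_mset[OF k1 eq] by simp
  then show ?thesis using fl cap_eq_image_mset[OF k1 eq, of g]
    by (intro fp_sum_cap_eq[OF F k]) auto
qed

section \<open>Transformers row by row\<close>

lemma fvec_iff: "v \<in> fvec F n \<longleftrightarrow> dim_vec v = n \<and> (\<forall>j<n. v $ j \<in> floats F)"
  unfolding fvec_def vec_set_def carrier_vec_def image_subset_iff mem_Collect_eq Ball_def lessThan_iff
  by (cases "dim_vec v = n") simp_all

lemma fmat_iff: "A \<in> fmat F n m \<longleftrightarrow> dim_row A = n \<and> dim_col A = m \<and> (\<forall>i<n. \<forall>j<m. A $$ (i, j) \<in> floats F)"
  unfolding fmat_def elements_mat_def carrier_mat_def by fastforce

lemma fmat_row: "A \<in> fmat F n m \<Longrightarrow> i < n \<Longrightarrow> row A i \<in> fvec F m"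
  by (auto simp: fmat_iff fvec_iff)

lemma fmatI_rows:
  assumes "A \<in> carrier_mat n m" "\<And>i. i < n \<Longrightarrow> row A i \<in> fvec F m" shows "A \<in> fmat F n m"
proof -
  have "A $$ (i, j) \<in> floats F" if "i < n" "j < m" for i j
    using assms(1) assms(2)[OF that(1)] that by (auto simp: fvec_iff)
  then show ?thesis using assms(1) by (auto simp: fmat_iff)
qed

definition vmult :: "fmt \<Rightarrow> fp vec \<Rightarrow> fp mat \<Rightarrow> fp vec" where
  "vmult F x W = vec (dim_col W) (\<lambda>l.
     fp_sum F (map (\<lambda>j. fp_mult F (x $ j) (W $$ (j, l))) [0..<dim_row W]))"

definition vadd :: "fmt \<Rightarrow> fp vec \<Rightarrow> fp vec \<Rightarrow> fp vec" where
  "vadd F a b = vec (dim_vec a) (\<lambda>j. fp_add F (a $ j) (b $ j))"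

text \<open>Softmax indexed by the score instead of the position: equal scores get equal weights,
  which turns a head into a function of a list of rows.\<close>

definition sm_weight :: "(fmt \<Rightarrow> fp \<Rightarrow> fp) \<Rightarrow> fmt \<Rightarrow> fp list \<Rightarrow> fp \<Rightarrow> fp" where
  "sm_weight fexp F ss s =
     (if set ss \<subseteq> {Inf True} then fp_zero
      else fp_div F (fexp F (fp_sub F s (fp_max F ss)))
             (fp_sum F (map (\<lambda>s. fexp F (fp_sub F s (fp_max F ss))) ss)))"

definition score :: "'a transformer \<Rightarrow> head \<Rightarrow> fp vec \<Rightarrow> fp vec \<Rightarrow> fp" where
  "score T H y x = (let F = tfmt T in
     fp_div F
       (fp_sum F (map (\<lambda>j. fp_mult F (vmult F y (wQ H) $ j) (vmult F x (wK H) $ j))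
          [0..<dim_col (wK H)]))
       (fp_round F False (sqrt (real (dim_key T)))))"

text \<open>The list \<open>xs\<close> holds just the visible rows, so masking has become the choice
  of a list.\<close>

definition head_row ::
  "(fmt \<Rightarrow> fp \<Rightarrow> fp) \<Rightarrow> 'a transformer \<Rightarrow> head \<Rightarrow> fp vec list \<Rightarrow> fp vec \<Rightarrow> fp vec" where
  "head_row fexp T H xs y = vec (dim_col (wV H)) (\<lambda>l. fp_sum (tfmt T)
     (map (\<lambda>x. fp_mult (tfmt T)
        (sm_weight fexp (tfmt T) (map (score T H y) xs) (score T H y x))
        (vmult (tfmt T) x (wV H) $ l)) xs))"

definition attn_row ::
  "(fmt \<Rightarrow> fp \<Rightarrow> fp) \<Rightarrow> 'a transformer \<Rightarrow> attention \<Rightarrow> fp vec list \<Rightarrow> fp vec \<Rightarrow> fp vec" where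
  "attn_row fexp T A xs y = vmult (tfmt T) (vec (length (heads A) * dim_val T)
     (\<lambda>j. head_row fexp T (heads A ! (j div dim_val T)) xs y $ (j mod dim_val T))) (wO A)"

definition mlp_row :: "fmt \<Rightarrow> mlp \<Rightarrow> fp vec \<Rightarrow> fp vec" where
  "mlp_row F M x = vadd F (vmult F (map_vec fp_relu (vadd F (vmult F x (w1 M)) (b1 M))) (w2 M)) (b2 M)"

definition enc_row ::
  "(fmt \<Rightarrow> fp \<Rightarrow> fp) \<Rightarrow> 'a transformer \<Rightarrow> enc_layer \<Rightarrow> fp vec list \<Rightarrow> fp vec \<Rightarrow> fp vec" where
  "enc_row fexp T L xs y =
     (let F = tfmt T; y' = vadd F (attn_row fexp T (enc_self L) xs y) y
      in vadd F (mlp_row F (enc_mlp L) y') y')"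

definition dec_row ::
  "(fmt \<Rightarrow> fp \<Rightarrow> fp) \<Rightarrow> 'a transformer \<Rightarrow> dec_layer \<Rightarrow> fp vec list \<Rightarrow> fp vec list \<Rightarrow> fp vec \<Rightarrow> fp vec"
  where
  "dec_row fexp T L xs ys y =
     (let F = tfmt T; y' = vadd F (attn_row fexp T (dec_self L) ys y) y;
          y'' = vadd F (attn_row fexp T (dec_cross L) xs y') y'
      in vadd F (mlp_row F (dec_mlp L) y'') y'')"

definition enc_rows ::
  "(fmt \<Rightarrow> fp \<Rightarrow> fp) \<Rightarrow> 'a transformer \<Rightarrow> enc_layer \<Rightarrow> fp vec list \<Rightarrow> fp vec list" where
  "enc_rows fexp T L xs = map (enc_row fexp T L xs) xs"

definition dec_rows ::
  "(fmt \<Rightarrow> fp \<Rightarrow> fp) \<Rightarrow> 'a transformer \<Rightarrow> fp vec list \<Rightarrow> dec_layer \<Rightarrow> fp vec list \<Rightarrow> fp vec list" where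
  "dec_rows fexp T xs L ys =
     map (\<lambda>i. dec_row fexp T L xs (take (Suc i) ys) (ys ! i)) [0..<length ys]"

lemma dim_vadd [simp]: "dim_vec (vadd F a b) = dim_vec a"
  and dim_vmult [simp]: "dim_vec (vmult F x W) = dim_col W"
  and dim_mlp_row [simp]: "dim_vec (mlp_row F M x) = dim_col (w2 M)"
  and dim_attn_row [simp]: "dim_vec (attn_row fexp T A xs y) = dim_col (wO A)"
  and dim_head_row [simp]: "dim_vec (head_row fexp T H xs y) = dim_col (wV H)"
  by (simp_all add: vadd_def vmult_def mlp_row_def attn_row_def head_row_def)

lemma softmax_eq: "softmax fexp F ss = map (sm_weight fexp F ss) ss"
  by (auto simp: softmax_def sm_weight_def Let_def)

lemma dim_fmat_mult [simp]: "dim_row (fmat_mult F X W) = dim_row X" "dim_col (fmat_mult F X W) = dim_col W"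
  by (simp_all add: fmat_mult_def fmat_mult_on_def)

lemma fmat_mult_index:
  "i < dim_row A \<Longrightarrow> l < dim_col B \<Longrightarrow> fmat_mult F A B $$ (i, l) =
     fp_sum F (map (\<lambda>j. fp_mult F (A $$ (i, j)) (B $$ (j, l))) [0..<dim_row B])"
  by (simp add: fmat_mult_def fmat_mult_on_def)

lemma row_fmat_mult:
  assumes "i < dim_row X" "dim_col X = dim_row W"
  shows "row (fmat_mult F X W) i = vmult F (row X i) W"
  using assms by (intro eq_vecI) (auto simp: fmat_mult_def fmat_mult_on_def vmult_def intro!: arg_cong[of _ _ "fp_sum F"])

lemma row_fmat_add:
  assumes "i < dim_row A" "dim_row B = dim_row A" "dim_col B = dim_col A"
  shows "row (fmat_add F A B) i = vadd F (row A i) (row B i)"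
  using assms by (intro eq_vecI) (auto simp: fmat_add_def vadd_def)

lemma row_fmat_add_row:
  assumes "i < dim_row A"
  shows "row (fmat_add_row F A b) i = vadd F (row A i) b"
  using assms by (intro eq_vecI) (auto simp: fmat_add_row_def vadd_def)

lemma row_eval_mlp:
  assumes "i < dim_row X" "dim_col X = dim_row (w1 M)" "dim_col (w1 M) = dim_row (w2 M)"
  shows "row (eval_mlp F M X) i = mlp_row F M (row X i)"
proof -
  define A where "A = fmat_add_row F (fmat_mult F X (w1 M)) (b1 M)"
  have d: "dim_row A = dim_row X" "dim_col A = dim_row (w2 M)"
    using assms by (auto simp: A_def fmat_add_row_def fmat_mult_def fmat_mult_on_def)
  have A: "row A i = vadd F (vmult F (row X i) (w1 M)) (b1 M)"
    unfolding A_def using assms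
    by (subst row_fmat_add_row) (auto simp: row_fmat_mult)
  have "row (map_mat fp_relu A) i = map_vec fp_relu (row A i)"
    using assms d by (intro eq_vecI) auto
  then show ?thesis
    using assms d unfolding eval_mlp_def A_def[symmetric] mlp_row_def A[symmetric]
    by (subst row_fmat_add_row) (auto simp: row_fmat_mult)
qed

section \<open>Softmax over masked scores\<close>

locale float_exp =
  fixes F :: fmt and fexp :: "fmt \<Rightarrow> fp \<Rightarrow> fp" and c :: nat
  assumes F: "valid_fmt F" and exp_ax: "exp_approx c F (fexp F)"
begin

lemma fexp_special [simp]:
  "fexp F NaN = NaN" "fexp F (Inf False) = Inf False" "fexp F (Inf True) = fp_zero"
  "fexp F (Fin b 0 0) = fp_one F"
  using exp_ax by (cases b; auto simp: exp_approx_def)+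

text \<open>The claim about the key says that exponentials are never negative and never
  \<open>-0\<close>, so that in a sum the \<open>+0\<close> of a masked entry can be sorted to the
  front.\<close>

lemma fexp_floats: "x \<in> floats F \<Longrightarrow> fexp F x \<in> floats F \<and> 0 \<le> fp_key F (fexp F x)"
proof (cases "x \<in> fin_floats F")
  case True
  then have "(fexp F x \<in> fin_floats F \<and> \<not> neg (fexp F x)) \<or> fexp F x = Inf False"
    using exp_ax unfolding exp_approx_def Let_def by blast
  then show ?thesis by (auto simp: floats_def fin_floats_def Let_def)
next
  case False
  assume "x \<in> floats F"
  with False show ?thesis by (auto simp: floats_def Let_def)
qed

text \<open>\<open>fp_max\<close> is a choice among the entries with maximal key; injectivity of the
  key leaves only one.\<close>

lemma fp_max_eqI:
  assumes "m \<in> set ss" "\<And>x. x \<in> set ss \<Longrightarrow> fp_key F x \<le> fp_key F m" "set ss \<subseteq> floats F"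
  shows "fp_max F ss = m"
proof -
  have "is_arg_max (fp_key F) (\<lambda>x. x \<in> set ss) m"
    using assms by (auto simp: is_arg_max_def not_less)
  then have "is_arg_max (fp_key F) (\<lambda>x. x \<in> set ss) (fp_max F ss)"
    unfolding fp_max_def arg_max_on_def arg_max_def by (rule someI)
  then have "fp_max F ss \<in> set ss" "fp_key F m \<le> fp_key F (fp_max F ss)"
    using assms(1) by (auto simp: is_arg_max_def not_less)
  then show ?thesis using assms fp_key_inj[OF F] by (meson antisym inj_onD subsetD)
qed

lemma fp_max_props:
  assumes "ss \<noteq> []" "set ss \<subseteq> floats F"
  shows "fp_max F ss \<in> set ss" "\<And>x. x \<in> set ss \<Longrightarrow> fp_key F x \<le> fp_key F (fp_max F ss)"
proof -
  have "Max (fp_key F ` set ss) \<in> fp_key F ` set ss" using assms(1) by (intro Max_in) auto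
  then obtain m where m: "m \<in> set ss" "fp_key F m = Max (fp_key F ` set ss)" by auto
  then have "fp_max F ss = m" by (intro fp_max_eqI) (auto simp: assms(2))
  with m show "fp_max F ss \<in> set ss" "\<And>x. x \<in> set ss \<Longrightarrow> fp_key F x \<le> fp_key F (fp_max F ss)"
    by auto
qed

lemma fp_round_zero: "fp_round F False 0 = fp_zero"
proof -
  have ovf: "\<bar>0\<bar> < overflow_bound F" using fv_less_overflow[OF F fv_zero] .
  have "fv F (fp_round F False 0) 0" using fp_round_exact[OF F representable_zero] .
  then obtain b where b: "fp_round F False 0 = Fin b 0 0" using fp_val_eq_zero[OF F] by blast
  have "neg (fp_round F False 0) = False" using fp_round_fin(2)[OF F ovf, of False] by simp
  with b show ?thesis by simp
qed

text \<open>With key 0 the additional \<open>+0\<close> comes first in the sorted list and meets the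
  start value \<open>+0\<close>, to which it adds nothing. The hypothesis rules out summands that
  would be sorted before it.\<close>

lemma fp_sum_zero_Cons:
  assumes "\<And>x. x \<in> set xs \<Longrightarrow> 0 \<le> fp_key F x"
  shows "fp_sum F (fp_zero # xs) = fp_sum F xs"
proof -
  have "insort_key (fp_key F) fp_zero (sort_key (fp_key F) xs) = fp_zero # sort_key (fp_key F) xs"
    using assms by (intro insort_is_Cons) auto
  then show ?thesis by (simp add: fp_sum_def fp_round_zero)
qed

lemma fp_sum_masked:
  assumes "\<And>j. j \<in> set js \<Longrightarrow> P j \<Longrightarrow> g j \<in> floats F \<and> 0 \<le> fp_key F (g j)"
  shows "fp_sum F (map (\<lambda>j. if P j then g j else fp_zero) js) = fp_sum F (map g (filter P js))"
proof -
  have "mset (map (\<lambda>j. if P j then g j else fp_zero) js) =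
    mset (replicate (length (filter (\<lambda>j. \<not> P j) js)) fp_zero @ map g (filter P js))"
    by (induction js) auto
  then have "fp_sum F (map (\<lambda>j. if P j then g j else fp_zero) js) =
    fp_sum F (replicate (length (filter (\<lambda>j. \<not> P j) js)) fp_zero @ map g (filter P js))"
    using assms by (intro fp_sum_cong_mset[OF F]) (auto simp: zero_floats[OF F])
  also have "fp_sum F (replicate n fp_zero @ map g (filter P js)) = fp_sum F (map g (filter P js))" for n
  proof (induction n)
    case (Suc n)
    have "fp_sum F (fp_zero # (replicate n fp_zero @ map g (filter P js))) =
      fp_sum F (replicate n fp_zero @ map g (filter P js))"
      using assms by (intro fp_sum_zero_Cons) auto
    then show ?case using Suc by simp
  qed simp
  finally show ?thesis .
qed

text \<open>A masked score \<open>Inf True\<close> has the least key, so it is not the maximum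
  unless all visible scores are \<open>Inf True\<close> as well. Subtracting any other maximum
  except \<open>NaN\<close> leaves it at minus infinity, where the exponential is \<open>+0\<close>,
  and this drops out of the denominator.\<close>

lemma sm_weight_masked:
  assumes fl: "\<And>j. j \<in> set js \<Longrightarrow> s j \<in> floats F" and j0: "j0 \<in> set js" "P j0"
  shows "sm_weight fexp F (map (\<lambda>j. if P j then s j else Inf True) js) (s j0) =
    sm_weight fexp F (map s (filter P js)) (s j0)"
proof -
  define ss where "ss = map (\<lambda>j. if P j then s j else Inf True) js"
  define ss' where "ss' = map s (filter P js)"
  have sub: "set ss \<subseteq> set ss' \<union> {Inf True}" "set ss' \<subseteq> set ss" "ss' \<noteq> []"
    using j0 by (auto simp: ss_def ss'_def filter_empty_conv)
  have flo: "set ss \<subseteq> floats F" "set ss' \<subseteq> floats F"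
    using fl by (auto simp: ss_def ss'_def floats_def)
  show ?thesis
  proof (cases "set ss' \<subseteq> {Inf True}")
    case True
    then have "set ss \<subseteq> {Inf True}" using sub by blast
    with True show ?thesis unfolding ss_def[symmetric] ss'_def[symmetric] by (simp add: sm_weight_def)
  next
    case False
    then have ss: "\<not> set ss \<subseteq> {Inf True}" using sub by blast
    define m where "m = fp_max F ss'"
    have m: "m \<in> set ss'" "\<And>x. x \<in> set ss' \<Longrightarrow> fp_key F x \<le> fp_key F m"
      using fp_max_props[OF sub(3) flo(2)] by (auto simp: m_def)
    from False obtain x where x: "x \<in> set ss'" "x \<noteq> Inf True" by blast
    have lt: "fp_key F (Inf True) < fp_key F m"
      using fp_key_minus_infinity[OF F, of x] m(2)[OF x(1)] x flo by fastforce
    then have mI: "m \<noteq> Inf True" by auto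
    have max: "fp_max F ss = m"
      using m sub lt flo by (intro fp_max_eqI) (auto dest!: subsetD[OF sub(1)] simp del: fp_key.simps)
    define e where "e = (\<lambda>x. fexp F (fp_sub F x m))"
    have w: "sm_weight fexp F ss t = fp_div F (e t) (fp_sum F (map e ss))"
      "sm_weight fexp F ss' t = fp_div F (e t) (fp_sum F (map e ss'))" for t
      using False ss by (simp_all add: sm_weight_def max m_def[symmetric] e_def)
    have "fp_div F (e (s j0)) (fp_sum F (map e ss)) = fp_div F (e (s j0)) (fp_sum F (map e ss'))"
    proof (cases "m = NaN")
      case True
      \<comment> \<open>With maximum \<open>NaN\<close> even masked entries have exponential
        \<open>NaN\<close>; but the numerators are \<open>NaN\<close> too, so the denominators do
        not matter.\<close>
      have "fp_add F x NaN = NaN" for x by (cases x) auto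
      then show ?thesis using True by (simp add: e_def fp_sub_def)
    next
      case False
      have "e (Inf True) = fp_zero" using False mI by (cases m) (auto simp: e_def fp_sub_def)
      then have "map e ss = map (\<lambda>j. if P j then e (s j) else fp_zero) js"
        by (auto simp: ss_def)
      moreover have "e (s j) \<in> floats F \<and> 0 \<le> fp_key F (e (s j))" if "j \<in> set js" for j
        unfolding e_def using m flo fl[OF that] by (intro fexp_floats fp_sub_floats[OF F]) auto
      ultimately have "fp_sum F (map e ss) = fp_sum F (map (\<lambda>j. e (s j)) (filter P js))"
        using fp_sum_masked[of js P "\<lambda>j. e (s j)"] by simp
      then show ?thesis by (simp add: ss'_def comp_def)
    qed
    then show ?thesis unfolding ss_def[symmetric] ss'_def[symmetric] w .
  qed
qed

lemma sm_weight_floats: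
  assumes "set ss \<subseteq> floats F" "s \<in> set ss"
  shows "sm_weight fexp F ss s \<in> floats F"
proof -
  have "ss \<noteq> []" using assms by auto
  then have "fp_max F ss \<in> floats F" using fp_max_props(1)[of ss] assms by blast
  then show ?thesis unfolding sm_weight_def using assms
    by (auto intro!: fexp_floats[THEN conjunct1] fp_div_floats[OF F] fp_sum_floats[OF F] fp_sub_floats[OF F] simp: zero_floats[OF F])
qed

lemma vmult_fvec:
  assumes "W \<in> fmat F n m" "x \<in> fvec F n" shows "vmult F x W \<in> fvec F m"
  using assms unfolding fmat_iff fvec_iff
  by (auto simp: vmult_def intro!: fp_sum_floats[OF F] fp_mult_floats[OF F])

lemma vadd_fvec:
  assumes "a \<in> fvec F n" "b \<in> fvec F n" shows "vadd F a b \<in> fvec F n"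
  using assms unfolding fvec_iff by (auto simp: vadd_def fp_add_floats[OF F])

end

section \<open>Matrix evaluation of well-formed layers reduced to rows\<close>

locale transformer = float_exp "tfmt T" fexp c
  for T :: "'a transformer" and fexp c +
  fixes \<Sigma> :: "'a set"
  assumes T: "is_transformer \<Sigma> T"
begin

abbreviation "TF \<equiv> tfmt T"

definition wf_head :: "head \<Rightarrow> bool" where
  "wf_head H \<longleftrightarrow> wQ H \<in> fmat TF (dim_model T) (dim_key T) \<and>
     wK H \<in> fmat TF (dim_model T) (dim_key T) \<and> wV H \<in> fmat TF (dim_model T) (dim_val T)"

lemma score_floats:
  assumes "wf_head H" "x \<in> fvec TF (dim_model T)" "y \<in> fvec TF (dim_model T)"
  shows "score T H y x \<in> floats TF"
proof -
  have "vmult TF y (wQ H) \<in> fvec TF (dim_key T)" "vmult TF x (wK H) \<in> fvec TF (dim_key T)"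
    "dim_col (wK H) = dim_key T"
    using assms by (auto simp: wf_head_def fmat_iff intro!: vmult_fvec)
  then show ?thesis unfolding score_def Let_def fvec_iff
    by (auto intro!: fp_div_floats[OF F] fp_sum_floats[OF F] fp_mult_floats[OF F] simp: fp_round_floats[OF F])
qed

lemma head_row_fvec:
  assumes "wf_head H" "set xs \<subseteq> fvec TF (dim_model T)" "y \<in> fvec TF (dim_model T)"
  shows "head_row fexp T H xs y \<in> fvec TF (dim_val T)"
proof -
  have "vmult TF x (wV H) \<in> fvec TF (dim_val T)" if "x \<in> set xs" for x
    using assms that by (auto simp: wf_head_def intro!: vmult_fvec)
  moreover have "sm_weight fexp TF (map (score T H y) xs) (score T H y x) \<in> floats TF" if "x \<in> set xs" for x
    using assms that by (intro sm_weight_floats) (auto intro!: score_floats)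
  ultimately show ?thesis
    using assms(1) unfolding head_row_def fvec_iff
    by (auto simp: wf_head_def fmat_iff intro!: fp_sum_floats[OF F] fp_mult_floats[OF F])
qed

lemma wf_attentionD:
  assumes "wf_attention T A"
  shows "\<And>H. H \<in> set (heads A) \<Longrightarrow> wf_head H"
    "wO A \<in> fmat TF (length (heads A) * dim_val T) (dim_model T)"
  using assms by (auto simp: wf_attention_def wf_head_def)

lemma attn_row_fvec:
  assumes "wf_attention T A" "set xs \<subseteq> fvec TF (dim_model T)" "y \<in> fvec TF (dim_model T)"
  shows "attn_row fexp T A xs y \<in> fvec TF (dim_model T)"
proof -
  have dv: "0 < dim_val T" using T by (auto simp: is_transformer_def)
  have "head_row fexp T (heads A ! (j div dim_val T)) xs y $ (j mod dim_val T) \<in> floats TF"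
    if "j < length (heads A) * dim_val T" for j
  proof -
    have "heads A ! (j div dim_val T) \<in> set (heads A)"
      using that by (intro nth_mem) (simp add: less_mult_imp_div_less)
    from head_row_fvec[OF wf_attentionD(1)[OF assms(1) this] assms(2,3)] dv show ?thesis
      by (auto simp: fvec_iff)
  qed
  then show ?thesis unfolding attn_row_def
    by (intro vmult_fvec[OF wf_attentionD(2)[OF assms(1)]]) (auto simp: fvec_iff)
qed

lemma mlp_row_fvec:
  assumes "wf_mlp T M" "x \<in> fvec TF (dim_model T)"
  shows "mlp_row TF M x \<in> fvec TF (dim_model T)"
proof -
  have "vadd TF (vmult TF x (w1 M)) (b1 M) \<in> fvec TF (dim_ff T)"
    using assms by (auto simp: wf_mlp_def intro!: vadd_fvec vmult_fvec)
  then have "map_vec fp_relu (vadd TF (vmult TF x (w1 M)) (b1 M)) \<in> fvec TF (dim_ff T)"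
    by (auto simp: fvec_iff fp_relu_floats[OF F])
  then show ?thesis
    using assms by (auto simp: wf_mlp_def mlp_row_def intro!: vadd_fvec vmult_fvec)
qed

text \<open>Masked columns could enter row \<open>i\<close> in two places: in the softmax
  denominator, from which \<open>sm_weight_masked\<close> removes them, and in the product with the
  values, which is restricted to the same columns by definition.\<close>

lemma row_eval_head:
  assumes H: "wf_head H" and X: "X \<in> fmat TF n (dim_model T)" and Y: "Y \<in> fmat TF m (dim_model T)"
    and i: "i < m"
  shows "row (eval_head keep fexp T H X Y) i =
    head_row fexp T H (map (row X) (filter (keep i) [0..<n])) (row Y i)"
proof -
  define QK where "QK = fmat_mult TF (fmat_mult TF Y (wQ H)) (transpose_mat (fmat_mult TF X (wK H)))"
  define S where "S = map_mat (\<lambda>x. fp_div TF x (fp_round TF False (sqrt (real (dim_key T))))) QK"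
  define V where "V = fmat_mult TF X (wV H)"
  define s where "s j = score T H (row Y i) (row X j)" for j
  define js where "js = filter (keep i) [0..<n]"
  have d: "dim_row X = n" "dim_row Y = m" "dim_col X = dim_model T" "dim_col Y = dim_model T"
    "dim_row (wQ H) = dim_model T" "dim_row (wK H) = dim_model T" "dim_row (wV H) = dim_model T"
    "dim_col (wQ H) = dim_key T" "dim_col (wK H) = dim_key T" "dim_col (wV H) = dim_val T"
    using H X Y by (auto simp: fmat_iff wf_head_def)
  have dS: "dim_row S = m" "dim_col S = n"
    by (auto simp: S_def QK_def fmat_mult_def fmat_mult_on_def d)
  have dV: "dim_row V = n" "dim_col V = dim_val T" by (auto simp: V_def fmat_mult_def fmat_mult_on_def d)
  have rQ: "fmat_mult TF Y (wQ H) $$ (i, l) = vmult TF (row Y i) (wQ H) $ l" if "l < dim_key T" for l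
    using row_fmat_mult[of i Y "wQ H" TF, symmetric] i that d by (simp add: fmat_mult_def fmat_mult_on_def)
  have rK: "fmat_mult TF X (wK H) $$ (j, l) = vmult TF (row X j) (wK H) $ l" if "j < n" "l < dim_key T" for j l
    using row_fmat_mult[of j X "wK H" TF, symmetric] that d by (simp add: fmat_mult_def fmat_mult_on_def)
  have QKe: "QK $$ (i, j) = fp_sum TF (map (\<lambda>l. fp_mult TF (vmult TF (row Y i) (wQ H) $ l)
    (vmult TF (row X j) (wK H) $ l)) [0..<dim_key T])" if "j < n" for j
    unfolding QK_def using i that
    by (subst fmat_mult_index) (auto simp: d rQ rK intro!: arg_cong[of _ _ "fp_sum TF"])
  have Se: "S $$ (i, j) = s j" if "j < n" for j
  proof -
    have "S $$ (i, j) = fp_div TF (QK $$ (i, j)) (fp_round TF False (sqrt (real (dim_key T))))"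
      using i that dS by (simp add: S_def)
    then show ?thesis unfolding QKe[OF that] s_def score_def Let_def d .
  qed
  have Ve: "V $$ (j, l) = vmult TF (row X j) (wV H) $ l" if "j < n" "l < dim_val T" for j l
    using row_fmat_mult[of j X "wV H" TF, symmetric] that d by (simp add: V_def fmat_mult_def fmat_mult_on_def)
  have sfl: "s j \<in> floats TF" if "j < n" for j
    unfolding s_def using H that i by (intro score_floats) (auto intro: fmat_row[OF X] fmat_row[OF Y])
  have rowS: "list_of_vec (row (mask keep S) i) = map (\<lambda>j. if keep i j then s j else Inf True) [0..<n]"
    using i dS by (intro nth_equalityI) (auto simp: mask_def Se list_of_vec_index)
  have We: "softmax_rows fexp TF (mask keep S) $$ (i, j) = sm_weight fexp TF (map s js) (s j)"
    if "j \<in> set js" for j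
  proof -
    have j: "j < n" "keep i j" using that by (auto simp: js_def)
    have "dim_row (mask keep S) = m" "dim_col (mask keep S) = n" by (simp_all add: mask_def dS)
    then have "softmax_rows fexp TF (mask keep S) $$ (i, j) =
      softmax fexp TF (list_of_vec (row (mask keep S) i)) ! j"
      using i j by (simp add: softmax_rows_def)
    also have "\<dots> =
      sm_weight fexp TF (map (\<lambda>j. if keep i j then s j else Inf True) [0..<n]) (s j)"
      unfolding rowS softmax_eq using j by simp
    also have "\<dots> = sm_weight fexp TF (map s js) (s j)"
      unfolding js_def using j sfl by (intro sm_weight_masked) auto
    finally show ?thesis .
  qed
  have "row (eval_head keep fexp T H X Y) i = row (fmat_mult_on keep TF (softmax_rows fexp TF (mask keep S)) V) i"
    by (simp add: eval_head_def Let_def S_def QK_def V_def)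
  also have "\<dots> = vec (dim_val T) (\<lambda>l. fp_sum TF (map (\<lambda>j. fp_mult TF (sm_weight fexp TF (map s js) (s j))
    (vmult TF (row X j) (wV H) $ l)) js))"
  proof -
    define A where "A = softmax_rows fexp TF (mask keep S)"
    have dA: "dim_row A = m" by (simp add: A_def softmax_rows_def mask_def dS)
    have "fmat_mult_on keep TF A V $$ (i, l) = fp_sum TF (map (\<lambda>j. fp_mult TF
        (sm_weight fexp TF (map s js) (s j)) (vmult TF (row X j) (wV H) $ l)) js)" if "l < dim_val T" for l
    proof -
      have "fmat_mult_on keep TF A V $$ (i, l) =
        fp_sum TF (map (\<lambda>j. fp_mult TF (A $$ (i, j)) (V $$ (j, l))) js)"
        using i that dA dV by (simp add: fmat_mult_on_def js_def)
      also have "map (\<lambda>j. fp_mult TF (A $$ (i, j)) (V $$ (j, l))) js = map (\<lambda>j. fp_mult TF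
        (sm_weight fexp TF (map s js) (s j)) (vmult TF (row X j) (wV H) $ l)) js"
        using that by (intro map_cong refl) (simp add: A_def We Ve, simp add: js_def Ve)
      finally show ?thesis .
    qed
    moreover have "dim_row (fmat_mult_on keep TF A V) = m" "dim_col (fmat_mult_on keep TF A V) = dim_val T"
      by (simp_all add: fmat_mult_on_def dA dV)
    ultimately show ?thesis unfolding A_def[symmetric] using i by (intro eq_vecI) simp_all
  qed
  also have "\<dots> = head_row fexp T H (map (row X) js) (row Y i)"
    by (simp add: head_row_def d s_def[abs_def] comp_def)
  finally show ?thesis by (simp add: js_def)
qed

lemma row_eval_attention:
  assumes A: "wf_attention T A" and X: "X \<in> fmat TF n (dim_model T)" and Y: "Y \<in> fmat TF m (dim_model T)"
    and i: "i < m"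
  shows "row (eval_attention keep fexp T A X Y) i =
    attn_row fexp T A (map (row X) (filter (keep i) [0..<n])) (row Y i)"
proof -
  have dv: "0 < dim_val T" using T by (auto simp: is_transformer_def)
  define Hs where "Hs = map (\<lambda>H. eval_head keep fexp T H X Y) (heads A)"
  define C where "C = mat (dim_row Y) (length Hs * dim_val T)
                (\<lambda>(i, j). (Hs ! (j div dim_val T)) $$ (i, j mod dim_val T))"
  have m: "dim_row Y = m" using Y by (auto simp: fmat_iff)
  have C: "row C i = vec (length (heads A) * dim_val T)
     (\<lambda>j. head_row fexp T (heads A ! (j div dim_val T)) (map (row X) (filter (keep i) [0..<n])) (row Y i) $ (j mod dim_val T))"
  proof (intro eq_vecI)
    fix j assume "j < dim_vec (vec (length (heads A) * dim_val T)
     (\<lambda>j. head_row fexp T (heads A ! (j div dim_val T)) (map (row X) (filter (keep i) [0..<n])) (row Y i) $ (j mod dim_val T)))"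
    then have j: "j < length (heads A) * dim_val T" by simp
    then have h: "j div dim_val T < length (heads A)" by (simp add: less_mult_imp_div_less)
    then have wf: "wf_head (heads A ! (j div dim_val T))" using wf_attentionD(1)[OF A] by simp
    have dim: "dim_row (eval_head keep fexp T (heads A ! (j div dim_val T)) X Y) = m"
      "dim_col (eval_head keep fexp T (heads A ! (j div dim_val T)) X Y) = dim_val T"
      using wf m by (auto simp: eval_head_def Let_def fmat_mult_on_def softmax_rows_def mask_def fmat_mult_def wf_head_def fmat_iff)
    have "row C i $ j = row (eval_head keep fexp T (heads A ! (j div dim_val T)) X Y) i $ (j mod dim_val T)"
      using j i h m dim dv by (auto simp: C_def Hs_def)
    then show "row C i $ j = vec (length (heads A) * dim_val T)
     (\<lambda>j. head_row fexp T (heads A ! (j div dim_val T)) (map (row X) (filter (keep i) [0..<n])) (row Y i) $ (j mod dim_val T)) $ j"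
      using j row_eval_head[OF wf X Y i] by simp
  qed (simp add: C_def Hs_def)
  have "row (eval_attention keep fexp T A X Y) i = row (fmat_mult TF C (wO A)) i"
    by (simp add: eval_attention_def Let_def C_def Hs_def)
  also have "\<dots> = vmult TF (row C i) (wO A)"
    using wf_attentionD(2)[OF A] i m by (intro row_fmat_mult) (auto simp: C_def Hs_def fmat_iff)
  finally show ?thesis by (simp add: C attn_row_def)
qed

lemma eval_attention_carrier:
  assumes "wf_attention T A" "Y \<in> fmat TF m (dim_model T)"
  shows "eval_attention keep fexp T A X Y \<in> carrier_mat m (dim_model T)"
  using assms wf_attentionD(2)[OF assms(1)]
  by (auto simp: eval_attention_def Let_def fmat_mult_def fmat_mult_on_def fmat_iff)

lemma map_row_eq_rows: "dim_row X = n \<Longrightarrow> map (row X) [0..<n] = rows X"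
  by (simp add: rows_def)

lemma enc_layer_rows:
  assumes L: "L \<in> set (encoder T)" and X: "X \<in> fmat TF n (dim_model T)"
  shows "eval_enc_layer fexp T L X \<in> fmat TF n (dim_model T)"
    "rows (eval_enc_layer fexp T L X) = enc_rows fexp T L (rows X)"
proof -
  have wf: "wf_attention T (enc_self L)" "wf_mlp T (enc_mlp L)"
    using T L by (auto simp: is_transformer_def)
  define X' where "X' = fmat_add TF (eval_attention everywhere fexp T (enc_self L) X X) X"
  have Xd: "dim_row X = n" "dim_col X = dim_model T" using X by (auto simp: fmat_iff)
  note att = eval_attention_carrier[OF wf(1) X, of everywhere X]
  have X'c: "X' \<in> carrier_mat n (dim_model T)" using att by (auto simp: X'_def fmat_add_def)
  have rX: "set (rows X) \<subseteq> fvec TF (dim_model T)" using X fmat_row[OF X] Xd by (auto simp: rows_def)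
  have X'r: "row X' i = vadd TF (attn_row fexp T (enc_self L) (rows X) (row X i)) (row X i)" if "i < n" for i
    using att Xd that row_eval_attention[OF wf(1) X X that, of everywhere]
    unfolding X'_def by (subst row_fmat_add) (auto simp: map_row_eq_rows)
  have res: "row (eval_enc_layer fexp T L X) i = enc_row fexp T L (rows X) (row X i)" if "i < n" for i
  proof -
    have "row (eval_mlp TF (enc_mlp L) X') i = mlp_row TF (enc_mlp L) (row X' i)"
      using that X'c wf(2) by (intro row_eval_mlp) (auto simp: wf_mlp_def fmat_iff)
    moreover have "eval_mlp TF (enc_mlp L) X' \<in> carrier_mat n (dim_model T)"
      using X'c wf(2) by (auto simp: eval_mlp_def fmat_add_row_def fmat_mult_def fmat_mult_on_def wf_mlp_def fmat_iff)
    ultimately show ?thesis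
      using that X'c unfolding eval_enc_layer_def Let_def X'_def[symmetric]
      by (subst row_fmat_add) (auto simp: enc_row_def Let_def X'r)
  qed
  have c: "eval_enc_layer fexp T L X \<in> carrier_mat n (dim_model T)"
    using X'c wf(2) unfolding eval_enc_layer_def Let_def X'_def[symmetric]
    by (auto simp: fmat_add_def eval_mlp_def fmat_add_row_def fmat_mult_def fmat_mult_on_def wf_mlp_def fmat_iff)
  have fv: "enc_row fexp T L (rows X) (row X i) \<in> fvec TF (dim_model T)" if "i < n" for i
    unfolding enc_row_def Let_def
    using wf rX fmat_row[OF X that] by (auto intro!: vadd_fvec mlp_row_fvec attn_row_fvec)
  show "eval_enc_layer fexp T L X \<in> fmat TF n (dim_model T)"
    using c by (rule fmatI_rows) (simp add: res fv)
  show "rows (eval_enc_layer fexp T L X) = enc_rows fexp T L (rows X)"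
    using c Xd by (intro nth_equalityI) (auto simp: enc_rows_def res)
qed

lemma dec_layer_rows:
  assumes L: "L \<in> set (decoder T)" and X: "X \<in> fmat TF n (dim_model T)" and Y: "Y \<in> fmat TF m (dim_model T)"
  shows "eval_dec_layer fexp T L X Y \<in> fmat TF m (dim_model T)"
    "rows (eval_dec_layer fexp T L X Y) = dec_rows fexp T (rows X) L (rows Y)"
proof -
  have wf: "wf_attention T (dec_self L)" "wf_attention T (dec_cross L)" "wf_mlp T (dec_mlp L)"
    using T L by (auto simp: is_transformer_def)
  define Y' where "Y' = fmat_add TF (eval_attention causal fexp T (dec_self L) Y Y) Y"
  define Y'' where "Y'' = fmat_add TF (eval_attention everywhere fexp T (dec_cross L) X Y') Y'"
  have Xd: "dim_row X = n" "dim_col X = dim_model T" using X by (auto simp: fmat_iff)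
  have Yd: "dim_row Y = m" "dim_col Y = dim_model T" using Y by (auto simp: fmat_iff)
  have rX: "set (rows X) \<subseteq> fvec TF (dim_model T)" using X fmat_row[OF X] Xd by (auto simp: rows_def)
  have rY: "set (rows Y) \<subseteq> fvec TF (dim_model T)" using Y fmat_row[OF Y] Yd by (auto simp: rows_def)
  \<comment> \<open>The mask is non-strict: row \<open>i\<close> sees itself, so the visible rows
    are the first \<open>Suc i\<close>.\<close>
  have tk: "map (row Y) (filter (causal i) [0..<m]) = take (Suc i) (rows Y)" if "i < m" for i
  proof -
    have "[0..<m] = [0..<Suc i] @ [Suc i..<m]" using that by (metis Suc_leI le0 upt_add_eq_append le_add_diff_inverse)
    then have "filter (causal i) [0..<m] = [0..<Suc i]" by (simp add: filter_empty_conv filter_id_conv del: upt_Suc)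
    then show ?thesis using that Yd by (simp add: rows_def take_map take_upt del: upt_Suc)
  qed
  note att = eval_attention_carrier[OF wf(1) Y, of causal Y]
  have Y'c: "Y' \<in> carrier_mat m (dim_model T)" using att by (auto simp: Y'_def fmat_add_def)
  have Y'r: "row Y' i = vadd TF (attn_row fexp T (dec_self L) (take (Suc i) (rows Y)) (row Y i)) (row Y i)" if "i < m" for i
    using att Yd that row_eval_attention[OF wf(1) Y Y that, of causal]
    unfolding Y'_def by (subst row_fmat_add) (auto simp: tk)
  have Y'v: "row Y' i \<in> fvec TF (dim_model T)" if "i < m" for i
    unfolding Y'r[OF that] using wf rY fmat_row[OF Y that]
    by (intro vadd_fvec attn_row_fvec) (auto dest: in_set_takeD)
  have Y': "Y' \<in> fmat TF m (dim_model T)" using Y'c Y'v by (rule fmatI_rows)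
  note att' = eval_attention_carrier[OF wf(2) Y', of everywhere X]
  have Y''c: "Y'' \<in> carrier_mat m (dim_model T)" using att' by (auto simp: Y''_def fmat_add_def)
  have Y''r: "row Y'' i = vadd TF (attn_row fexp T (dec_cross L) (rows X) (row Y' i)) (row Y' i)" if "i < m" for i
    using att' Xd Y'c that row_eval_attention[OF wf(2) X Y' that, of everywhere]
    unfolding Y''_def by (subst row_fmat_add) (auto simp: map_row_eq_rows)
  have res: "row (eval_dec_layer fexp T L X Y) i =
    dec_row fexp T L (rows X) (take (Suc i) (rows Y)) (row Y i)" if "i < m" for i
  proof -
    have "row (eval_mlp TF (dec_mlp L) Y'') i = mlp_row TF (dec_mlp L) (row Y'' i)"
      using that Y''c wf(3) by (intro row_eval_mlp) (auto simp: wf_mlp_def fmat_iff)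
    moreover have "eval_mlp TF (dec_mlp L) Y'' \<in> carrier_mat m (dim_model T)"
      using Y''c wf(3) by (auto simp: eval_mlp_def fmat_add_row_def fmat_mult_def fmat_mult_on_def wf_mlp_def fmat_iff)
    ultimately show ?thesis
      using that Y''c unfolding eval_dec_layer_def Let_def Y'_def[symmetric] Y''_def[symmetric]
      by (subst row_fmat_add) (auto simp: dec_row_def Let_def Y'r Y''r)
  qed
  have c: "eval_dec_layer fexp T L X Y \<in> carrier_mat m (dim_model T)"
    using Y''c wf(3) unfolding eval_dec_layer_def Let_def Y'_def[symmetric] Y''_def[symmetric]
    by (auto simp: fmat_add_def eval_mlp_def fmat_add_row_def fmat_mult_def fmat_mult_on_def wf_mlp_def fmat_iff)
  have fv: "dec_row fexp T L (rows X) (take (Suc i) (rows Y)) (row Y i) \<in> fvec TF (dim_model T)" if "i < m" for i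
    unfolding dec_row_def Let_def
    using wf rX rY fmat_row[OF Y that] by (auto intro!: vadd_fvec mlp_row_fvec attn_row_fvec dest: in_set_takeD)
  show "eval_dec_layer fexp T L X Y \<in> fmat TF m (dim_model T)"
    using c by (rule fmatI_rows) (simp add: res fv)
  show "rows (eval_dec_layer fexp T L X Y) = dec_rows fexp T (rows X) L (rows Y)"
    using c Yd by (intro nth_equalityI) (auto simp: dec_rows_def res)
qed

definition enc_out :: "'a graph \<Rightarrow> fp vec list" where
  "enc_out G = fold (enc_rows fexp T) (encoder T) (map (emb T) (take (bos G) G))"

definition dec_out :: "'a graph \<Rightarrow> fp vec list" where
  "dec_out G = fold (dec_rows fexp T (enc_out G)) (decoder T) (map (emb T) (drop (bos G) G))"

lemma embed_rows:
  assumes "set xs \<subseteq> labels \<Sigma>"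
  shows "embed T xs \<in> fmat TF (length xs) (dim_model T)" "rows (embed T xs) = map (emb T) xs"
proof -
  have e: "emb T (xs ! i) \<in> fvec TF (dim_model T)" if "i < length xs" for i
  proof -
    have "emb T ` labels \<Sigma> \<subseteq> fvec TF (dim_model T)" using T by (simp add: is_transformer_def)
    moreover have "xs ! i \<in> labels \<Sigma>" using assms that by auto
    ultimately show ?thesis by blast
  qed
  then show "embed T xs \<in> fmat TF (length xs) (dim_model T)"
    by (auto simp: embed_def fmat_iff fvec_iff)
  have "row (embed T xs) i = emb T (xs ! i)" if "i < length xs" for i
    using e[OF that] that by (intro eq_vecI) (auto simp: embed_def fvec_iff)
  then show "rows (embed T xs) = map (emb T) xs"
    by (intro nth_equalityI) (auto simp: embed_def)
qed

lemma transformer_output_rows: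
  assumes G: "two_sorted \<Sigma> G" and v: "v \<in> suffix_vertices G"
  shows "transformer_output fexp T G v =
    list_of_vec (vadd TF (vmult TF (dec_out G ! (v - bos G)) (w_out T)) (b_out T))"
proof -
  have sub: "set (take (bos G) G) \<subseteq> labels \<Sigma>" "set (drop (bos G) G) \<subseteq> labels \<Sigma>"
    using G by (auto simp: two_sorted_def dest: in_set_takeD in_set_dropD)
  define X where "X = fold (eval_enc_layer fexp T) (encoder T) (embed T (take (bos G) G))"
  define Y where "Y = fold (\<lambda>L. eval_dec_layer fexp T L X) (decoder T) (embed T (drop (bos G) G))"
  have X1: "fold (eval_enc_layer fexp T) Ls X0 \<in> fmat TF n (dim_model T) \<and>
    rows (fold (eval_enc_layer fexp T) Ls X0) = fold (enc_rows fexp T) Ls (rows X0)"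
    if "set Ls \<subseteq> set (encoder T)" "X0 \<in> fmat TF n (dim_model T)" for Ls X0 n
    using that by (induction Ls arbitrary: X0) (auto simp: enc_layer_rows)
  have X: "X \<in> fmat TF (length (take (bos G) G)) (dim_model T)" "rows X = enc_out G"
    using X1[OF _ embed_rows(1)[OF sub(1)]] embed_rows(2)[OF sub(1)] by (auto simp: X_def enc_out_def)
  have Y1: "fold (\<lambda>L. eval_dec_layer fexp T L X) Ls Y0 \<in> fmat TF n (dim_model T) \<and>
    rows (fold (\<lambda>L. eval_dec_layer fexp T L X) Ls Y0) = fold (dec_rows fexp T (rows X)) Ls (rows Y0)"
    if "set Ls \<subseteq> set (decoder T)" "Y0 \<in> fmat TF n (dim_model T)" for Ls Y0 n
    using that by (induction Ls arbitrary: Y0) (auto simp: dec_layer_rows[OF _ X(1)])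
  have Y: "Y \<in> fmat TF (length (drop (bos G) G)) (dim_model T)" "rows Y = dec_out G"
    using Y1[OF _ embed_rows(1)[OF sub(2)]] embed_rows(2)[OF sub(2)] X(2) by (auto simp: Y_def dec_out_def)
  have i: "v - bos G < dim_row Y" using v Y(1) by (auto simp: suffix_vertices_def fmat_iff)
  have w: "dim_col Y = dim_row (w_out T)" using T Y(1) by (auto simp: is_transformer_def fmat_iff)
  have "row (eval_transformer fexp T G) (v - bos G) = vadd TF (row (fmat_mult TF Y (w_out T)) (v - bos G)) (b_out T)"
    unfolding eval_transformer_def Let_def X_def[symmetric] Y_def[symmetric]
    using i by (intro row_fmat_add_row) (simp add: fmat_mult_def fmat_mult_on_def)
  also have "row (fmat_mult TF Y (w_out T)) (v - bos G) = vmult TF (row Y (v - bos G)) (w_out T)"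
    by (rule row_fmat_mult[OF i w])
  also have "row Y (v - bos G) = dec_out G ! (v - bos G)" using i Y(2) by (metis nth_rows)
  finally show ?thesis by (simp add: transformer_output_def)
qed

end

section \<open>Definable functions\<close>

text \<open>Correctness is demanded at prefix vertices too, because counting modalities evaluate
  their argument there, although equivalence only compares outputs at suffix vertices.\<close>

definition definable :: "'a set \<Rightarrow> ('a graph \<Rightarrow> nat \<Rightarrow> bool) \<Rightarrow> bool" where
  "definable \<Sigma> P \<longleftrightarrow> (\<exists>\<phi>. set_gptl \<phi> \<subseteq> \<Sigma> \<and>
     (\<forall>G v. two_sorted \<Sigma> G \<longrightarrow> v < length G \<longrightarrow> (sat G v \<phi> \<longleftrightarrow> P G v)))"

definition definable_fun :: "'a set \<Rightarrow> ('a graph \<Rightarrow> nat \<Rightarrow> 'b) \<Rightarrow> bool" where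
  "definable_fun \<Sigma> f \<longleftrightarrow>
     (\<exists>R. finite R \<and> (\<forall>G v. two_sorted \<Sigma> G \<longrightarrow> v < length G \<longrightarrow> f G v \<in> R)) \<and>
     (\<forall>b. definable \<Sigma> (\<lambda>G v. f G v = b))"

lemma bos_props:
  assumes "two_sorted \<Sigma> G"
  shows "bos G < length G" "G ! bos G = None"
proof -
  have "\<exists>!w. w < length G \<and> G ! w = None" using assms by (simp add: two_sorted_def)
  from theI'[OF this] show "bos G < length G" "G ! bos G = None" by (auto simp: bos_def)
qed

lemma definable_cong:
  assumes "\<And>G v. two_sorted \<Sigma> G \<Longrightarrow> v < length G \<Longrightarrow> P G v = Q G v"
  shows "definable \<Sigma> P = definable \<Sigma> Q"
  unfolding definable_def using assms by (metis (no_types, lifting))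

lemma definable_fun_cong:
  assumes "\<And>G v. two_sorted \<Sigma> G \<Longrightarrow> v < length G \<Longrightarrow> f G v = g G v"
  shows "definable_fun \<Sigma> f = definable_fun \<Sigma> g"
proof -
  have "definable \<Sigma> (\<lambda>G v. f G v = b) = definable \<Sigma> (\<lambda>G v. g G v = b)" for b
    using assms by (intro definable_cong) auto
  then show ?thesis unfolding definable_fun_def using assms by (metis (no_types, lifting))
qed

lemma definable_const: "definable \<Sigma> (\<lambda>G v. b)"
  unfolding definable_def by (rule exI[of _ "if b then Neg Bot else Bot"]) auto

lemma definable_not: "definable \<Sigma> P \<Longrightarrow> definable \<Sigma> (\<lambda>G v. \<not> P G v)"
  unfolding definable_def by (elim exE, rule_tac x = "Neg \<phi>" in exI) auto

lemma definable_conj: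
  assumes "definable \<Sigma> P" "definable \<Sigma> Q" shows "definable \<Sigma> (\<lambda>G v. P G v \<and> Q G v)"
proof -
  from assms obtain \<phi> \<psi> where "set_gptl \<phi> \<subseteq> \<Sigma>" "set_gptl \<psi> \<subseteq> \<Sigma>"
    "\<forall>G v. two_sorted \<Sigma> G \<longrightarrow> v < length G \<longrightarrow> (sat G v \<phi> \<longleftrightarrow> P G v)"
    "\<forall>G v. two_sorted \<Sigma> G \<longrightarrow> v < length G \<longrightarrow> (sat G v \<psi> \<longleftrightarrow> Q G v)"
    unfolding definable_def by blast
  then show ?thesis unfolding definable_def by (intro exI[of _ "And \<phi> \<psi>"]) auto
qed

lemma definable_disj:
  assumes "definable \<Sigma> P" "definable \<Sigma> Q" shows "definable \<Sigma> (\<lambda>G v. P G v \<or> Q G v)"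
  using definable_not[OF definable_conj[OF definable_not[OF assms(1)] definable_not[OF assms(2)]]] by simp

lemma definable_bex:
  assumes "finite I" "\<And>i. i \<in> I \<Longrightarrow> definable \<Sigma> (P i)"
  shows "definable \<Sigma> (\<lambda>G v. \<exists>i\<in>I. P i G v)"
  using assms by (induction I) (auto simp: definable_const intro!: definable_disj)

lemma definable_count_prefix:
  assumes "definable \<Sigma> P" shows "definable \<Sigma> (\<lambda>G v. k \<le> card {u \<in> {..<bos G}. P G u})"
proof -
  from assms obtain \<phi> where \<phi>: "set_gptl \<phi> \<subseteq> \<Sigma>"
    "\<And>G v. two_sorted \<Sigma> G \<Longrightarrow> v < length G \<Longrightarrow> (sat G v \<phi> \<longleftrightarrow> P G v)"
    unfolding definable_def by blast
  have "sat G v (GPre k \<phi>) \<longleftrightarrow> k \<le> card {u \<in> {..<bos G}. P G u}" if "two_sorted \<Sigma> G" for G v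
  proof -
    have "{u. u < bos G \<and> sat G u \<phi>} = {u \<in> {..<bos G}. P G u}"
      using \<phi>(2)[OF that] bos_props(1)[OF that] by (auto dest: less_trans)
    then show ?thesis by simp
  qed
  then show ?thesis using \<phi>(1) unfolding definable_def by (intro exI[of _ "GPre k \<phi>"]) auto
qed

lemma definable_count_suffix:
  assumes "definable \<Sigma> P" shows "definable \<Sigma> (\<lambda>G v. k \<le> card {u \<in> {bos G..v}. P G u})"
proof -
  from assms obtain \<phi> where \<phi>: "set_gptl \<phi> \<subseteq> \<Sigma>"
    "\<And>G v. two_sorted \<Sigma> G \<Longrightarrow> v < length G \<Longrightarrow> (sat G v \<phi> \<longleftrightarrow> P G v)"
    unfolding definable_def by blast
  have "sat G v (PSuf k \<phi>) \<longleftrightarrow> k \<le> card {u \<in> {bos G..v}. P G u}" if "two_sorted \<Sigma> G" "v < length G" for G v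
  proof -
    have "{u \<in> suffix_vertices G. u \<le> v \<and> sat G u \<phi>} = {u \<in> {bos G..v}. P G u}"
      using \<phi>(2)[OF that(1)] that by (auto simp: suffix_vertices_def)
    then show ?thesis by simp
  qed
  then show ?thesis using \<phi>(1) unfolding definable_def by (intro exI[of _ "PSuf k \<phi>"]) auto
qed

lemma definable_fun_range:
  "definable_fun \<Sigma> f \<Longrightarrow> \<exists>R. finite R \<and> (\<forall>G v. two_sorted \<Sigma> G \<longrightarrow> v < length G \<longrightarrow> f G v \<in> R)"
  by (simp add: definable_fun_def)

lemma definable_fun_val: "definable_fun \<Sigma> f \<Longrightarrow> definable \<Sigma> (\<lambda>G v. f G v = b)"
  by (simp add: definable_fun_def)

lemma definable_funI:
  assumes "finite R" "\<And>G v. two_sorted \<Sigma> G \<Longrightarrow> v < length G \<Longrightarrow> f G v \<in> R"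
    "\<And>b. definable \<Sigma> (\<lambda>G v. f G v = b)"
  shows "definable_fun \<Sigma> f"
  using assms unfolding definable_fun_def by blast

lemma definable_fun_const: "definable_fun \<Sigma> (\<lambda>G v. b)"
  by (rule definable_funI[of "{b}"]) (auto simp: definable_const)

lemma definable_fun_pred:
  assumes "definable \<Sigma> P" shows "definable_fun \<Sigma> P"
proof (rule definable_funI[of UNIV])
  show "definable \<Sigma> (\<lambda>G v. P G v = b)" for b
    using assms definable_not[OF assms] by (cases b) auto
qed auto

lemma definable_fun_comp:
  assumes "definable_fun \<Sigma> f" shows "definable_fun \<Sigma> (\<lambda>G v. h (f G v))"
proof -
  obtain R where R: "finite R" "\<And>G v. two_sorted \<Sigma> G \<Longrightarrow> v < length G \<Longrightarrow> f G v \<in> R"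
    using definable_fun_range[OF assms] by blast
  show ?thesis
  proof (rule definable_funI[of "h ` R"])
    fix b
    have "definable \<Sigma> (\<lambda>G v. \<exists>x\<in>{x \<in> R. h x = b}. f G v = x)"
      using R(1) definable_fun_val[OF assms] by (intro definable_bex) auto
    moreover have "definable \<Sigma> (\<lambda>G v. \<exists>x\<in>{x \<in> R. h x = b}. f G v = x) = definable \<Sigma> (\<lambda>G v. h (f G v) = b)"
      using R(2) by (intro definable_cong) auto
    ultimately show "definable \<Sigma> (\<lambda>G v. h (f G v) = b)" by simp
  qed (use R in auto)
qed

lemma definable_fun_Pair:
  assumes "definable_fun \<Sigma> f" "definable_fun \<Sigma> g" shows "definable_fun \<Sigma> (\<lambda>G v. (f G v, g G v))"
proof -
  obtain R where R: "finite R" "\<And>G v. two_sorted \<Sigma> G \<Longrightarrow> v < length G \<Longrightarrow> f G v \<in> R"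
    using definable_fun_range[OF assms(1)] by blast
  obtain S where S: "finite S" "\<And>G v. two_sorted \<Sigma> G \<Longrightarrow> v < length G \<Longrightarrow> g G v \<in> S"
    using definable_fun_range[OF assms(2)] by blast
  show ?thesis
  proof (rule definable_funI[of "R \<times> S"])
    fix b :: "'b \<times> 'c"
    have "definable \<Sigma> (\<lambda>G v. f G v = fst b \<and> g G v = snd b)"
      by (intro definable_conj definable_fun_val assms)
    then show "definable \<Sigma> (\<lambda>G v. (f G v, g G v) = b)" by (cases b) simp
  qed (use R S in auto)
qed

lemma definable_fun_comp2:
  assumes "definable_fun \<Sigma> f" "definable_fun \<Sigma> g" shows "definable_fun \<Sigma> (\<lambda>G v. h (f G v) (g G v))"
  using definable_fun_comp[OF definable_fun_Pair[OF assms], of "\<lambda>(x, y). h x y"] by simp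

lemma definable_fun_comp3:
  assumes "definable_fun \<Sigma> f" "definable_fun \<Sigma> g" "definable_fun \<Sigma> k"
  shows "definable_fun \<Sigma> (\<lambda>G v. h (f G v) (g G v) (k G v))"
  using definable_fun_comp2[OF definable_fun_Pair[OF assms(1,2)] assms(3), of "\<lambda>(x, y). h x y"] by simp

text \<open>The logic has no atom for BOS. Since \<Sigma> is finite, the label \<open>None\<close>
  is defined by the negated disjunction of all tokens.\<close>

lemma definable_fun_label:
  assumes "finite \<Sigma>" shows "definable_fun \<Sigma> (\<lambda>G v. G ! v)"
proof (rule definable_funI[of "labels \<Sigma>"])
  show "G ! v \<in> labels \<Sigma>" if "two_sorted \<Sigma> G" "v < length G" for G v
    using that by (auto simp: two_sorted_def)
  have some: "definable \<Sigma> (\<lambda>G v. G ! v = Some a)" if "a \<in> \<Sigma>" for a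
    unfolding definable_def using that by (intro exI[of _ "Atom a"]) auto
  fix b
  show "definable \<Sigma> (\<lambda>G v. G ! v = b)"
  proof (cases b)
    case None
    have "definable \<Sigma> (\<lambda>G v. \<not> (\<exists>a\<in>\<Sigma>. G ! v = Some a))"
      using assms some by (intro definable_not definable_bex)
    moreover have "(\<not> (\<exists>a\<in>\<Sigma>. G ! v = Some a)) = (G ! v = None)" if "two_sorted \<Sigma> G" "v < length G" for G v
    proof -
      have "G ! v \<in> labels \<Sigma>" using that by (auto simp: two_sorted_def)
      then show ?thesis by (auto simp: labels_def)
    qed
    ultimately show ?thesis
      using definable_cong[of \<Sigma> "\<lambda>G v. \<not> (\<exists>a\<in>\<Sigma>. G ! v = Some a)" "\<lambda>G v. G ! v = None"] None by simp
  next
    case (Some a)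
    show ?thesis
    proof (cases "a \<in> \<Sigma>")
      case True
      then show ?thesis using some Some by simp
    next
      case False
      have "(G ! v = Some a) = False" if "two_sorted \<Sigma> G" "v < length G" for G v
      proof -
        have "G ! v \<in> labels \<Sigma>" using that by (auto simp: two_sorted_def)
        then show ?thesis using False by (auto simp: labels_def)
      qed
      then show ?thesis
        using definable_cong[of \<Sigma> "\<lambda>G v. G ! v = Some a" "\<lambda>G v. False"] definable_const Some by simp
    qed
  qed
qed (use assms in \<open>auto simp: labels_def\<close>)

text \<open>A value below the cap is pinned down by two threshold predicates, the cap itself by
  one.\<close>

lemma definable_fun_min:
  assumes "\<And>j. definable \<Sigma> (\<lambda>G v. j \<le> (n G v :: nat))"
  shows "definable_fun \<Sigma> (\<lambda>G v. min k (n G v))"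
proof (rule definable_funI[of "{..k}"])
  fix b
  consider "b < k" | "b = k" | "k < b" by linarith
  then show "definable \<Sigma> (\<lambda>G v. min k (n G v) = b)"
  proof cases
    case 1
    then have "min k i = b \<longleftrightarrow> b \<le> i \<and> \<not> Suc b \<le> i" for i by auto
    then show ?thesis using definable_conj[OF assms[of b] definable_not[OF assms[of "Suc b"]]] by simp
  next
    case 2
    then have "min k i = b \<longleftrightarrow> k \<le> i" for i by auto
    then show ?thesis using assms[of k] by simp
  next
    case 3
    then have "min k i = b \<longleftrightarrow> False" for i by auto
    then show ?thesis using definable_const[of \<Sigma> False] by simp
  qed
qed auto

lemma definable_fun_sum:
  fixes g :: "'c \<Rightarrow> 'a graph \<Rightarrow> nat \<Rightarrow> 'b::comm_monoid_add"
  assumes "finite R" "\<And>x. x \<in> R \<Longrightarrow> definable_fun \<Sigma> (g x)"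
  shows "definable_fun \<Sigma> (\<lambda>G v. \<Sum>x\<in>R. g x G v)"
  using assms
  by (induction R) (auto simp: definable_fun_const intro!: definable_fun_comp2[where h = "(+)"])

section \<open>Capped multisets of values as definable functions\<close>

lemma count_cap [simp]: "count (cap k M) x = min k (count M x)"
proof -
  have "count (cap k M) x = (\<Sum>y\<in>set_mset M. if y = x then min k (count M y) else 0)"
    unfolding cap_def by (auto simp: count_sum intro!: sum.cong)
  also have "\<dots> = (if x \<in># M then min k (count M x) else 0)" by simp
  also have "\<dots> = min k (count M x)" by (cases "x \<in># M") (simp_all only: not_in_iff if_True if_False min_0R if_cancel)
  finally show ?thesis .
qed

lemma cap_eq_cap: "cap_eq k M (cap k M)"
  by (simp add: cap_eq_def)

lemma set_mset_cap: "set_mset (cap k M) \<subseteq> set_mset M"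
proof
  fix x assume "x \<in># cap k M"
  then have "0 < min k (count M x)" by (metis count_cap count_greater_zero_iff)
  then show "x \<in># M" by (metis count_greater_zero_iff min_less_iff_conj)
qed

lemma count_image_mset_set:
  assumes "finite A" shows "count (image_mset f (mset_set A)) x = card {u \<in> A. f u = x}"
  using assms
proof (induction A)
  case (insert a A)
  have "{u \<in> insert a A. f u = x} = (if f a = x then insert a {u \<in> A. f u = x} else {u \<in> A. f u = x})"
    by auto
  then show ?case using insert by simp
qed simp

text \<open>Summing over a fixed \<open>R\<close> instead of the support makes the index set
  independent of the graph, as closure under finite sums requires.\<close>

lemma cap_eq_sum:
  assumes "finite R" "set_mset M \<subseteq> R"
  shows "cap k M = (\<Sum>x\<in>R. replicate_mset (min k (count M x)) x)"
  unfolding cap_def using assms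
  by (intro sum.mono_neutral_left) (auto simp only: not_in_iff min_0R replicate_mset_0)

text \<open>The positions \<open>A G v\<close> are constrained mainly by the second hypothesis:
  thresholds on the number of positions with a definable property have to be definable. The two
  modalities provide this for the prefix and for the suffix up to \<open>v\<close>.\<close>

lemma definable_fun_cap:
  fixes A :: "'a graph \<Rightarrow> nat \<Rightarrow> nat set"
  assumes f: "definable_fun \<Sigma> f"
    and A: "\<And>P k. definable \<Sigma> P \<Longrightarrow> definable \<Sigma> (\<lambda>G v. k \<le> card {u \<in> A G v. P G u})"
    and len: "\<And>G v. two_sorted \<Sigma> G \<Longrightarrow> v < length G \<Longrightarrow> A G v \<subseteq> {..<length G}"
  shows "definable_fun \<Sigma> (\<lambda>G v. cap k (image_mset (f G) (mset_set (A G v))))"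
proof -
  obtain R where R: "finite R" "\<And>G v. two_sorted \<Sigma> G \<Longrightarrow> v < length G \<Longrightarrow> f G v \<in> R"
    using definable_fun_range[OF f] by blast
  have "definable_fun \<Sigma> (\<lambda>G v. \<Sum>x\<in>R. replicate_mset (min k (card {u \<in> A G v. f G u = x})) x)"
    using R(1) A[OF definable_fun_val[OF f]]
    by (intro definable_fun_sum definable_fun_comp[where h = "\<lambda>n. replicate_mset n _"] definable_fun_min)
  moreover have "cap k (image_mset (f G) (mset_set (A G v))) =
    (\<Sum>x\<in>R. replicate_mset (min k (card {u \<in> A G v. f G u = x})) x)" if "two_sorted \<Sigma> G" "v < length G" for G v
  proof -
    have fin: "finite (A G v)" using len[OF that] finite_subset by blast
    have "set_mset (image_mset (f G) (mset_set (A G v))) \<subseteq> R"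
      using R(2)[OF that(1)] len[OF that] fin by auto
    from cap_eq_sum[OF R(1) this, of k] show ?thesis by (simp add: count_image_mset_set[OF fin])
  qed
  ultimately show ?thesis
    using definable_fun_cong[of \<Sigma> "\<lambda>G v. cap k (image_mset (f G) (mset_set (A G v)))"
      "\<lambda>G v. \<Sum>x\<in>R. replicate_mset (min k (card {u \<in> A G v. f G u = x})) x"] by simp
qed

lemma definable_fun_cap_prefix:
  assumes "definable_fun \<Sigma> f"
  shows "definable_fun \<Sigma> (\<lambda>G v. cap k (image_mset (f G) (mset_set {..<bos G})))"
  using assms definable_count_prefix bos_props(1)
  by (intro definable_fun_cap[where A = "\<lambda>G v. {..<bos G}"]) fastforce+

lemma definable_fun_cap_suffix:
  assumes "definable_fun \<Sigma> f"
  shows "definable_fun \<Sigma> (\<lambda>G v. cap k (image_mset (f G) (mset_set {bos G..v})))"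
  using assms definable_count_suffix
  by (intro definable_fun_cap[where A = "\<lambda>G v. {bos G..v}"]) fastforce+

text \<open>Each bit is the composition of \<open>f\<close> with a projection. The common length is
  asked for at suffix vertices only, where outputs are compared.\<close>

lemma definable_fun_tuple:
  assumes f: "definable_fun \<Sigma> f" and n: "1 \<le> n"
    and len: "\<And>G v. two_sorted \<Sigma> G \<Longrightarrow> v \<in> suffix_vertices G \<Longrightarrow> length (f G v) = n"
  shows "\<exists>\<phi>s. is_formula_tuple \<Sigma> \<phi>s \<and> equivalent \<Sigma> f (tuple_output \<phi>s)"
proof -
  have "definable \<Sigma> (\<lambda>G v. f G v ! i)" for i
    using definable_fun_comp[OF f, of "\<lambda>xs. xs ! i"] unfolding definable_fun_def
    by (elim conjE) (drule spec[of _ True], simp)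
  then have "\<forall>i. \<exists>\<phi>. set_gptl \<phi> \<subseteq> \<Sigma> \<and>
    (\<forall>G v. two_sorted \<Sigma> G \<longrightarrow> v < length G \<longrightarrow> (sat G v \<phi> \<longleftrightarrow> f G v ! i))"
    unfolding definable_def by blast
  then obtain \<phi> where \<phi>: "\<And>i. set_gptl (\<phi> i) \<subseteq> \<Sigma>"
    "\<And>i G v. two_sorted \<Sigma> G \<Longrightarrow> v < length G \<Longrightarrow> (sat G v (\<phi> i) \<longleftrightarrow> f G v ! i)"
    by metis
  have "f G v = tuple_output (map \<phi> [0..<n]) G v" if "two_sorted \<Sigma> G" "v \<in> suffix_vertices G" for G v
    using len[OF that] \<phi>(2)[OF that(1)] that(2)
    by (intro nth_equalityI) (auto simp: tuple_output_def suffix_vertices_def)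
  then show ?thesis using \<phi>(1) n
    by (intro exI[of _ "map \<phi> [0..<n]"]) (auto simp: is_formula_tuple_def equivalent_def)
qed

section \<open>From automata and transformers to formulas\<close>

lemma automaton_to_formulas:
  assumes "finite \<Sigma>" "is_automaton \<Sigma> A"
  shows "\<exists>\<phi>s. is_formula_tuple \<Sigma> \<phi>s \<and> equivalent \<Sigma> (automaton_output A) (tuple_output \<phi>s)"
proof (rule definable_fun_tuple[of _ _ "outlen A"])
  have run: "definable_fun \<Sigma> (\<lambda>G. run_state A G t)" for t
  proof (induction t)
    case 0
    show ?case using definable_fun_comp[OF definable_fun_label[OF assms(1)]] by simp
  next
    case (Suc t)
    show ?case
      using definable_fun_comp3[OF Suc definable_fun_cap_prefix[OF Suc] definable_fun_cap_suffix[OF Suc],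
          where h = "delta A"] by simp
  qed
  show "definable_fun \<Sigma> (automaton_output A)"
    using definable_fun_comp[OF run[of "rounds A"], of "take (outlen A)"]
    by (simp add: automaton_output_def[abs_def])
  show "1 \<le> outlen A" using assms(2) by (simp add: is_automaton_def)
  fix G v assume G: "two_sorted \<Sigma> G" and v: "v \<in> suffix_vertices G"
  \<comment> \<open>Staying inside \<open>states A\<close> is needed for the length of the output;
    definability itself treats \<open>delta A\<close> as an arbitrary total function.\<close>
  have "\<forall>u<length G. run_state A G t u \<in> states A" for t
  proof (induction t)
    case 0
    show ?case
    proof (intro allI impI)
      fix u assume "u < length G"
      then have "G ! u \<in> labels \<Sigma>" using G by (auto simp: two_sorted_def)
      then show "run_state A G 0 u \<in> states A" using assms(2) by (auto simp: is_automaton_def)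
    qed
  next
    case (Suc t)
    have "cap (cap_bound A) (image_mset (run_state A G t) (mset_set S)) \<in> capped_msets (cap_bound A) (states A)"
      if "S \<subseteq> {..<length G}" for S
    proof -
      have "finite S" using that finite_subset by blast
      then have "set_mset (image_mset (run_state A G t) (mset_set S)) \<subseteq> states A"
        using Suc that by auto
      then show ?thesis using set_mset_cap by (force simp: capped_msets_def)
    qed
    then show ?case using Suc assms(2) bos_props(1)[OF G]
      by (auto simp: is_automaton_def subset_iff)
  qed
  then show "length (automaton_output A G v) = outlen A"
    using v assms(2) by (auto simp: automaton_output_def suffix_vertices_def is_automaton_def)
qed

text \<open>Attention is insensitive to the order of rows, so any list with the given multiset can
  represent it.\<close>

definition list_of_mset :: "'b multiset \<Rightarrow> 'b list" where
  "list_of_mset M = (SOME xs. mset xs = M)"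

lemma mset_list_of_mset [simp]: "mset (list_of_mset M) = M"
  unfolding list_of_mset_def by (rule someI_ex) (rule ex_mset)

section \<open>Definability through the layers of a transformer\<close>

context transformer
begin

abbreviation "capK \<equiv> card (floats TF)"

text \<open>The list enters a head in three places: the maximal score depends on the set of rows
  only, while the denominator and the weighted sum of values are floating-point sums over rows and
  thus invariant under capped equality.\<close>

lemma attn_row_cap_eq:
  assumes A: "wf_attention T A" and eq: "cap_eq capK (mset xs) (mset ys)"
    and xs: "set xs \<subseteq> fvec TF (dim_model T)" and y: "y \<in> fvec TF (dim_model T)"
  shows "attn_row fexp T A xs y = attn_row fexp T A ys y"
proof -
  have "floats TF \<noteq> {}" by (auto simp: floats_def)
  then have k1: "1 \<le> capK" using finite_floats[of TF] by (metis One_nat_def Suc_leI card_gt_0_iff)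
  have set: "set ys = set xs" using cap_eq_set_mset[OF k1 eq] by simp
  have sum: "fp_sum TF (map g xs) = fp_sum TF (map g ys)" if "\<And>x. x \<in> set xs \<Longrightarrow> g x \<in> floats TF" for g
    using fp_sum_map_cap_eq[OF F order_refl eq that] .
  have head: "head_row fexp T H xs y = head_row fexp T H ys y" if H: "wf_head H" for H
  proof -
    define s where "s = score T H y"
    have sfl: "s x \<in> floats TF" if "x \<in> set xs" for x
      unfolding s_def using score_floats[OF H _ y] xs that by blast
    have ss: "set (map s xs) = set (map s ys)" using set by simp
    then have max: "fp_max TF (map s xs) = fp_max TF (map s ys)" unfolding fp_max_def by simp
    have "sm_weight fexp TF (map s xs) (s x) = sm_weight fexp TF (map s ys) (s x)" if x: "x \<in> set xs" for x
    proof -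
      have "fp_max TF (map s xs) \<in> set (map s xs)"
        using x sfl by (intro fp_max_props(1)) auto
      then have "fp_max TF (map s xs) \<in> floats TF" using sfl by auto
      then have "fexp TF (fp_sub TF (s u) (fp_max TF (map s xs))) \<in> floats TF" if "u \<in> set xs" for u
        using fexp_floats[OF fp_sub_floats[OF F sfl[OF that]]] by blast
      from sum[of "\<lambda>u. fexp TF (fp_sub TF (s u) (fp_max TF (map s xs)))", OF this]
      show ?thesis unfolding sm_weight_def using ss by (simp add: max comp_def set)
    qed
    moreover have "fp_sum TF (map (\<lambda>x. fp_mult TF (sm_weight fexp TF (map s xs) (s x)) (vmult TF x (wV H) $ l)) xs)
      = fp_sum TF (map (\<lambda>x. fp_mult TF (sm_weight fexp TF (map s xs) (s x)) (vmult TF x (wV H) $ l)) ys)"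
      if "l < dim_col (wV H)" for l
    proof (rule sum)
      fix x assume x: "x \<in> set xs"
      have "vmult TF x (wV H) \<in> fvec TF (dim_val T)"
        using H xs x by (intro vmult_fvec[of _ "dim_model T"]) (auto simp: wf_head_def)
      moreover have "l < dim_val T" using that H by (auto simp: wf_head_def fmat_iff)
      ultimately have "vmult TF x (wV H) $ l \<in> floats TF" by (auto simp: fvec_iff)
      moreover have "sm_weight fexp TF (map s xs) (s x) \<in> floats TF"
        using x sfl by (intro sm_weight_floats) auto
      ultimately show "fp_mult TF (sm_weight fexp TF (map s xs) (s x)) (vmult TF x (wV H) $ l) \<in> floats TF"
        by (intro fp_mult_floats[OF F])
    qed
    moreover have "map (\<lambda>x. fp_mult TF (sm_weight fexp TF (map s xs) (s x)) (vmult TF x (wV H) $ l)) ys =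
      map (\<lambda>x. fp_mult TF (sm_weight fexp TF (map s ys) (s x)) (vmult TF x (wV H) $ l)) ys" for l
      using calculation(1) set by (intro map_cong) auto
    ultimately show ?thesis
      unfolding head_row_def s_def[symmetric] by (intro eq_vecI) auto
  qed
  have "head_row fexp T (heads A ! (j div dim_val T)) xs y = head_row fexp T (heads A ! (j div dim_val T)) ys y"
    if "j < length (heads A) * dim_val T" for j
    using that by (intro head wf_attentionD(1)[OF A] nth_mem) (simp add: less_mult_imp_div_less)
  then have "vec (length (heads A) * dim_val T)
     (\<lambda>j. head_row fexp T (heads A ! (j div dim_val T)) xs y $ (j mod dim_val T)) =
    vec (length (heads A) * dim_val T)
     (\<lambda>j. head_row fexp T (heads A ! (j div dim_val T)) ys y $ (j mod dim_val T))"
    by (intro eq_vecI) auto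
  then show ?thesis unfolding attn_row_def by simp
qed

text \<open>Definability speaks about all vertices, but encoder rows belong to prefix vertices only;
  elsewhere the function takes one fixed value, for which \<open>undefined\<close> serves.\<close>

definition prefix_definable :: "('a graph \<Rightarrow> fp vec list) \<Rightarrow> bool" where
  "prefix_definable X \<longleftrightarrow>
     (\<forall>G. two_sorted \<Sigma> G \<longrightarrow> length (X G) = bos G \<and> set (X G) \<subseteq> fvec TF (dim_model T)) \<and>
     definable_fun \<Sigma> (\<lambda>G v. if v < bos G then X G ! v else undefined)"

definition suffix_definable :: "('a graph \<Rightarrow> fp vec list) \<Rightarrow> bool" where
  "suffix_definable Y \<longleftrightarrow>
     (\<forall>G. two_sorted \<Sigma> G \<longrightarrow> length (Y G) = length G - bos G \<and> set (Y G) \<subseteq> fvec TF (dim_model T)) \<and>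
     definable_fun \<Sigma> (\<lambda>G v. if v < bos G then undefined else Y G ! (v - bos G))"

text \<open>A vertex lies in the prefix iff no suffix vertex is at or before it, which is the
  negation of a suffix modality with threshold 1.\<close>

lemma definable_fun_in_prefix: "definable_fun \<Sigma> (\<lambda>G v. v < bos G)"
proof -
  have "definable \<Sigma> (\<lambda>G v. \<not> 1 \<le> card {u \<in> {bos G..v}. True})"
    by (intro definable_not definable_count_suffix definable_const)
  moreover have "(\<not> 1 \<le> card {u \<in> {bos G..v}. True}) = (v < bos G)" for G :: "'a graph" and v
  proof -
    have "{u \<in> {bos G..v}. True} = {bos G..v}" by auto
    then show ?thesis by (simp only: card_atLeastAtMost) linarith
  qed
  ultimately show ?thesis by (intro definable_fun_pred) simp
qed

lemma prefix_definable_cap: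
  assumes "prefix_definable X"
  shows "definable_fun \<Sigma> (\<lambda>G v. cap k (mset (X G)))"
proof -
  let ?f = "\<lambda>G v. if v < bos G then X G ! v else undefined"
  have "definable_fun \<Sigma> (\<lambda>G v. cap k (image_mset (?f G) (mset_set {..<bos G})))"
    using assms by (intro definable_fun_cap_prefix) (simp add: prefix_definable_def)
  moreover have "image_mset (?f G) (mset_set {..<bos G}) = mset (X G)" if "two_sorted \<Sigma> G" for G
  proof -
    have len: "length (X G) = bos G" using assms that by (simp add: prefix_definable_def)
    have "mset (X G) = image_mset ((!) (X G)) (mset_set {..<bos G})"
      by (metis len map_nth mset_map mset_upt atLeast_upt lessThan_atLeast0)
    then show ?thesis by (auto intro: image_mset_cong)
  qed
  ultimately show ?thesis
    using definable_fun_cong[of \<Sigma> "\<lambda>G v. cap k (image_mset (?f G) (mset_set {..<bos G}))" "\<lambda>G v. cap k (mset (X G))"]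
    by auto
qed

lemma mset_take_Suc:
  "i < length ys \<Longrightarrow> mset (take (Suc i) ys) = image_mset (\<lambda>u. ys ! (u - b)) (mset_set {b..b + i})"
proof (induction i)
  case 0
  then show ?case by (cases ys) auto
next
  case (Suc i)
  have "{b..b + Suc i} = insert (b + Suc i) {b..b + i}" by auto
  then have "mset_set {b..b + Suc i} = add_mset (b + Suc i) (mset_set {b..b + i})" by simp
  then show ?case using Suc by (simp add: take_Suc_conv_app_nth[of "Suc i"])
qed

lemma suffix_definable_cap:
  assumes "suffix_definable Y"
  shows "definable_fun \<Sigma> (\<lambda>G v. if v < bos G then undefined else cap k (mset (take (Suc (v - bos G)) (Y G))))"
proof -
  let ?f = "\<lambda>G v. if v < bos G then undefined else Y G ! (v - bos G)"
  have "definable_fun \<Sigma> (\<lambda>G v. cap k (image_mset (?f G) (mset_set {bos G..v})))"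
    using assms by (intro definable_fun_cap_suffix) (simp add: suffix_definable_def)
  from definable_fun_comp2[OF definable_fun_in_prefix this, where h = "\<lambda>b M. if b then undefined else M"]
  have "definable_fun \<Sigma> (\<lambda>G v. if v < bos G then undefined else cap k (image_mset (?f G) (mset_set {bos G..v})))" .
  moreover have "image_mset (?f G) (mset_set {bos G..v}) = mset (take (Suc (v - bos G)) (Y G))"
    if "two_sorted \<Sigma> G" "v < length G" "\<not> v < bos G" for G v
  proof -
    have "v - bos G < length (Y G)" using assms that by (auto simp: suffix_definable_def)
    from mset_take_Suc[OF this, of "bos G"] that(3) show ?thesis
      by (auto intro: image_mset_cong)
  qed
  ultimately show ?thesis
    using definable_fun_cong[of \<Sigma> "\<lambda>G v. if v < bos G then undefined else cap k (image_mset (?f G) (mset_set {bos G..v}))"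
       "\<lambda>G v. if v < bos G then undefined else cap k (mset (take (Suc (v - bos G)) (Y G)))"]
    by auto
qed

lemma cap_eq_list_of_mset: "cap_eq k (mset xs) (mset (list_of_mset (cap k (mset xs))))"
  by (simp add: cap_eq_cap)

text \<open>The new row is a function of three definable data: the side of the vertex, the old row,
  and the capped multiset of all rows, turned back into a list by
  \<open>list_of_mset\<close>.\<close>

lemma prefix_definable_enc:
  assumes X: "prefix_definable X" and L: "L \<in> set (encoder T)"
  shows "prefix_definable (\<lambda>G. enc_rows fexp T L (X G))"
proof -
  have wf: "wf_attention T (enc_self L)" "wf_mlp T (enc_mlp L)"
    using T L by (auto simp: is_transformer_def)
  have Xp: "length (X G) = bos G" "set (X G) \<subseteq> fvec TF (dim_model T)" if "two_sorted \<Sigma> G" for G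
    using X that by (auto simp: prefix_definable_def)
  have fv: "enc_row fexp T L xs y \<in> fvec TF (dim_model T)"
    if "set xs \<subseteq> fvec TF (dim_model T)" "y \<in> fvec TF (dim_model T)" for xs y
    unfolding enc_row_def Let_def using wf that by (auto intro!: vadd_fvec mlp_row_fvec attn_row_fvec)
  let ?f = "\<lambda>G v. if v < bos G then X G ! v else undefined"
  have f: "definable_fun \<Sigma> ?f" using X by (simp add: prefix_definable_def)
  note definable_fun_comp3[OF definable_fun_in_prefix f prefix_definable_cap[OF X, of capK],
    where h = "\<lambda>b y M. if b then enc_row fexp T L (list_of_mset M) y else undefined"]
  moreover have "enc_row fexp T L (list_of_mset (cap capK (mset (X G)))) (X G ! v) = enc_rows fexp T L (X G) ! v"
    if G: "two_sorted \<Sigma> G" and v: "v < bos G" for G v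
  proof -
    have y: "X G ! v \<in> fvec TF (dim_model T)" using Xp[OF G] v by auto
    show ?thesis
      using attn_row_cap_eq[OF wf(1) cap_eq_list_of_mset Xp(2)[OF G] y] Xp(1)[OF G] v
      by (simp add: enc_rows_def enc_row_def)
  qed
  ultimately have "definable_fun \<Sigma> (\<lambda>G v. if v < bos G then enc_rows fexp T L (X G) ! v else undefined)"
    using definable_fun_cong[of \<Sigma> "\<lambda>G v. if v < bos G then enc_row fexp T L (list_of_mset (cap capK (mset (X G)))) (?f G v) else undefined"
       "\<lambda>G v. if v < bos G then enc_rows fexp T L (X G) ! v else undefined"] by auto
  moreover have "set (enc_rows fexp T L (X G)) \<subseteq> fvec TF (dim_model T)" if "two_sorted \<Sigma> G" for G
    using fv[OF Xp(2)[OF that]] Xp(2)[OF that] by (auto simp: enc_rows_def)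
  moreover have "length (enc_rows fexp T L (X G)) = length (X G)" for G by (simp add: enc_rows_def)
  ultimately show ?thesis using Xp(1) by (simp add: prefix_definable_def)
qed

text \<open>Self-attention needs the capped multiset of the suffix rows up to the vertex,
  cross-attention that of all encoder rows. Both are definable, so the layer is one function applied
  to them and to the old row.\<close>

lemma suffix_definable_dec:
  assumes X: "prefix_definable X" and Y: "suffix_definable Y" and L: "L \<in> set (decoder T)"
  shows "suffix_definable (\<lambda>G. dec_rows fexp T (X G) L (Y G))"
proof -
  have wf: "wf_attention T (dec_self L)" "wf_attention T (dec_cross L)" "wf_mlp T (dec_mlp L)"
    using T L by (auto simp: is_transformer_def)
  have Xp: "set (X G) \<subseteq> fvec TF (dim_model T)" if "two_sorted \<Sigma> G" for G
    using X that by (auto simp: prefix_definable_def)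
  have Yp: "length (Y G) = length G - bos G" "set (Y G) \<subseteq> fvec TF (dim_model T)" if "two_sorted \<Sigma> G" for G
    using Y that by (auto simp: suffix_definable_def)
  have fv: "dec_row fexp T L xs ys y \<in> fvec TF (dim_model T)"
    if "set xs \<subseteq> fvec TF (dim_model T)" "set ys \<subseteq> fvec TF (dim_model T)" "y \<in> fvec TF (dim_model T)" for xs ys y
    unfolding dec_row_def Let_def using wf that by (auto intro!: vadd_fvec mlp_row_fvec attn_row_fvec)
  let ?f = "\<lambda>G v. if v < bos G then undefined else Y G ! (v - bos G)"
  let ?M = "\<lambda>G v. if v < bos G then undefined else cap capK (mset (take (Suc (v - bos G)) (Y G)))"
  have f: "definable_fun \<Sigma> ?f" using Y by (simp add: suffix_definable_def)
  note definable_fun_comp3[OF definable_fun_Pair[OF definable_fun_in_prefix f]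
      prefix_definable_cap[OF X, of capK] suffix_definable_cap[OF Y, of capK],
    where h = "\<lambda>(b, y) N M. if b then undefined else dec_row fexp T L (list_of_mset N) (list_of_mset M) y"]
  moreover have "dec_row fexp T L (list_of_mset (cap capK (mset (X G))))
      (list_of_mset (cap capK (mset (take (Suc (v - bos G)) (Y G))))) (Y G ! (v - bos G)) =
      dec_rows fexp T (X G) L (Y G) ! (v - bos G)"
    if G: "two_sorted \<Sigma> G" and v: "\<not> v < bos G" "v < length G" for G v
  proof -
    have i: "v - bos G < length (Y G)" using Yp[OF G] v by auto
    then have y: "Y G ! (v - bos G) \<in> fvec TF (dim_model T)" using Yp(2)[OF G] by auto
    have tk: "set (take (Suc (v - bos G)) (Y G)) \<subseteq> fvec TF (dim_model T)"
      using Yp(2)[OF G] by (auto dest: in_set_takeD)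
    \<comment> \<open>Cross-attention is queried with the row after self-attention, which must be
      known to consist of floats before \<open>attn_row_cap_eq\<close> applies.\<close>
    define y' where "y' = vadd TF (attn_row fexp T (dec_self L) (take (Suc (v - bos G)) (Y G)) (Y G ! (v - bos G))) (Y G ! (v - bos G))"
    have y': "y' \<in> fvec TF (dim_model T)" unfolding y'_def
      using wf tk y by (intro vadd_fvec attn_row_fvec)
    show ?thesis
      using attn_row_cap_eq[OF wf(1) cap_eq_list_of_mset tk y]
        attn_row_cap_eq[OF wf(2) cap_eq_list_of_mset Xp[OF G] y'] i
      by (simp add: dec_rows_def dec_row_def Let_def y'_def)
  qed
  ultimately have "definable_fun \<Sigma> (\<lambda>G v. if v < bos G then undefined else dec_rows fexp T (X G) L (Y G) ! (v - bos G))"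
    using definable_fun_cong[of \<Sigma> "\<lambda>G v. (\<lambda>(b, y) N M. if b then undefined
        else dec_row fexp T L (list_of_mset N) (list_of_mset M) y)
      (v < bos G, ?f G v) (cap capK (mset (X G))) (?M G v)"
      "\<lambda>G v. if v < bos G then undefined else dec_rows fexp T (X G) L (Y G) ! (v - bos G)"] by auto
  moreover have "set (dec_rows fexp T (X G) L (Y G)) \<subseteq> fvec TF (dim_model T)" if "two_sorted \<Sigma> G" for G
  proof -
    have "dec_row fexp T L (X G) (take (Suc i) (Y G)) (Y G ! i) \<in> fvec TF (dim_model T)" if "i < length (Y G)" for i
      using Yp(2)[OF \<open>two_sorted \<Sigma> G\<close>] that
      by (intro fv[OF Xp[OF \<open>two_sorted \<Sigma> G\<close>]]) (auto dest: in_set_takeD)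
    then show ?thesis by (auto simp: dec_rows_def)
  qed
  moreover have "length (dec_rows fexp T (X G) L (Y G)) = length (Y G)" for G by (simp add: dec_rows_def)
  ultimately show ?thesis using Yp(1) by (simp add: suffix_definable_def)
qed

lemma emb_fvec: "x \<in> labels \<Sigma> \<Longrightarrow> emb T x \<in> fvec TF (dim_model T)"
  using T unfolding is_transformer_def by blast

lemma suffix_definable_dec_out:
  assumes fin: "finite \<Sigma>"
  shows "suffix_definable dec_out"
proof -
  have lab: "G ! v \<in> labels \<Sigma>" if "two_sorted \<Sigma> G" "v < length G" for G v
    using that by (auto simp: two_sorted_def)
  have sub: "set (take (bos G) G) \<subseteq> labels \<Sigma>" "set (drop (bos G) G) \<subseteq> labels \<Sigma>" if "two_sorted \<Sigma> G" for G
    using that by (auto simp: two_sorted_def dest: in_set_takeD in_set_dropD)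
  have e: "definable_fun \<Sigma> (\<lambda>G v. emb T (G ! v))"
    using definable_fun_comp[OF definable_fun_label[OF fin]] .
  note d = definable_fun_comp2[OF definable_fun_in_prefix e, where h = "\<lambda>b x. if b then x else undefined"]
  have "definable_fun \<Sigma> (\<lambda>G v. if v < bos G then map (emb T) (take (bos G) G) ! v else undefined)"
    by (rule definable_fun_cong[THEN iffD1, OF _ d]) simp
  then have X0: "prefix_definable (\<lambda>G. map (emb T) (take (bos G) G))"
    using bos_props(1) sub by (auto simp: prefix_definable_def less_imp_le intro!: emb_fvec)
  have "prefix_definable (\<lambda>G. fold (enc_rows fexp T) Ls (X G))"
    if "prefix_definable X" "set Ls \<subseteq> set (encoder T)" for Ls X
    using that
  proof (induction Ls arbitrary: X)
    case (Cons L Ls)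
    then show ?case using Cons.IH[OF prefix_definable_enc[OF Cons.prems(1), of L]] by simp
  qed simp
  from this[OF X0] have X: "prefix_definable enc_out" by (simp add: enc_out_def[abs_def])
  note d = definable_fun_comp2[OF definable_fun_in_prefix e, where h = "\<lambda>b x. if b then undefined else x"]
  have "definable_fun \<Sigma> (\<lambda>G v. if v < bos G then undefined else map (emb T) (drop (bos G) G) ! (v - bos G))"
    by (rule definable_fun_cong[THEN iffD1, OF _ d]) simp
  then have Y0: "suffix_definable (\<lambda>G. map (emb T) (drop (bos G) G))"
    using sub by (auto simp: suffix_definable_def intro!: emb_fvec)
  have "suffix_definable (\<lambda>G. fold (dec_rows fexp T (enc_out G)) Ls (Y G))"
    if "suffix_definable Y" "set Ls \<subseteq> set (decoder T)" for Ls Y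
    using that
  proof (induction Ls arbitrary: Y)
    case (Cons L Ls)
    then show ?case using Cons.IH[OF suffix_definable_dec[OF X Cons.prems(1), of L]] by simp
  qed simp
  from this[OF Y0] show ?thesis by (simp add: dec_out_def[abs_def])
qed

lemma transformer_to_formulas:
  assumes fin: "finite \<Sigma>" and nanb: "length (nanb TF) = prec TF + ebits TF + 1"
  shows "\<exists>\<phi>s. is_formula_tuple \<Sigma> \<phi>s \<and> equivalent \<Sigma> (bitwise_output fexp nanb T) (tuple_output \<phi>s)"
proof -
  define out where "out y = bitwise nanb TF (list_of_vec (vadd TF (vmult TF y (w_out T)) (b_out T)))" for y
  let ?f = "\<lambda>G v. if v < bos G then undefined else dec_out G ! (v - bos G)"
  have "definable_fun \<Sigma> ?f"
    using suffix_definable_dec_out[OF fin] by (simp add: suffix_definable_def)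
  note f = definable_fun_comp[OF this, of out]
  \<comment> \<open>All floats have bit strings of the same length, \<open>NaN\<close> by the
    assumption on \<open>nanb\<close>; a tuple of formulas has an output of fixed length.\<close>
  have bits: "length (fp_bits nanb TF x) = prec TF + ebits TF + 1" for x
    using nanb by (cases x) (auto simp: bin_def)
  have "length (bitwise nanb TF xs) = length xs * (prec TF + ebits TF + 1)" for xs
    by (induction xs) (auto simp: bitwise_def bits)
  moreover have d: "dim_col (w_out T) = dim_out T" "1 \<le> dim_out T"
    using T by (auto simp: is_transformer_def fmat_iff)
  ultimately have len: "length (out y) = dim_out T * (prec TF + ebits TF + 1)" for y
    by (simp add: out_def)
  have n: "1 \<le> dim_out T * (prec TF + ebits TF + 1)" using d(2) by simp
  obtain \<phi>s where \<phi>s: "is_formula_tuple \<Sigma> \<phi>s" "equivalent \<Sigma> (\<lambda>G v. out (?f G v)) (tuple_output \<phi>s)"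
    using definable_fun_tuple[OF f n len] by blast
  have "bitwise_output fexp nanb T G v = out (?f G v)" if "two_sorted \<Sigma> G" "v \<in> suffix_vertices G" for G v
    using transformer_output_rows[OF that] that(2)
    by (simp add: bitwise_output_def out_def suffix_vertices_def)
  then show ?thesis using \<phi>s by (auto simp: equivalent_def)
qed

end

section \<open>From formulas to automata\<close>

primrec subformulas :: "'a gptl \<Rightarrow> 'a gptl list" where
  "subformulas Bot = [Bot]"
| "subformulas (Atom a) = [Atom a]"
| "subformulas (Neg \<phi>) = subformulas \<phi> @ [Neg \<phi>]"
| "subformulas (And \<phi> \<psi>) = subformulas \<phi> @ subformulas \<psi> @ [And \<phi> \<psi>]"
| "subformulas (GPre k \<phi>) = subformulas \<phi> @ [GPre k \<phi>]"
| "subformulas (PSuf k \<phi>) = subformulas \<phi> @ [PSuf k \<phi>]"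

primrec children :: "'a gptl \<Rightarrow> 'a gptl set" where
  "children Bot = {}"
| "children (Atom a) = {}"
| "children (Neg \<phi>) = {\<phi>}"
| "children (And \<phi> \<psi>) = {\<phi>, \<psi>}"
| "children (GPre k \<phi>) = {\<phi>}"
| "children (PSuf k \<phi>) = {\<phi>}"

primrec threshold :: "'a gptl \<Rightarrow> nat" where
  "threshold Bot = 0"
| "threshold (Atom a) = 0"
| "threshold (Neg \<phi>) = 0"
| "threshold (And \<phi> \<psi>) = 0"
| "threshold (GPre k \<phi>) = k"
| "threshold (PSuf k \<phi>) = k"

primrec depth :: "'a gptl \<Rightarrow> nat" where
  "depth Bot = 0"
| "depth (Atom a) = 0"
| "depth (Neg \<phi>) = Suc (depth \<phi>)"
| "depth (And \<phi> \<psi>) = Suc (max (depth \<phi>) (depth \<psi>))"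
| "depth (GPre k \<phi>) = Suc (depth \<phi>)"
| "depth (PSuf k \<phi>) = Suc (depth \<phi>)"

lemma subformulas_self: "\<phi> \<in> set (subformulas \<phi>)"
  by (cases \<phi>) auto

lemma subformulas_children: "\<psi> \<in> set (subformulas \<phi>) \<Longrightarrow> children \<psi> \<subseteq> set (subformulas \<phi>)"
  by (induction \<phi>) (auto simp: subformulas_self)

text \<open>States are capped before they are projected to a truth value. Several states may share
  that value, but merging capped multiplicities preserves comparisons with numbers below the
  cap.\<close>

lemma count_image_mset_cap:
  assumes "k < K"
  shows "k \<le> count (image_mset P (cap K M)) x \<longleftrightarrow> k \<le> count (image_mset P M) x"
proof -
  have "cap_eq K (image_mset P M) (image_mset P (cap K M))"
    using assms by (intro cap_eq_image_mset cap_eq_cap) auto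
  then have "min K (count (image_mset P M) x) = min K (count (image_mset P (cap K M)) x)"
    by (simp add: cap_eq_def)
  then show ?thesis using assms by (auto simp: min_def split: if_splits)
qed

context
  fixes L :: "'a gptl list"
begin

text \<open>A formula may occur in \<open>L\<close> several times. One occurrence with a true bit is
  enough; in states of the form \<open>map f L\<close> all occurrences agree.\<close>

definition truth :: "bool list \<Rightarrow> 'a gptl \<Rightarrow> bool" where
  "truth x \<psi> \<longleftrightarrow> (\<exists>i<length L. L ! i = \<psi> \<and> x ! i)"

lemma truth_map: "truth (map f L) \<psi> \<longleftrightarrow> \<psi> \<in> set L \<and> f \<psi>"
  unfolding truth_def by (auto simp: in_set_conv_nth)

definition step_truth ::
  "bool list \<Rightarrow> bool list multiset \<Rightarrow> bool list multiset \<Rightarrow> 'a gptl \<Rightarrow> bool" where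
  "step_truth x M N \<psi> = (case \<psi> of
       Bot \<Rightarrow> False
     | Atom a \<Rightarrow> truth x \<psi>
     | Neg \<phi> \<Rightarrow> \<not> truth x \<phi>
     | And \<phi> \<chi> \<Rightarrow> truth x \<phi> \<and> truth x \<chi>
     | GPre k \<phi> \<Rightarrow> k \<le> count (image_mset (\<lambda>s. truth s \<phi>) M) True
     | PSuf k \<phi> \<Rightarrow> k \<le> count (image_mset (\<lambda>s. truth s \<phi>) N) True)"

text \<open>The state stores one truth value per entry of \<open>L\<close>. The cap lies strictly
  above all thresholds, and as many rounds are run as the largest depth, since each round makes one
  more level of formulas correct.\<close>

definition formula_automaton :: "nat \<Rightarrow> 'a automaton" where
  "formula_automaton b = \<lparr>width = length L, states = {xs. length xs = length L},
     cap_bound = Suc (Max (threshold ` set L)),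
     init_state = (\<lambda>l. map (\<lambda>\<psi>. case \<psi> of Atom a \<Rightarrow> l = Some a | _ \<Rightarrow> False) L),
     delta = (\<lambda>x M N. map (step_truth x M N) L),
     rounds = Max (depth ` set L), outlen = b\<rparr>"

lemma is_automaton_formula_automaton:
  "1 \<le> b \<Longrightarrow> b \<le> length L \<Longrightarrow> is_automaton \<Sigma> (formula_automaton b)"
  using finite_lists_length_eq[of "UNIV :: bool set" "length L"]
  by (auto simp: is_automaton_def formula_automaton_def intro!: exI[of _ "replicate (length L) True"])

text \<open>The induction on rounds generalises over vertices, because a counting formula at
  \<open>v\<close> needs correct bits at other vertices one round earlier; \<open>closed\<close>
  guarantees that these bits are stored.\<close>

lemma truth_run_state:
  assumes closed: "\<And>\<psi>. \<psi> \<in> set L \<Longrightarrow> children \<psi> \<subseteq> set L"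
    and G: "two_sorted \<Sigma> G" and v: "v < length G" and \<psi>: "\<psi> \<in> set L" "depth \<psi> \<le> t"
  shows "truth (run_state (formula_automaton b) G t v) \<psi> \<longleftrightarrow> sat G v \<psi>"
  using v \<psi>
proof (induction t arbitrary: v \<psi>)
  case 0
  then show ?case by (cases \<psi>) (auto simp: formula_automaton_def truth_map)
next
  case (Suc t)
  let ?A = "formula_automaton b"
  have bos: "bos G < length G" using bos_props(1)[OF G] .
  have count: "k \<le> count (image_mset (\<lambda>s. truth s \<phi>) (cap (cap_bound ?A) (image_mset (run_state ?A G t) (mset_set S)))) True
      \<longleftrightarrow> k \<le> card {u \<in> S. sat G u \<phi>}"
    if "S \<subseteq> {..<length G}" "k \<le> Max (threshold ` set L)" "\<phi> \<in> set L" "depth \<phi> \<le> t" for S k \<phi>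
  proof -
    have "finite S" using that(1) finite_subset by blast
    have "k < cap_bound ?A" using that(2) by (simp add: formula_automaton_def)
    note count_image_mset_cap[OF this, of "\<lambda>s. truth s \<phi>" "image_mset (run_state ?A G t) (mset_set S)" True]
    also have "count (image_mset (\<lambda>s. truth s \<phi>) (image_mset (run_state ?A G t) (mset_set S))) True =
      card {u \<in> S. truth (run_state ?A G t u) \<phi>}"
      using count_image_mset_set[OF \<open>finite S\<close>, of "\<lambda>u. truth (run_state ?A G t u) \<phi>" True]
      by (simp add: image_mset.compositionality comp_def)
    also have "{u \<in> S. truth (run_state ?A G t u) \<phi>} = {u \<in> S. sat G u \<phi>}"
      using Suc.IH[of _ \<phi>] that by auto
    finally show ?thesis .
  qed
  have thr: "threshold \<psi> \<le> Max (threshold ` set L)" using Suc.prems(2) by auto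
  have ch: "\<phi> \<in> set L \<and> (truth (run_state ?A G t v) \<phi> \<longleftrightarrow> sat G v \<phi>)" if "\<phi> \<in> children \<psi>" "depth \<phi> \<le> t" for \<phi>
    using closed[OF Suc.prems(2)] that Suc.IH[OF Suc.prems(1)] by auto
  have run: "run_state ?A G (Suc t) v = map (step_truth (run_state ?A G t v)
      (cap (cap_bound ?A) (image_mset (run_state ?A G t) (mset_set {..<bos G})))
      (cap (cap_bound ?A) (image_mset (run_state ?A G t) (mset_set {bos G..v})))) L"
    by (simp add: formula_automaton_def)
  have pre: "{..<bos G} \<subseteq> {..<length G}" using bos by auto
  have suf: "{bos G..v} \<subseteq> {..<length G}" using Suc.prems(1) by auto
  have sufset: "{u \<in> suffix_vertices G. u \<le> v \<and> sat G u \<phi>} = {u \<in> {bos G..v}. sat G u \<phi>}" for \<phi>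
    using Suc.prems(1) by (auto simp: suffix_vertices_def)
  show ?case
  proof (cases \<psi>)
    case (Atom a)
    then show ?thesis using Suc.IH[OF Suc.prems(1,2)] Suc.prems(2)
      unfolding run truth_map by (simp add: step_truth_def)
  next
    case (GPre k \<phi>)
    then show ?thesis
      using Suc.prems(2,3) ch[of \<phi>] thr count[OF pre, of k \<phi>]
      unfolding run truth_map by (simp add: step_truth_def)
  next
    case (PSuf k \<phi>)
    then show ?thesis
      using Suc.prems(2,3) ch[of \<phi>] thr count[OF suf, of k \<phi>] sufset
      unfolding run truth_map by (simp add: step_truth_def)
  qed (use Suc.prems(2,3) ch in \<open>simp_all add: run truth_map step_truth_def del: run_state.simps\<close>)
qed

end

lemma formulas_to_automaton:
  assumes "is_formula_tuple \<Sigma> \<phi>s"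
  shows "\<exists>A. is_automaton \<Sigma> A \<and> equivalent \<Sigma> (tuple_output \<phi>s) (automaton_output A)"
proof -
  \<comment> \<open>The formulas of the tuple stand in front, so that their bits form the output
    prefix.\<close>
  define L where "L = \<phi>s @ concat (map subformulas \<phi>s)"
  have closed: "children \<psi> \<subseteq> set L" if "\<psi> \<in> set L" for \<psi>
    using that subformulas_children subformulas_self unfolding L_def by fastforce
  define A where "A = formula_automaton L (length \<phi>s)"
  have "is_automaton \<Sigma> A"
    unfolding A_def using assms
    by (intro is_automaton_formula_automaton) (auto simp: L_def is_formula_tuple_def Suc_le_eq)
  moreover have "tuple_output \<phi>s G v = automaton_output A G v"
    if G: "two_sorted \<Sigma> G" and v: "v \<in> suffix_vertices G" for G v
  proof -
    have v': "v < length G" using v by (simp add: suffix_vertices_def)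
    have len: "length (run_state A G t u) = length L" for t u
      by (cases t) (auto simp: A_def formula_automaton_def)
    have t: "truth L (run_state A G (rounds A) v) \<psi> \<longleftrightarrow> sat G v \<psi>" if "\<psi> \<in> set L" for \<psi>
      unfolding A_def using that
      by (intro truth_run_state[OF closed G v']) (auto simp: formula_automaton_def)
    obtain f where f: "run_state A G (rounds A) v = map f L"
      by (cases "rounds A") (auto simp: A_def formula_automaton_def)
    have "run_state A G (rounds A) v = map (sat G v) L"
      using t unfolding f truth_map by auto
    then show ?thesis
      by (simp add: automaton_output_def tuple_output_def) (simp add: A_def formula_automaton_def L_def)
  qed
  ultimately show ?thesis by (auto simp: equivalent_def)
qed

section \<open>Counting with a single attention head\<close>

lemma insort_key_map: "insort_key k (f x) (map f ys) = map f (insort_key (\<lambda>x. k (f x)) x ys)"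
  by (induction ys) auto

lemma sort_key_map: "sort_key k (map f xs) = map f (sort_key (\<lambda>x. k (f x)) xs)"
  by (induction xs) (auto simp: insort_key_map)

context float_exp
begin

lemma foldl_fp_add_exact:
  assumes "fv F a a0" "distinct js" "\<And>j. j \<in> set js \<Longrightarrow> fv F (f j) (v j)"
    "\<And>J. J \<subseteq> set js \<Longrightarrow> representable F (a0 + (\<Sum>j\<in>J. v j))"
  shows "fv F (foldl (fp_add F) a (map f js)) (a0 + (\<Sum>j\<in>set js. v j))"
  using assms
proof (induction js arbitrary: a a0)
  case (Cons j js)
  have "representable F (a0 + v j)" using Cons.prems(4)[of "{j}"] by simp
  then have "fv F (fp_add F a (f j)) (a0 + v j)"
    using Cons.prems by (intro fv_add[OF F]) auto
  moreover have "representable F (a0 + v j + (\<Sum>j\<in>J. v j))" if "J \<subseteq> set js" for J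
  proof -
    have "finite J" "j \<notin> J" using that Cons.prems(2) finite_subset by auto
    then show ?thesis using Cons.prems(4)[of "insert j J"] that by (auto simp: algebra_simps)
  qed
  ultimately have "fv F (foldl (fp_add F) (fp_add F a (f j)) (map f js)) (a0 + v j + (\<Sum>j\<in>set js. v j))"
    using Cons.prems by (intro Cons.IH) auto
  then show ?case using Cons.prems(2) by (simp add: algebra_simps)
qed simp

text \<open>Sorting decides in which order the summands are added, so representability is required
  of the partial sums over arbitrary index sets; then no addition rounds.\<close>

lemma fp_sum_exact:
  assumes "distinct js" "\<And>j. j \<in> set js \<Longrightarrow> fv F (f j) (v j)"
    "\<And>J. J \<subseteq> set js \<Longrightarrow> representable F (\<Sum>j\<in>J. v j)"
  shows "fv F (fp_sum F (map f js)) (\<Sum>j\<in>set js. v j)"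
proof -
  have "fv F (foldl (fp_add F) fp_zero (map f (sort_key (\<lambda>x. fp_key F (f x)) js)))
    (0 + (\<Sum>j\<in>set (sort_key (\<lambda>x. fp_key F (f x)) js). v j))"
    using assms by (intro foldl_fp_add_exact) auto
  then show ?thesis by (simp add: fp_sum_def sort_key_map)
qed

lemma fp_dot_exact:
  assumes "\<And>j. j < n \<Longrightarrow> fv F (x j) (\<rho> j)" "\<And>j. j < n \<Longrightarrow> fv F (w j) (\<omega> j)"
    "\<And>J. J \<subseteq> {..<n} \<Longrightarrow> representable F (\<Sum>j\<in>J. \<rho> j * \<omega> j)"
  shows "fv F (fp_sum F (map (\<lambda>j. fp_mult F (x j) (w j)) [0..<n])) (\<Sum>j<n. \<rho> j * \<omega> j)"
proof -
  have set: "set [0..<n] = {..<n}" by auto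
  have "fv F (fp_mult F (x j) (w j)) (\<rho> j * \<omega> j)" if "j < n" for j
    using assms(1,2)[OF that] assms(3)[of "{j}"] that by (intro fv_mult[OF F]) auto
  then have "fv F (fp_sum F (map (\<lambda>j. fp_mult F (x j) (w j)) [0..<n])) (\<Sum>j\<in>set [0..<n]. \<rho> j * \<omega> j)"
    using assms(3) by (intro fp_sum_exact) (auto simp only: set distinct_upt lessThan_iff)
  then show ?thesis by (simp only: set)
qed

lemma fv_one: "fv F (fp_one F) 1"
proof -
  have "nat (bias F) < 2 ^ ebits F"
  proof -
    have "bias F < 2 ^ ebits F" using two_pow_ebits[OF F] bias_nonneg[OF F] by linarith
    then have "int (nat (bias F)) < int (2 ^ ebits F)" using bias_nonneg[OF F] by simp
    then show ?thesis by (simp only: of_nat_less_iff)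
  qed
  moreover have "real (2 ^ (prec F - 1)) * mag F (nat (bias F)) = 1"
  proof -
    have "mag F (nat (bias F)) = 2 powi (- int (prec F - 1))"
      using bias_nonneg[OF F] prec_pos[OF F] by (simp add: mag_def of_nat_diff)
    then show ?thesis by (simp add: power_int_minus power_int_of_nat)
  qed
  ultimately show ?thesis
    using prec_pos[OF F] by (auto simp: fv_def fp_one_def fin_floats_def fp_val_Fin)
qed

lemma fp_round_sign: "r \<noteq> 0 \<Longrightarrow> fp_round F z r = fp_round F z' r"
  by (simp add: fp_round_def)

end

section \<open>Formats large enough for counting\<close>

text \<open>\<open>K\<close> bounds the thresholds. The bias keeps powers of two from
  \<open>2 powi (- int (prec F) - 1)\<close> up to \<open>2 ^ (2 * prec F + 2)\<close>
  representable; the precision keeps the rounding error of a weight harmless even after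
  multiplication with a count and a threshold of size about \<open>K\<close>.\<close>

locale count_format = float_exp F fexp c for F fexp c +
  fixes K :: nat
  assumes bias_large: "2 * int (prec F) + 10 \<le> bias F"
    and prec_large: "8 * (K + 2) ^ 2 \<le> 2 ^ prec F"
begin

definition fl :: "real \<Rightarrow> fp" where "fl r = fp_round F False r"

lemma fl_fv: "representable F r \<Longrightarrow> fv F (fl r) r"
  unfolding fl_def by (rule fp_round_exact[OF F])

lemma fl_floats [simp]: "fl r \<in> floats F"
  unfolding fl_def by (rule fp_round_floats[OF F])

lemma representable_int: "\<bar>i\<bar> \<le> 2 ^ prec F \<Longrightarrow> representable F (of_int i)"
  using representable_grid[OF F, of i 0] bias_large by simp

lemma representable_of_bool [simp]: "representable F (of_bool b)"
  using representable_int[of 1] by (cases b) auto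

lemma representable_one [simp]: "representable F 1"
  using representable_of_bool[of True] by simp

lemma representable_pow:
  assumes "- bias F - int (prec F) + 1 \<le> a" "a \<le> bias F + 1"
  shows "representable F (2 powi a)"
proof (cases "a \<le> bias F + 1 - int (prec F)")
  case True
  then show ?thesis using representable_grid[OF F, of 1 a] assms by simp
next
  case False
  then have "representable F (of_int (2 ^ prec F) * 2 powi (a - int (prec F)))"
    using assms bias_large by (intro representable_grid[OF F]) auto
  moreover have "of_int (2 ^ prec F) * 2 powi (a - int (prec F)) = (2 powi a :: real)"
    by (simp add: power_int_diff power_int_of_nat)
  ultimately show ?thesis by simp
qed

lemma representable_nat_pow: "int n \<le> bias F + 1 \<Longrightarrow> representable F (2 ^ n)"
  using representable_pow[of "int n"] bias_large by (simp add: power_int_of_nat)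

text \<open>A float with the largest exponent is normalised, so its magnitude is at least
  \<open>2 powi (bias F + 1)\<close>; below that the exponent can be raised by one.\<close>

lemma representable_double:
  assumes "representable F r" "\<bar>r\<bar> < 2 powi (bias F + 1)"
  shows "representable F (2 * r)"
proof -
  obtain x where x: "x \<in> fin_floats F" "fp_val F x = r" using assms(1) by (auto simp: representable_def fv_def)
  then obtain b e s where bes: "x = Fin b e s" "e < 2 ^ ebits F" "s < 2 ^ prec F" "2 ^ (prec F - 1) \<le> s \<or> e = 0"
    by (auto elim: fin_floatsE)
  have r: "r = (if b then - 1 else 1) * (real s * mag F e)"
    using x bes prec_pos[OF F] by (simp add: fp_val_Fin)
  then have abs: "\<bar>r\<bar> = real s * mag F e" by (simp add: abs_mult less_imp_le)
  have "Suc e < 2 ^ ebits F"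
  proof (rule ccontr)
    assume "\<not> Suc e < 2 ^ ebits F"
    with bes have e: "Suc e = 2 ^ ebits F" by simp
    then have "int (Suc e) = 2 * bias F + 2" using two_pow_ebits[OF F]
      by (metis of_nat_numeral of_nat_power)
    then have e': "int e = 2 * bias F + 1" by simp
    then have "e \<noteq> 0" using bias_large by auto
    then have "2 ^ (prec F - 1) \<le> s" using bes by simp
    then have "real (2 ^ (prec F - 1)) \<le> real s" by (rule of_nat_mono)
    then have "2 ^ (prec F - 1) * mag F e \<le> \<bar>r\<bar>" unfolding abs by (intro mult_right_mono) (auto simp: less_imp_le)
    moreover have "2 ^ (prec F - 1) * mag F e = 2 powi (bias F + 1)"
    proof -
      have "bias F + 1 = int (prec F - 1) + (int e - bias F - (int (prec F) - 1))"
        using e' prec_pos[OF F] by (simp add: of_nat_diff)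
      then show ?thesis unfolding mag_def by (simp only:) (subst power_int_add, simp_all add: power_int_of_nat)
    qed
    ultimately show False using assms(2) by simp
  qed
  from representable_mag[OF F bes(3) this] have "representable F (2 * (real s * mag F e))"
    by (simp add: mag_Suc algebra_simps)
  then show ?thesis unfolding r by (cases b) auto
qed

lemma representable_mult_pow:
  assumes "representable F r" "2 ^ n * \<bar>r\<bar> \<le> 2 powi (bias F + 1)"
  shows "representable F (2 ^ n * r)"
  using assms(2)
proof (induction n)
  case (Suc n)
  have le: "2 * (2 ^ n * \<bar>r\<bar>) \<le> 2 powi (bias F + 1)" using Suc.prems by (simp add: mult.assoc)
  have pos: "(0::real) < 2 powi (bias F + 1)" by simp
  have "2 ^ n * \<bar>r\<bar> < 2 powi (bias F + 1)" using le pos by linarith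
  then have "representable F (2 * (2 ^ n * r))"
    using Suc.IH by (intro representable_double) (auto simp: abs_mult)
  then show ?case by (simp add: mult.assoc)
qed (use assms in simp)

lemma no_overflow: "representable F y \<Longrightarrow> \<bar>r\<bar> \<le> y \<Longrightarrow> \<bar>r\<bar> < overflow_bound F"
  unfolding representable_def using fv_less_overflow[OF F] by fastforce

text \<open>Floats above \<open>2 ^ (prec F + 1)\<close> are so sparse that adding at most 1 cannot
  round beyond this number. Sums of arbitrarily many such terms therefore saturate instead of
  overflowing.\<close>

lemma fp_add_unit:
  assumes "fv F a a0" "0 \<le> a0" "a0 \<le> 2 ^ (prec F + 1)" "fv F x r" "0 \<le> r" "r \<le> 1"
  obtains b where "fv F (fp_add F a x) b" "a0 \<le> b" "r \<le> b" "b \<le> 2 ^ (prec F + 1)"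
    "\<And>y. representable F y \<Longrightarrow> y \<le> a0 + r \<Longrightarrow> y \<le> b"
    "\<And>y. representable F y \<Longrightarrow> a0 + r \<le> y \<Longrightarrow> b \<le> y"
proof -
  define b where "b = fp_val F (fp_add F a x)"
  have add: "fp_add F a x = fp_round F (neg a \<and> neg x) (a0 + r)"
    using fp_add_fin[OF F, of a x] assms by (auto simp: fv_def)
  have "representable F (2 ^ (prec F + 2))" using bias_large by (intro representable_nat_pow) simp
  moreover have "\<bar>a0 + r\<bar> \<le> 2 ^ (prec F + 2)"
  proof -
    have "(1::real) \<le> 2 ^ (prec F + 1)" by (rule one_le_power) simp
    moreover have "(2::real) ^ (prec F + 2) = 2 * 2 ^ (prec F + 1)" by simp
    ultimately show ?thesis using assms by linarith
  qed
  ultimately have ovf: "\<bar>a0 + r\<bar> < overflow_bound F" by (rule no_overflow)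
  have fv: "fv F (fp_add F a x) b"
    using fp_round_fin(1)[OF F ovf] by (simp add: fv_def b_def add)
  have lo: "y \<le> b" if "representable F y" "y \<le> a0 + r" for y
    unfolding b_def add using fp_round_ge[OF F that ovf] .
  have hi: "b \<le> y" if "representable F y" "a0 + r \<le> y" for y
    unfolding b_def add using fp_round_le[OF F that ovf] .
  have repB: "representable F (2 ^ (prec F + 1))" using bias_large by (intro representable_nat_pow) simp
  have "b \<le> 2 ^ (prec F + 1)"
  proof (rule ccontr)
    assume nb: "\<not> b \<le> 2 ^ (prec F + 1)"
    then have gt: "2 ^ (prec F + 1) < a0 + r" using hi[OF repB] by linarith
    \<comment> \<open>At this exponent the last significand bit weighs 2. The next float above
      \<open>2 ^ (prec F + 1)\<close> is at least 4 larger, while the exact sum exceeds it by at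
      most 1.\<close>
    define e where "e = nat (bias F + int (prec F))"
    have "mag F e = 2"
      using bias_large by (simp add: mag_def e_def)
    then have "2 ^ prec F * mag F e < fp_val F (fp_add F a x)" using nb b_def by simp
    from fp_val_gap[OF F fvD(1)[OF fv] this] have "2 ^ (prec F + 1) + 4 \<le> b"
      using \<open>mag F e = 2\<close> b_def by simp
    moreover have "\<bar>b - (a0 + r)\<bar> \<le> \<bar>2 ^ (prec F + 1) - (a0 + r)\<bar>"
      unfolding b_def add using fp_round_fin(3)[OF F ovf repB] .
    ultimately show False using gt assms by linarith
  qed
  then show ?thesis
    using that[OF fv _ _ _ lo hi] assms lo[OF representableI[OF assms(1)]] lo[OF representableI[OF assms(4)]] by auto
qed

text \<open>Rounding up to a representable bound makes the sum dominate each summand, so a sum of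
  tiny positive weights cannot vanish.\<close>

lemma foldl_unit_bounds:
  assumes "fv F a a0" "0 \<le> a0" "a0 \<le> 2 ^ (prec F + 1)"
    "\<And>x. x \<in> set xs \<Longrightarrow> x \<in> fin_floats F \<and> 0 \<le> fp_val F x \<and> fp_val F x \<le> 1"
  shows "\<exists>b. fv F (foldl (fp_add F) a xs) b \<and> a0 \<le> b \<and> b \<le> 2 ^ (prec F + 1) \<and> (\<forall>x\<in>set xs. fp_val F x \<le> b)"
  using assms
proof (induction xs arbitrary: a a0)
  case (Cons x xs)
  have x: "fv F x (fp_val F x)" "0 \<le> fp_val F x" "fp_val F x \<le> 1" using Cons.prems(4)[of x] by (auto simp: fv_def)
  from fp_add_unit[OF Cons.prems(1,2,3) x] obtain b where b: "fv F (fp_add F a x) b" "a0 \<le> b" "fp_val F x \<le> b"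
    "b \<le> 2 ^ (prec F + 1)" by metis
  have "0 \<le> b" using b Cons.prems by linarith
  from Cons.IH[OF b(1) this b(4)] Cons.prems(4) obtain b' where
    "fv F (foldl (fp_add F) (fp_add F a x) xs) b'" "b \<le> b'" "b' \<le> 2 ^ (prec F + 1)" "\<forall>x\<in>set xs. fp_val F x \<le> b'"
    by auto
  then show ?case using b by (intro exI[of _ b']) auto
qed auto

lemma fp_sum_unit_bounds:
  assumes "\<And>x. x \<in> set xs \<Longrightarrow> x \<in> fin_floats F \<and> 0 \<le> fp_val F x \<and> fp_val F x \<le> 1"
  shows "\<exists>b. fv F (fp_sum F xs) b \<and> 0 \<le> b \<and> b \<le> 2 ^ (prec F + 1) \<and> (\<forall>x\<in>set xs. fp_val F x \<le> b)"
  using foldl_unit_bounds[OF fv_zero, of "sort_key (fp_key F) xs"] assms by (simp add: fp_sum_def)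

text \<open>Integers up to \<open>2 ^ prec F\<close> are floats, so counting is exact that far;
  beyond, only the lower bound \<open>2 ^ prec F\<close> and the saturation bound survive.
  \<open>n\<close> counts the ones already added; the zeros stand for unmarked rows.\<close>

lemma foldl_ones:
  assumes "fv F a a0" "0 \<le> a0" "a0 \<le> 2 ^ (prec F + 1)"
    "min (2 ^ prec F) (real n) \<le> a0" "n \<le> 2 ^ prec F \<Longrightarrow> a0 \<le> real n"
    "\<And>x. x \<in> set xs \<Longrightarrow> fv F x 0 \<or> fv F x 1"
  shows "\<exists>b. fv F (foldl (fp_add F) a xs) b \<and> b \<le> 2 ^ (prec F + 1) \<and>
    (let m = n + length (filter (\<lambda>x. fp_val F x = 1) xs) in
      min (2 ^ prec F) (real m) \<le> b \<and> (m \<le> 2 ^ prec F \<longrightarrow> b \<le> real m))"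
  using assms
proof (induction xs arbitrary: a a0 n)
  case (Cons x xs)
  define r where "r = fp_val F x"
  have x: "fv F x r" "r = 0 \<or> r = 1" using Cons.prems(6)[of x] by (auto simp: fv_def r_def)
  then have r: "0 \<le> r" "r \<le> 1" by auto
  define n' where "n' = n + (if r = 1 then 1 else 0)"
  have n': "real n' = real n + r" using x(2) by (auto simp: n'_def)
  from fp_add_unit[OF Cons.prems(1,2,3) x(1) r] obtain b where b: "fv F (fp_add F a x) b" "a0 \<le> b" "r \<le> b"
    "b \<le> 2 ^ (prec F + 1)" "\<And>y. representable F y \<Longrightarrow> y \<le> a0 + r \<Longrightarrow> y \<le> b"
    "\<And>y. representable F y \<Longrightarrow> a0 + r \<le> y \<Longrightarrow> b \<le> y" by metis
  have rep: "representable F (real i)" if "i \<le> 2 ^ prec F" for i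
  proof -
    have "int i \<le> int (2 ^ prec F)" using that by (rule of_nat_mono)
    then show ?thesis using representable_int[of "int i"] by simp
  qed
  have lo: "min (2 ^ prec F) (real n') \<le> b"
  proof (cases "n' \<le> 2 ^ prec F")
    case True
    then have "n \<le> 2 ^ prec F" by (simp add: n'_def split: if_splits)
    then have "real n \<le> real (2 ^ prec F)" by (rule of_nat_mono)
    then have "real n \<le> 2 ^ prec F" by simp
    then have "real n \<le> a0" using Cons.prems(4) by (simp only: min_absorb2)
    then have "real n' \<le> b" using b(5)[OF rep[OF True]] n' by simp
    then show ?thesis by (simp add: min_le_iff_disj)
  next
    case False
    then have "2 ^ prec F \<le> n" by (simp add: n'_def split: if_splits)
    then have "real (2 ^ prec F) \<le> real n" by (rule of_nat_mono)
    then have "2 ^ prec F \<le> a0" using Cons.prems(4) by (simp add: min_def split: if_splits)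
    then show ?thesis using b(2) by (simp add: min_le_iff_disj)
  qed
  have hi: "b \<le> real n'" if "n' \<le> 2 ^ prec F"
  proof -
    have "n \<le> 2 ^ prec F" using that by (simp add: n'_def split: if_splits)
    then have "a0 + r \<le> real n'" using Cons.prems(5) n' by simp
    then show ?thesis using b(6)[OF rep[OF that]] by simp
  qed
  have b0: "0 \<le> b" using b Cons.prems by linarith
  have "n + length (filter (\<lambda>x. fp_val F x = 1) (x # xs)) = n' + length (filter (\<lambda>x. fp_val F x = 1) xs)"
    using r_def by (auto simp: n'_def)
  then show ?case using Cons.IH[OF b(1) b0 b(4) lo hi] Cons.prems(6) by simp
qed (auto simp: Let_def)

lemma fp_sum_ones:
  assumes "\<And>x. x \<in> set xs \<Longrightarrow> fv F x 0 \<or> fv F x 1"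
    and m: "m = length (filter (\<lambda>x. fp_val F x = 1) xs)"
  shows "\<exists>b. fv F (fp_sum F xs) b \<and> b \<le> 2 ^ (prec F + 1) \<and>
      min (2 ^ prec F) (real m) \<le> b \<and> (m \<le> 2 ^ prec F \<longrightarrow> b \<le> real m)"
proof -
  have "length (filter (\<lambda>x. fp_val F x = 1) (sort_key (fp_key F) xs)) = m"
    unfolding m by (metis mset_filter mset_sort size_mset)
  with foldl_ones[OF fv_zero, of 0 "sort_key (fp_key F) xs"] assms(1) show ?thesis
    by (simp add: fp_sum_def Let_def)
qed

end

text \<open>\<open>cnt\<close> is the number of marked rows, \<open>D\<close> the computed
  denominator, \<open>w\<close> the rounded weight, \<open>m\<close> an integer within 1 / 2 of
  \<open>w * t\<close>, and \<open>p2\<close> stands for \<open>2 ^ prec F\<close>. For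
  \<open>cnt\<close> up to \<open>k + 2\<close> the product \<open>cnt * m\<close> differs from
  \<open>t\<close> by at most \<open>cnt / 2\<close> plus an error of 1 / 8, and
  \<open>2 * t\<close> is \<open>k\<close> or \<open>k + 1\<close>.\<close>

lemma scale_arith:
  fixes k t cnt :: nat and D w p2 :: real and m :: int
  assumes k: "1 \<le> k" and t: "t = (k + 1) div 2" and p2: "8 * (real k + 2) ^ 2 \<le> p2"
    and cnt: "1 \<le> cnt" and D: "min p2 (real cnt) \<le> D" "real cnt \<le> p2 \<Longrightarrow> D \<le> real cnt"
    and w: "\<bar>w - 1 / D\<bar> \<le> 1 / (2 * p2)" "0 \<le> w"
    and m: "\<bar>of_int m - w * real t\<bar> \<le> 1 / 2"
  shows "0 \<le> m" "cnt < k \<Longrightarrow> 1 \<le> m \<and> int cnt * m < int k" "int cnt * m \<le> 2 * int k + 2"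
proof -
  define T where "T = real t"
  have tk: "2 * t = k \<or> 2 * t = k + 1" using t by presburger
  then have Tk: "real k \<le> 2 * T" "2 * T \<le> real k + 1" by (auto simp: T_def)
  have T1: "1 \<le> T" using t k by (simp add: T_def)
  have wT: "0 \<le> w * T" using w(2) T1 by simp
  have "- 1 / 2 \<le> (of_int m :: real)" using m wT unfolding T_def[symmetric] by linarith
  then show m0: "0 \<le> m" by linarith
  have p2': "8 * real k ^ 2 + 32 * real k + 32 \<le> p2" using p2 by (simp add: power2_eq_square algebra_simps)
  have p2pos: "0 < p2" using p2' zero_le_power2[of "real k"] by linarith
  have k2: "0 \<le> real k ^ 2" "real k * real k = real k ^ 2" by (simp_all add: power2_eq_square)
  have big: "real k + 2 \<le> p2" using p2' k2 by linarith
  have err: "real n * T / (2 * p2) \<le> 1 / 8" if "real n \<le> real k + 2" for n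
  proof -
    have "real n * T \<le> (real k + 2) * (real k + 2)"
      using that Tk T1 by (intro mult_mono) auto
    also have "\<dots> \<le> p2 / 8" using p2 by (simp add: power2_eq_square)
    finally show ?thesis using p2pos by (simp add: field_simps)
  qed
  have exact: "\<bar>real cnt * (w * T) - T\<bar> \<le> 1 / 8" if "real cnt \<le> real k + 2"
  proof -
    have le: "real cnt \<le> p2" using that big by linarith
    then have "D = real cnt" using D by simp
    then have "\<bar>real cnt * T * (w - 1 / D)\<bar> \<le> real cnt * T * (1 / (2 * p2))"
    proof -
      have "real cnt * T * \<bar>w - 1 / D\<bar> \<le> real cnt * T * (1 / (2 * p2))"
        using w(1) T1 by (intro mult_left_mono) auto
      then show ?thesis using T1 by (simp add: abs_mult)
    qed
    moreover have "real cnt * T * (w - 1 / D) = real cnt * (w * T) - T"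
      using cnt \<open>D = real cnt\<close> by (simp add: field_simps)
    moreover have "real cnt * T * (1 / (2 * p2)) = real cnt * T / (2 * p2)" by simp
    ultimately show ?thesis using err[OF that] by linarith
  qed
  have cm: "\<bar>real cnt * of_int m - real cnt * (w * T)\<bar> \<le> real cnt / 2"
  proof -
    have "real cnt * \<bar>of_int m - w * T\<bar> \<le> real cnt * (1 / 2)"
      using m unfolding T_def[symmetric] by (intro mult_left_mono) auto
    moreover have "real cnt * \<bar>of_int m - w * T\<bar> = \<bar>real cnt * of_int m - real cnt * (w * T)\<bar>"
      by (simp add: abs_mult flip: right_diff_distrib)
    ultimately show ?thesis by simp
  qed
  show "1 \<le> m \<and> int cnt * m < int k" if "cnt < k"
  proof -
    have c: "real cnt \<le> real k - 1" using that by linarith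
    have ex: "\<bar>real cnt * (w * T) - T\<bar> \<le> 1 / 8" using exact c by linarith
    \<comment> \<open>\<open>t\<close> exceeds \<open>cnt / 2\<close> by at least 1 / 2, which is
      more than the error.\<close>
    have "0 < real cnt * of_int m" using cm ex c Tk by linarith
    then have "0 < m" using cnt by (simp add: zero_less_mult_iff)
    then have m1: "1 \<le> m" by simp
    have up: "real cnt * of_int m \<le> T + real cnt / 2 + 1 / 8" using cm ex by linarith
    \<comment> \<open>For \<open>m = 1\<close> the product is \<open>cnt\<close> itself. A larger
      \<open>m\<close> forces \<open>3 * cnt \<le> k + 1\<close>, which leaves enough room below
      \<open>k\<close>; only \<open>k = 2\<close> with \<open>cnt = 1\<close> has to be excluded
      separately.\<close>
    have "int cnt * m < int k"
    proof (cases "m = 1")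
      case True then show ?thesis using that by simp
    next
      case False
      then have m2: "2 \<le> m" using m1 by simp
      then have "2 * real cnt \<le> real cnt * of_int m" using cnt by simp
      with up Tk have "3 * real cnt \<le> real k + 1 + 1 / 4" by linarith
      then have "3 * cnt \<le> k + 1" by linarith
      then have "cnt \<le> k - 2 \<or> (k = 2 \<and> cnt = 1)" using that cnt by linarith
      then show ?thesis
      proof
        assume "cnt \<le> k - 2"
        then have "real cnt \<le> real k - 2" using \<open>3 * cnt \<le> k + 1\<close> cnt that by linarith
        with up Tk have "real cnt * of_int m < real k" by linarith
        then have "of_int (int cnt * m) < (of_int (int k) :: real)" by simp
        then show ?thesis by (simp only: of_int_less_iff)
      next
        assume a: "k = 2 \<and> cnt = 1"
        then have "T = 1" using t by (simp add: T_def)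
        with up a m2 show ?thesis by simp
      qed
    qed
    with m1 show ?thesis by simp
  qed
  show "int cnt * m \<le> 2 * int k + 2"
  proof (cases "real cnt \<le> real k + 2")
    case True
    then have "real cnt * of_int m \<le> T + real cnt / 2 + 1 / 8" using cm exact by linarith
    then have "real cnt * of_int m \<le> 2 * real k + 2" using Tk True k by linarith
    then have "of_int (int cnt * m) \<le> (of_int (2 * int k + 2) :: real)" by simp
    then show ?thesis by (simp only: of_int_le_iff)
  next
    \<comment> \<open>From \<open>k + 3\<close> marked rows on \<open>w * t\<close> lies below 1 / 2
      and \<open>m\<close> vanishes: \<open>t / (k + 3)\<close> stays away from 1 / 2 by
      \<open>1 / (k + 3)\<close>, more than the rounding error.\<close>
    case False
    then have "k + 3 \<le> cnt" by linarith
    then have "real k + 3 \<le> real cnt" by linarith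
    moreover have "real k + 3 \<le> p2" using p2' k2 by linarith
    ultimately have D3: "real k + 3 \<le> D" using D(1) by linarith
    have "w \<le> 1 / D + 1 / (2 * p2)" using w(1) by linarith
    also have "\<dots> \<le> 1 / (real k + 3) + 1 / (2 * p2)" using D3 by (simp add: frac_le)
    finally have "w * T \<le> (1 / (real k + 3) + 1 / (2 * p2)) * T" using T1 by (simp add: mult_right_mono)
    also have "\<dots> = T / (real k + 3) + T / (2 * p2)" by (simp add: distrib_right)
    finally have "w * T \<le> T / (real k + 3) + T / (2 * p2)" .
    moreover have "T / (real k + 3) \<le> 1 / 2 - 1 / (real k + 3)"
    proof -
      have "T / (real k + 3) \<le> ((real k + 1) / 2) / (real k + 3)" using Tk by (intro divide_right_mono) auto
      also have "\<dots> = 1 / 2 - 1 / (real k + 3)" by (simp add: field_simps)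
      finally show ?thesis .
    qed
    moreover have "T / (2 * p2) < 1 / (real k + 3)"
    proof -
      have "T * (real k + 3) \<le> (real k + 2) * (real k + 3)" using Tk k by (intro mult_right_mono) auto
      also have "\<dots> = real k ^ 2 + 5 * real k + 6" by (simp add: algebra_simps power2_eq_square)
      also have "\<dots> < 2 * p2" using p2' k2(1) by linarith
      finally show ?thesis using p2pos by (simp add: field_simps)
    qed
    ultimately have "w * T < 1 / 2" by linarith
    then have "of_int m < (1 :: real)" using m unfolding T_def[symmetric] by linarith
    then have "m \<le> 0" by simp
    then show ?thesis using m0 by (simp add: k)
  qed
qed

section \<open>The counting head\<close>

context count_format
begin

abbreviation "p \<equiv> prec F"

lemma p2_large: "k \<le> K \<Longrightarrow> 8 * (real k + 2) ^ 2 \<le> 2 ^ p"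
proof -
  assume "k \<le> K"
  then have "8 * (k + 2) ^ 2 \<le> 8 * (K + 2) ^ 2" by (simp add: power_mono)
  then have "8 * (k + 2) ^ 2 \<le> 2 ^ p" using prec_large by linarith
  then have "real (8 * (k + 2) ^ 2) \<le> real (2 ^ p)" by (rule of_nat_mono)
  then show ?thesis by (simp add: add.commute)
qed

lemma mag0: "mag F 0 = 2 powi (- bias F - int p + 1)"
  unfolding mag_def by (rule arg_cong[of _ _ "power_int 2"]) simp

text \<open>The largest power of two in the format; its square overflows. An infinite matrix entry
  could not be used to produce the score minus infinity, because its product with a zero is
  \<open>NaN\<close>.\<close>

definition bigB :: real where "bigB = 2 powi (bias F + 1)"

lemma representable_bigB: "representable F bigB"
  unfolding bigB_def using bias_large by (intro representable_pow) auto

lemma overflow_bigB: "overflow_bound F \<le> bigB * bigB"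
proof -
  have e: "2 ^ ebits F - 1 - bias F - (int p - 1) = bias F + 2 - int p"
    using two_pow_ebits[OF F] by simp
  have "overflow_bound F \<le> 2 ^ p * 2 powi (bias F + 2 - int p)"
    unfolding overflow_bound_def e by (intro mult_right_mono) auto
  also have "\<dots> = 2 powi (bias F + 2)" by (simp add: power_int_diff power_int_of_nat)
  also have "\<dots> \<le> 2 powi (bias F + 1 + (bias F + 1))"
    using bias_large by (intro power_int_increasing) auto
  also have "\<dots> = bigB * bigB" unfolding bigB_def by (subst power_int_add) auto
  finally show ?thesis .
qed

text \<open>The key is \<open>bigB\<close> times the bit at \<open>src\<close> minus the constant
  coordinate, and the query is \<open>bigB\<close>: the score is 0 for a set bit and overflows to
  minus infinity otherwise. With \<open>src = 0\<close> the two entries cancel and every row is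
  marked.\<close>

definition count_head :: "nat \<Rightarrow> nat \<Rightarrow> nat \<Rightarrow> head" where
  "count_head d src t = \<lparr>
     wQ = mat d 1 (\<lambda>(j, l). fl (if j = 0 then bigB else 0)),
     wK = mat d 1 (\<lambda>(j, l). fl ((if j = src then bigB else 0) - (if j = 0 then bigB else 0))),
     wV = mat d 2 (\<lambda>(j, l). fl (if j = 0 then (if l = 0 then real t * mag F 0 else 1) else 0))\<rparr>"

text \<open>The full factor turning \<open>N * mag F 0\<close> into \<open>N\<close> exceeds every
  float. \<open>2 powi bias F\<close> is applied here, and the remaining \<open>2 ^ (p - 1)\<close>
  is left to the weights of \<open>count_gate\<close>.\<close>

definition count_attention :: "nat \<Rightarrow> nat \<Rightarrow> nat \<Rightarrow> nat \<Rightarrow> attention" where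
  "count_attention d src t base = \<lparr>heads = [count_head d src t],
     wO = mat 2 d (\<lambda>(r, l). fl (if r = 0 \<and> l = base then 2 powi bias F
       else if r = 1 \<and> l = base + 1 then 2 ^ (p + 1) else 0))\<rparr>"

text \<open>What a counting head reports about \<open>n\<close> marked rows: \<open>N\<close> vanishes for large \<open>n\<close> because
  the value \<open>t * mag F 0\<close> is so small that its product with the weight \<open>1 / n\<close> underflows.\<close>

definition count_spec :: "nat \<Rightarrow> nat \<Rightarrow> int \<Rightarrow> real \<Rightarrow> bool" where
  "count_spec k n N S \<longleftrightarrow> 0 \<le> N \<and> N \<le> 2 * int k + 2 \<and> representable F S \<and> 0 \<le> S \<and> S \<le> 2 ^ (2 * p + 2) \<and>
     (n = 0 \<longrightarrow> N = 0 \<and> S = 0) \<and> (1 \<le> n \<longrightarrow> 1 \<le> S) \<and>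
     (1 \<le> n \<and> n < k \<longrightarrow> 1 \<le> N \<and> N < int k) \<and> (k \<le> n \<longrightarrow> N = 0 \<or> int k \<le> N)"

definition fin_row :: "nat \<Rightarrow> fp vec \<Rightarrow> bool" where
  "fin_row d x \<longleftrightarrow> dim_vec x = d \<and> (\<forall>j<d. x $ j \<in> fin_floats F)"

lemma vmult_fv:
  assumes "fin_row n x" "dim_row W = n" "l < dim_col W"
    "\<And>j. j < n \<Longrightarrow> fv F (W $$ (j, l)) (\<omega> j)"
    "\<And>J. J \<subseteq> {..<n} \<Longrightarrow> representable F (\<Sum>j\<in>J. fp_val F (x $ j) * \<omega> j)"
  shows "fv F (vmult F x W $ l) (\<Sum>j<n. fp_val F (x $ j) * \<omega> j)"
proof -
  have "fv F (fp_sum F (map (\<lambda>j. fp_mult F (x $ j) (W $$ (j, l))) [0..<n])) (\<Sum>j<n. fp_val F (x $ j) * \<omega> j)"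
    using assms by (intro fp_dot_exact) (auto simp: fin_row_def fv_def)
  then show ?thesis using assms(2,3) by (simp add: vmult_def)
qed

lemma sum_if_eq: "finite J \<Longrightarrow> (\<Sum>j\<in>J. g j * (if j = a then b else 0)) = (if a \<in> J then g a * b else (0::real))"
  by (simp add: if_distrib[of "\<lambda>x. _ * x"] cong: if_cong)

lemma fv_single:
  assumes "fin_row n x" "dim_row W = n" "l < dim_col W" "a < n"
    "\<And>j. j < n \<Longrightarrow> fv F (W $$ (j, l)) (if j = a then b else 0)" "representable F (fp_val F (x $ a) * b)"
  shows "fv F (vmult F x W $ l) (fp_val F (x $ a) * b)"
proof -
  have "fv F (vmult F x W $ l) (\<Sum>j<n. fp_val F (x $ j) * (if j = a then b else 0))"
  proof (rule vmult_fv[OF assms(1,2,3,5)])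
    fix J assume "J \<subseteq> {..<n}"
    then have "finite J" using finite_subset by blast
    then show "representable F (\<Sum>j\<in>J. fp_val F (x $ j) * (if j = a then b else 0))"
      using assms(6) by (simp add: sum_if_eq)
  qed
  then show ?thesis using assms(4) by (simp add: sum_if_eq)
qed

context
  fixes T :: "'a transformer" and d src t k :: nat
  assumes TF: "tfmt T = F" and dk: "dim_key T = 1" and dv: "dim_val T = 2" and src: "src < d"
    and k: "1 \<le> k" "k \<le> K" and t: "t = (k + 1) div 2"
begin

lemma t_le: "t \<le> k" using t k by auto

lemma t_pow: "int t \<le> 2 ^ p"
proof -
  have "real t \<le> real k" using t_le by simp
  also have "\<dots> \<le> 8 * (real k + 2) ^ 2" by (simp add: power2_eq_square algebra_simps)
  finally have "real t \<le> 2 ^ p" using p2_large[OF k(2)] by linarith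
  then have "of_int (int t) \<le> (of_int (2 ^ p) :: real)" by (simp only: of_int_of_nat_eq of_int_power of_int_numeral)
  then show ?thesis by (simp only: of_int_le_iff)
qed

lemma representable_value: "representable F (real t * mag F 0)"
proof -
  have "representable F (of_int (int t) * 2 powi (- bias F - int p + 1))"
    using bias_large t_pow by (intro representable_grid[OF F]) auto
  then show ?thesis by (simp add: mag0)
qed

lemma score_count:
  assumes x: "fin_row d x" "fp_val F (x $ 0) = 1" "fp_val F (x $ src) = of_bool P"
    and y: "fin_row d y" "fp_val F (y $ 0) = 1"
  shows "if P then fv F (score T (count_head d src t) y x) 0 else score T (count_head d src t) y x = Inf True"
proof -
  let ?H = "count_head d src t"
  have d0: "0 < d" using src by simp
  have "fv F (vmult F y (wQ ?H) $ 0) (fp_val F (y $ 0) * bigB)"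
    using y d0 representable_bigB by (intro fv_single) (auto simp: count_head_def intro!: fl_fv)
  then have Q: "fv F (vmult F y (wQ ?H) $ 0) bigB" using y by simp
  let ?\<omega> = "\<lambda>j. (if j = src then bigB else 0) - (if j = 0 then bigB else 0)"
  have sum: "(\<Sum>j\<in>J. fp_val F (x $ j) * ?\<omega> j) =
    (if src \<in> J then of_bool P * bigB else 0) - (if 0 \<in> J then bigB else 0)" if "J \<subseteq> {..<d}" for J
  proof -
    have "finite J" using that finite_subset by blast
    then show ?thesis unfolding right_diff_distrib sum_subtractf using x by (simp add: sum_if_eq)
  qed
  have rep: "representable F (?\<omega> j)" for j
    using representable_bigB by auto
  have "fv F (vmult F x (wK ?H) $ 0) (\<Sum>j<d. fp_val F (x $ j) * ?\<omega> j)"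
  proof (rule vmult_fv[OF x(1)])
    show "representable F (\<Sum>j\<in>J. fp_val F (x $ j) * ?\<omega> j)" if "J \<subseteq> {..<d}" for J
      unfolding sum[OF that] using representable_bigB by auto
    show "fv F (wK ?H $$ (j, 0)) (?\<omega> j)" if "j < d" for j
      using that fl_fv[OF rep[of j]] by (simp add: count_head_def)
  qed (auto simp: count_head_def)
  moreover have "(\<Sum>j<d. fp_val F (x $ j) * ?\<omega> j) = (of_bool P - 1) * bigB"
    using sum[of "{..<d}"] src d0 by (simp add: left_diff_distrib)
  ultimately have Kf: "fv F (vmult F x (wK ?H) $ 0) ((of_bool P - 1) * bigB)" by simp
  define z where "z = fp_mult F (vmult F y (wQ ?H) $ 0) (vmult F x (wK ?H) $ 0)"
  have sc: "score T ?H y x = fp_div F (fp_add F fp_zero z) (fp_round F False 1)"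
    by (simp add: score_def TF dk count_head_def fp_sum_def z_def)
  have one: "fv F (fp_round F False 1) 1" by (rule fp_round_exact[OF F representable_one])
  have ovf1: "\<bar>1\<bar> < overflow_bound F" using no_overflow[OF representable_one, of 1] by simp
  \<comment> \<open>When the score is infinite, the sign of the divisor 1 decides the sign of the
    quotient.\<close>
  have neg1: "\<not> neg (fp_round F False 1)" using fp_round_fin(2)[OF F ovf1] by simp
  show ?thesis
  proof (cases P)
    case True
    then have "fv F z 0" unfolding z_def using fv_mult[OF F Q Kf] by simp
    then have "fv F (fp_add F fp_zero z) 0" using fv_add[OF F fv_zero] by fastforce
    then show ?thesis using fv_div[OF F _ one, of _ 0] True by (simp add: sc)
  next
    case False
    have "0 < bigB" by (simp add: bigB_def)
    then have "z = Inf True"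
      using overflow_bigB False fvD[OF Q] fvD[OF Kf] unfolding z_def
      by (subst fp_mult_fin[OF F]) (auto simp: fp_round_def)
    then have "fp_add F fp_zero z = Inf True" by simp
    moreover obtain e s where "fp_round F False 1 = Fin False e s" "s \<noteq> 0"
    proof -
      from fvD(1)[OF one] obtain b e s where bes: "fp_round F False 1 = Fin b e s" by (auto elim: fin_floatsE)
      then have "s \<noteq> 0" using fvD(2)[OF one] by (cases "s = 0") auto
      then show ?thesis using that[of e s] bes neg1 by simp
    qed
    ultimately show ?thesis using False by (simp add: sc)
  qed
qed

text \<open>If nothing is marked, all scores are \<open>Inf True\<close> and softmax is 0 by
  convention. Otherwise the maximum is a zero of either sign, so marked rows have exponential
  exactly 1 and the others \<open>+0\<close>: \<open>D\<close> is the computed count and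
  \<open>w\<close> its rounded reciprocal.\<close>

lemma sm_weight_count:
  assumes s: "\<And>x. x \<in> set xs \<Longrightarrow> if P x then fv F (s x) 0 else s x = Inf True"
    and n: "n = length (filter P xs)"
  obtains w D where "\<And>x. x \<in> set xs \<Longrightarrow> fv F (sm_weight fexp F (map s xs) (s x)) (if P x then w else 0)"
    "1 \<le> n \<Longrightarrow> min (2 ^ p) (real n) \<le> D" "1 \<le> n \<Longrightarrow> real n \<le> 2 ^ p \<Longrightarrow> D \<le> real n"
    "1 \<le> n \<Longrightarrow> \<bar>w - 1 / D\<bar> \<le> 1 / (2 * 2 ^ p)" "1 \<le> n \<Longrightarrow> 1 / 2 ^ (p + 1) \<le> w" "1 \<le> n \<Longrightarrow> w \<le> 1"
proof (cases "n = 0")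
  case True
  then have "\<not> P x" if "x \<in> set xs" for x using that by (auto simp: n filter_empty_conv)
  then have "set (map s xs) \<subseteq> {Inf True}" using s by fastforce
  then have "sm_weight fexp F (map s xs) y = fp_zero" for y by (simp add: sm_weight_def)
  then show ?thesis using that[of 0 0] True by auto
next
  case False
  then obtain x0 where x0: "x0 \<in> set xs" "P x0" by (auto simp: n filter_empty_conv)
  have sfl: "set (map s xs) \<subseteq> floats F"
    using s fvD(1) by (fastforce simp: floats_def split: if_splits)
  have s0: "fv F (s x0) 0" using s[OF x0(1)] x0(2) by simp
  then have s0ne: "s x0 \<noteq> Inf True" by (auto simp: fv_def fin_floats_def)
  define m where "m = fp_max F (map s xs)"
  have mp: "m \<in> set (map s xs)" "\<And>y. y \<in> set (map s xs) \<Longrightarrow> fp_key F y \<le> fp_key F m"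
    using fp_max_props[OF _ sfl] x0(1) unfolding m_def by (metis empty_iff list.map_disc_iff list.set(1))+
  have "fp_key F (Inf True) < fp_key F m"
    using fp_key_minus_infinity[OF F _ s0ne] mp(2)[of "s x0"] sfl x0 by fastforce
  then have "m \<noteq> Inf True" by auto
  moreover obtain x1 where "x1 \<in> set xs" "m = s x1" using mp(1) by auto
  ultimately have "fv F m 0" using s[of x1] by (simp split: if_splits)
  then obtain b where mb: "m = Fin b 0 0" using fp_val_eq_zero[OF F] by blast
  define e where "e x = fexp F (fp_sub F (s x) m)" for x
  have e1: "e x = fp_one F" if x: "x \<in> set xs" "P x" for x
  proof -
    have "fv F (s x) 0" using s[OF x(1)] x(2) by simp
    moreover have "fv F (fp_uminus m) 0" using fp_uminus_fv[OF \<open>fv F m 0\<close>] by simp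
    ultimately have "fv F (fp_sub F (s x) m) 0" unfolding fp_sub_def
      using fv_add[OF F, of "s x" 0 "fp_uminus m" 0] by simp
    then show ?thesis using fp_val_eq_zero[OF F] by (fastforce simp: e_def)
  qed
  have e0: "e x = fp_zero" if "x \<in> set xs" "\<not> P x" for x
    using s[OF that(1)] that(2) by (simp add: e_def mb fp_sub_def)
  have e_vals: "fv F (e x) (if P x then 1 else 0)" if "x \<in> set xs" for x
    using e1[OF that] e0[OF that] fv_one fv_zero by auto
  have cnt: "n = length (filter (\<lambda>x. fp_val F x = 1) (map e xs))"
    unfolding n filter_map length_map comp_def
    by (intro arg_cong[of _ _ length] filter_cong refl) (use e_vals in \<open>auto simp: fv_def\<close>)
  obtain D where D: "fv F (fp_sum F (map e xs)) D" "D \<le> 2 ^ (p + 1)"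
    "min (2 ^ p) (real n) \<le> D" "n \<le> 2 ^ p \<longrightarrow> D \<le> real n"
    using fp_sum_ones[OF _ cnt] e_vals by (force split: if_splits)
  have D1: "1 \<le> D"
  proof -
    have "(1::real) \<le> 2 ^ p" by simp
    then have "1 \<le> min (2 ^ p) (real n)" using False by simp
    then show ?thesis using D(3) by linarith
  qed
  have ns: "\<not> set (map s xs) \<subseteq> {Inf True}" using x0 s0ne by auto
  have sm: "sm_weight fexp F (map s xs) (s x) = fp_div F (e x) (fp_sum F (map e xs))" for x
    using ns by (simp add: sm_weight_def m_def[symmetric] e_def[abs_def] comp_def)
  define w where "w = fp_val F (fp_round F False (1 / D))"
  have D01: "0 < 1 / D" "1 / D \<le> 1" using D1 by auto
  then have ovf: "\<bar>1 / D\<bar> < overflow_bound F" using no_overflow[OF representable_one, of "1 / D"] by simp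
  have wfv: "fv F (fp_div F (fp_one F) (fp_sum F (map e xs))) w"
  proof -
    have "fp_div F (fp_one F) (fp_sum F (map e xs)) = fp_round F (neg (fp_one F) \<noteq> neg (fp_sum F (map e xs))) (1 / D)"
      using fp_div_fin[OF F fvD(1)[OF fv_one] fvD(1)[OF D(1)]] D1 fvD(2)[OF fv_one] fvD(2)[OF D(1)] by simp
    also have "\<dots> = fp_round F False (1 / D)" using D01 by (intro fp_round_sign) simp
    finally show ?thesis using fp_round_fin(1)[OF F ovf] by (simp add: fv_def w_def)
  qed
  have w0: "fv F (fp_div F fp_zero (fp_sum F (map e xs))) 0"
    using fv_div[OF F fv_zero D(1)] D1 by simp
  have 1: "fv F (sm_weight fexp F (map s xs) (s x)) (if P x then w else 0)" if "x \<in> set xs" for x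
    using wfv w0 e1[OF that] e0[OF that] by (simp add: sm)
  have 2: "\<bar>w - 1 / D\<bar> \<le> 1 / (2 * 2 ^ p)"
  proof -
    \<comment> \<open>\<open>i / 2 ^ p\<close> is a float within \<open>1 / 2 ^ (p + 1)\<close> of
      \<open>1 / D\<close>, so the rounded reciprocal is no farther away.\<close>
    define i where "i = round (2 ^ p / D)"
    have i: "\<bar>of_int i - 2 ^ p / D\<bar> \<le> 1 / 2" unfolding i_def by (rule of_int_round_abs_le)
    have "2 ^ p / D \<le> 2 ^ p" using D1 by (simp add: field_simps)
    then have "round (2 ^ p / D) \<le> round ((2::real) ^ p)" by (rule round_mono)
    then have "i \<le> 2 ^ p" unfolding i_def by (metis of_int_numeral of_int_power round_of_int)
    moreover have "- 1 / 2 \<le> (of_int i :: real)"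
    proof -
      have "0 \<le> 2 ^ p / D" using D1 by simp
      then show ?thesis using i by linarith
    qed
    then have "0 \<le> i" by linarith
    ultimately have "representable F (of_int i * 2 powi (- int p))"
      using bias_large by (intro representable_grid[OF F]) auto
    then have "representable F (of_int i / 2 ^ p)" by (simp add: power_int_minus field_simps)
    from fp_round_fin(3)[OF F ovf this] have "\<bar>w - 1 / D\<bar> \<le> \<bar>of_int i / 2 ^ p - 1 / D\<bar>" by (simp add: w_def)
    also have "of_int i / 2 ^ p - 1 / D = (of_int i - 2 ^ p / D) / 2 ^ p" by (simp add: field_simps)
    also have "\<bar>\<dots>\<bar> = \<bar>of_int i - 2 ^ p / D\<bar> / 2 ^ p" by simp
    also have "\<dots> \<le> (1 / 2) / 2 ^ p" using i by (intro divide_right_mono) auto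
    finally show ?thesis by simp
  qed
  \<comment> \<open>\<open>D\<close> saturates at \<open>2 ^ (p + 1)\<close>, so no weight falls
    below the reciprocal of that number.\<close>
  have 3: "1 / 2 ^ (p + 1) \<le> w"
  proof -
    have "representable F (2 powi (- int (p + 1)))" using bias_large by (intro representable_pow) auto
    then have "representable F (1 / 2 ^ (p + 1))" by (simp only: power_int_minus power_int_of_nat inverse_eq_divide)
    moreover have "1 / 2 ^ (p + 1) \<le> 1 / D" using D(2) D1 by (intro divide_left_mono) auto
    ultimately show ?thesis unfolding w_def using fp_round_ge[OF F _ _ ovf] by blast
  qed
  have 4: "w \<le> 1" unfolding w_def using fp_round_le[OF F representable_one D01(2) ovf] .
  have 5: "D \<le> real n" if "real n \<le> 2 ^ p"
  proof -
    have "real n \<le> real (2 ^ p)" using that by simp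
    then have "n \<le> 2 ^ p" by (simp only: of_nat_le_iff)
    then show ?thesis using D(4) by simp
  qed
  show ?thesis using that[of w D] 1 2 3 4 5 D(3) by blast
qed

text \<open>\<open>N\<close> comes from the first value column: all marked rows contribute the same
  small multiple \<open>m\<close> of \<open>mag F 0\<close>, and their sum is exact because
  \<open>N\<close> stays below \<open>2 ^ p\<close>. \<open>S\<close> comes from the second column,
  the sum of the weights; only whether it vanishes will matter.\<close>

lemma attention_count:
  assumes xs: "\<And>x. x \<in> set xs \<Longrightarrow> fin_row d x \<and> fp_val F (x $ 0) = 1 \<and> fp_val F (x $ src) = of_bool (P x)"
    and y: "fin_row d y" "fp_val F (y $ 0) = 1"
  shows "\<exists>N S. count_spec k (length (filter P xs)) N S \<and>
    (\<forall>l<d. fv F (attn_row fexp T (count_attention d src t base) xs y $ l)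
       (if l = base then of_int N * 2 powi (1 - int p) else if l = base + 1 then S else 0))"
proof -
  let ?H = "count_head d src t"
  have d0: "0 < d" using src by simp
  define n where "n = length (filter P xs)"
  define s where "s = score T ?H y"
  have sc: "if P x then fv F (s x) 0 else s x = Inf True" if "x \<in> set xs" for x
    unfolding s_def using xs[OF that] y by (intro score_count) auto
  obtain w D where w: "\<And>x. x \<in> set xs \<Longrightarrow> fv F (sm_weight fexp F (map s xs) (s x)) (if P x then w else 0)"
    "1 \<le> n \<Longrightarrow> min (2 ^ p) (real n) \<le> D" "1 \<le> n \<Longrightarrow> real n \<le> 2 ^ p \<Longrightarrow> D \<le> real n"
    "1 \<le> n \<Longrightarrow> \<bar>w - 1 / D\<bar> \<le> 1 / (2 * 2 ^ p)" "1 \<le> n \<Longrightarrow> 1 / 2 ^ (p + 1) \<le> w" "1 \<le> n \<Longrightarrow> w \<le> 1"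
    using sm_weight_count[OF sc n_def] by metis
  have V: "fv F (vmult F x (wV ?H) $ l) (if l = 0 then real t * mag F 0 else 1)" if "x \<in> set xs" "l < 2" for x l
  proof -
    have "fv F (vmult F x (wV ?H) $ l) (fp_val F (x $ 0) * (if l = 0 then real t * mag F 0 else 1))"
      using xs[OF that(1)] that(2) d0 representable_value
      by (intro fv_single) (auto simp: count_head_def intro!: fl_fv)
    then show ?thesis using xs[OF that(1)] by simp
  qed
  define r where "r = w * (real t * mag F 0)"
  define prod where "prod l x = fp_mult F (sm_weight fexp F (map s xs) (s x)) (vmult F x (wV ?H) $ l)" for l x
  have col0: "head_row fexp T ?H xs y $ l = fp_sum F (map (prod l) xs)" if "l < 2" for l
    using that by (simp add: head_row_def TF s_def prod_def[abs_def] count_head_def)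
  have t1: "1 \<le> t" using t k by simp
  have mu: "0 < mag F 0" by simp
  have nP: "\<not> P x" if "n = 0" "x \<in> set xs" for x
    using that by (auto simp: n_def filter_empty_conv)
  obtain m :: int where m: "\<And>x. x \<in> set xs \<Longrightarrow> fv F (prod 0 x) (if P x then of_int m * mag F 0 else 0)"
    "1 \<le> n \<Longrightarrow> \<bar>of_int m - w * real t\<bar> \<le> 1 / 2" "n = 0 \<Longrightarrow> m = 0"
  proof (cases "n = 0")
    case True
    have "fv F (prod 0 x) 0" if "x \<in> set xs" for x
      using fv_mult[OF F w(1)[OF that] V[OF that, of 0]] nP[OF True that] by (simp add: prod_def)
    then show ?thesis using that[of 0] nP[OF True] True by simp
  next
    case False
    then have n1: "1 \<le> n" by simp
    have w01: "0 < w" "w \<le> 1" using w(5,6)[OF n1] by (auto intro: less_le_trans[rotated])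
    have wt: "0 \<le> w * real t" "w * real t \<le> real t" using w01 by (auto simp: mult_left_le_one_le)
    have "r \<le> 1 * (real t * mag F 0)"
      unfolding r_def using w01 mu by (intro mult_right_mono) (auto simp: less_imp_le)
    moreover have "0 \<le> r" unfolding r_def using w01 mu by (simp add: less_imp_le)
    ultimately have "\<bar>r\<bar> \<le> real t * mag F 0" by simp
    then have ovf: "\<bar>r\<bar> < overflow_bound F" by (rule no_overflow[OF representable_value])
    have fin: "fp_round F False r \<in> fin_floats F" by (rule fp_round_fin(1)[OF F ovf])
    from fp_val_multiple_mag0[OF F fin] obtain m :: int where m: "fp_val F (fp_round F False r) = of_int m * mag F 0" by blast
    \<comment> \<open>All floats are multiples of \<open>mag F 0\<close>, and all small multiples
      are floats: rounding \<open>r\<close> amounts to rounding \<open>w * t\<close> to an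
      integer.\<close>
    define i where "i = round (w * real t)"
    have i: "\<bar>of_int i - w * real t\<bar> \<le> 1 / 2" unfolding i_def by (rule of_int_round_abs_le)
    have "i \<le> int t" using i wt by linarith
    then have "i \<le> 2 ^ p" using t_pow by linarith
    moreover have "0 \<le> i" using i wt by linarith
    ultimately have "representable F (of_int i * 2 powi (- bias F - int p + 1))"
      using bias_large by (intro representable_grid[OF F]) auto
    then have "representable F (of_int i * mag F 0)" by (simp add: mag0)
    from fp_round_fin(3)[OF F ovf this] have "\<bar>of_int m * mag F 0 - r\<bar> \<le> \<bar>of_int i * mag F 0 - r\<bar>" by (simp add: m[symmetric])
    moreover have "of_int j * mag F 0 - r = (of_int j - w * real t) * mag F 0" for j :: int
      by (simp add: r_def algebra_simps)
    ultimately have near: "\<bar>of_int m - w * real t\<bar> \<le> 1 / 2"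
      using mu i by (simp add: abs_mult)
    have "mag F 0 \<noteq> 0" using mag_pos[of F 0] by linarith
    then have "r \<noteq> 0" using w01 t1 by (simp add: r_def)
    have "fv F (prod 0 x) (if P x then of_int m * mag F 0 else 0)" if x: "x \<in> set xs" for x
    proof (cases "P x")
      case True
      have "prod 0 x = fp_round F (neg (sm_weight fexp F (map s xs) (s x)) \<noteq> neg (vmult F x (wV ?H) $ 0)) r"
        unfolding prod_def using fp_mult_fin[OF F fvD(1)[OF w(1)[OF x]] fvD(1)[OF V[OF x, of 0]]]
          fvD(2)[OF w(1)[OF x]] fvD(2)[OF V[OF x, of 0]] True by (simp add: r_def)
      also have "\<dots> = fp_round F False r" using \<open>r \<noteq> 0\<close> by (rule fp_round_sign)
      finally show ?thesis using True fin m by (simp add: fv_def)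
    next
      case False
      then show ?thesis using fv_mult[OF F w(1)[OF x] V[OF x, of 0]] by (simp add: prod_def)
    qed
    then show ?thesis using that[of m] near False by blast
  qed
  define N where "N = int n * m"
  have arith: "0 \<le> m" "n < k \<Longrightarrow> 1 \<le> m \<and> int n * m < int k" "int n * m \<le> 2 * int k + 2" if n1: "1 \<le> n"
  proof -
    have w0: "0 \<le> w" using w(5)[OF n1] by (rule order_trans[rotated]) simp
    note a = scale_arith[OF k(1) t p2_large[OF k(2)] n1 w(2)[OF n1] w(3)[OF n1] w(4)[OF n1] w0 m(2)[OF n1]]
    show "0 \<le> m" "n < k \<Longrightarrow> 1 \<le> m \<and> int n * m < int k" "int n * m \<le> 2 * int k + 2" using a by blast+
  qed
  have m0: "0 \<le> m" using arith(1) m(3) by (cases "n = 0") auto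
  have Nle: "N \<le> 2 * int k + 2" using arith(3) unfolding N_def by (cases "n = 0") auto
  have k_pow: "2 * int k + 2 \<le> 2 ^ p"
  proof -
    have "2 * real k + 2 \<le> 8 * (real k + 2) ^ 2" by (simp add: power2_eq_square algebra_simps)
    then have "of_int (2 * int k + 2) \<le> (of_int (2 ^ p) :: real)" using p2_large[OF k(2)] by simp
    then show ?thesis by (simp only: of_int_le_iff)
  qed
  \<comment> \<open>Rows may repeat in \<open>xs\<close>, whereas exact summation is indexed by
    distinct elements, hence the passage to positions.\<close>
  have idx: "map g xs = map (\<lambda>j. g (xs ! j)) [0..<length xs]" for g :: "fp vec \<Rightarrow> fp"
    by (intro nth_equalityI) auto
  have cardP: "n = card {j \<in> {0..<length xs}. P (xs ! j)}"
    unfolding n_def length_filter_conv_card by (intro arg_cong[of _ _ card]) auto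
  have sumP: "(\<Sum>j\<in>J. if P (xs ! j) then a else 0) = real (card {j \<in> J. P (xs ! j)}) * a" if "finite J" for J and a :: real
    using that by (simp add: sum.If_cases Int_def)
  have col_0: "fv F (head_row fexp T ?H xs y $ 0) (of_int N * mag F 0)"
  proof -
    have "fv F (fp_sum F (map (\<lambda>j. prod 0 (xs ! j)) [0..<length xs]))
      (\<Sum>j\<in>set [0..<length xs]. if P (xs ! j) then of_int m * mag F 0 else 0)"
    proof (rule fp_sum_exact)
      fix J assume J: "J \<subseteq> set [0..<length xs]"
      then have finJ: "finite J" using finite_subset by blast
      have "card {j \<in> J. P (xs ! j)} \<le> n" unfolding cardP using J by (intro card_mono) auto
      then have "int (card {j \<in> J. P (xs ! j)}) * m \<le> N" unfolding N_def using m0 by (intro mult_right_mono) auto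
      then have "\<bar>int (card {j \<in> J. P (xs ! j)}) * m\<bar> \<le> 2 ^ p" using m0 Nle k_pow by simp
      then have "representable F (of_int (int (card {j \<in> J. P (xs ! j)}) * m) * 2 powi (- bias F - int p + 1))"
        using bias_large by (intro representable_grid[OF F]) auto
      then show "representable F (\<Sum>j\<in>J. if P (xs ! j) then of_int m * mag F 0 else 0)"
        unfolding sumP[OF finJ] by (simp add: mag0 mult.assoc)
    qed (use m(1) in auto)
    moreover have "(\<Sum>j\<in>set [0..<length xs]. if P (xs ! j) then of_int m * mag F 0 else 0) =
      real (card {j \<in> {0..<length xs}. P (xs ! j)}) * (of_int m * mag F 0)"
      unfolding set_upt by (rule sumP) simp
    ultimately show ?thesis
      unfolding cardP[symmetric] idx[of "prod 0", symmetric] by (simp add: col0 N_def mult.assoc)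
  qed
  have prod1: "fv F (prod 1 x) (if P x then w else 0)" if "x \<in> set xs" for x
    using fv_mult[OF F w(1)[OF that] V[OF that, of 1]] representableI[OF w(1)[OF that]] by (simp add: prod_def)
  have unit: "z \<in> fin_floats F \<and> 0 \<le> fp_val F z \<and> fp_val F z \<le> 1" if z: "z \<in> set (map (prod 1) xs)" for z
  proof -
    from z obtain x where x: "x \<in> set xs" "z = prod 1 x" by auto
    show ?thesis
    proof (cases "P x")
      case True
      then have "1 \<le> n" using x nP by (cases "n = 0") auto
      then have "0 \<le> w" "w \<le> 1" using w(5,6) by (auto intro: order_trans[rotated])
      then show ?thesis using prod1[OF x(1)] True x(2) by (simp add: fv_def)
    next
      case False
      then show ?thesis using prod1[OF x(1)] x(2) by (simp add: fv_def)
    qed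
  qed
  obtain S0 where S0: "fv F (head_row fexp T ?H xs y $ 1) S0" "0 \<le> S0" "S0 \<le> 2 ^ (p + 1)"
    "\<And>z. z \<in> set (map (prod 1) xs) \<Longrightarrow> fp_val F z \<le> S0"
  proof -
    have c1: "head_row fexp T ?H xs y $ 1 = fp_sum F (map (prod 1) xs)" by (rule col0) simp
    have "\<exists>b. fv F (fp_sum F (map (prod 1) xs)) b \<and> 0 \<le> b \<and> b \<le> 2 ^ (p + 1) \<and>
      (\<forall>z\<in>set (map (prod 1) xs). fp_val F z \<le> b)"
      by (rule fp_sum_unit_bounds) (rule unit)
    then obtain b where b: "fv F (fp_sum F (map (prod 1) xs)) b \<and> 0 \<le> b \<and> b \<le> 2 ^ (p + 1) \<and>
      (\<forall>z\<in>set (map (prod 1) xs). fp_val F z \<le> b)" by (rule exE)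
    show ?thesis by (rule that[of b]) (use b in \<open>simp_all only: c1\<close>)
  qed
  have S0_0: "S0 = 0" if "n = 0"
  proof -
    have "fv F (fp_sum F (map (\<lambda>j. prod 1 (xs ! j)) [0..<length xs])) (\<Sum>j\<in>set [0..<length xs]. 0)"
      using prod1 nP[OF that] by (intro fp_sum_exact) auto
    then have "fv F (fp_sum F (map (prod 1) xs)) 0" unfolding idx[of "prod 1", symmetric] by simp
    then show ?thesis using fv_unique[OF S0(1)] by (simp add: col0)
  qed
  have S0_1: "1 / 2 ^ (p + 1) \<le> S0" if n1: "1 \<le> n"
  proof -
    obtain x where x: "x \<in> set xs" "P x" using n1 by (auto simp: n_def filter_empty_conv Suc_le_eq)
    then have "w \<le> S0" using S0(4)[of "prod 1 x"] prod1[OF x(1)] by (simp add: fv_def)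
    then show ?thesis using w(5)[OF n1] by linarith
  qed
  \<comment> \<open>The factor lifts the lower bound \<open>1 / 2 ^ (p + 1)\<close> for a nonempty
    count to 1, so that \<open>S\<close> is 0 or at least 1.\<close>
  define S where "S = 2 ^ (p + 1) * S0"
  have S_le: "S \<le> 2 ^ (2 * p + 2)"
  proof -
    have "S \<le> 2 ^ (p + 1) * 2 ^ (p + 1)" unfolding S_def using S0(3) by (intro mult_left_mono) auto
    also have "\<dots> = 2 ^ ((p + 1) + (p + 1))" by (simp only: power_add)
    also have "(p + 1) + (p + 1) = 2 * p + 2" by simp
    finally show ?thesis .
  qed
  have repS: "representable F S"
  proof -
    have "(2::real) ^ (2 * p + 2) = 2 powi int (2 * p + 2)" by (simp only: power_int_of_nat)
    also have "\<dots> \<le> 2 powi (bias F + 1)" using bias_large by (intro power_int_increasing) auto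
    finally have "S \<le> 2 powi (bias F + 1)" using S_le by linarith
    moreover have "2 ^ (p + 1) * \<bar>S0\<bar> = S" using S0(2) by (simp add: S_def)
    ultimately have "2 ^ (p + 1) * \<bar>S0\<bar> \<le> 2 powi (bias F + 1)" by simp
    then show ?thesis unfolding S_def by (intro representable_mult_pow representableI[OF S0(1)])
  qed
  have S_1: "1 \<le> S" if "1 \<le> n"
  proof -
    have "2 ^ (p + 1) * (1 / 2 ^ (p + 1)) \<le> S" unfolding S_def using S0_1[OF that] by (intro mult_left_mono) auto
    then show ?thesis by simp
  qed
  have spec: "count_spec k n N S"
    unfolding count_spec_def
  proof (intro conjI impI)
    show "0 \<le> N" using m0 by (simp add: N_def)
    show "0 \<le> S" using S0(2) by (simp add: S_def)
    show "N = 0" "S = 0" if "n = 0" using that S0_0 by (auto simp: N_def S_def)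
    show "1 \<le> N" "N < int k" if "1 \<le> n \<and> n < k"
    proof -
      have "1 \<le> m" "int n * m < int k" using arith(2) that by auto
      then show "N < int k" by (simp add: N_def)
      have "1 * 1 \<le> int n * m" using that \<open>1 \<le> m\<close> by (intro mult_mono) auto
      then show "1 \<le> N" by (simp add: N_def)
    qed
    show "N = 0 \<or> int k \<le> N" if "k \<le> n"
    proof (cases "m = 0")
      case False
      then have "int n * 1 \<le> int n * m" using m0 by (intro mult_left_mono) auto
      then show ?thesis using that by (simp add: N_def)
    qed (simp add: N_def)
  qed (use Nle repS S_le S_1 in auto)
  define z where "z = vec 2 (\<lambda>j. head_row fexp T ?H xs y $ j)"
  have z: "fin_row 2 z" "fp_val F (z $ 0) = of_int N * mag F 0" "fp_val F (z $ 1) = S0"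
    using col_0 S0(1) by (auto simp: z_def fin_row_def fv_def less_2_cases_iff)
  have attn: "attn_row fexp T (count_attention d src t base) xs y = vmult F z (wO (count_attention d src t base))"
  proof -
    have "vec (1 * 2) (\<lambda>j. head_row fexp T ([?H] ! (j div 2)) xs y $ (j mod 2)) = z"
      by (intro eq_vecI) (auto simp: z_def)
    then show ?thesis by (simp add: attn_row_def TF dv count_attention_def)
  qed
  let ?W = "wO (count_attention d src t base)"
  have rep_bias: "representable F (2 powi bias F)" using bias_large by (intro representable_pow) auto
  have rep_C: "representable F (2 ^ (p + 1))" using bias_large by (intro representable_nat_pow) simp
  have NN: "of_int N * mag F 0 * 2 powi bias F = of_int N * 2 powi (1 - int p)"
  proof -
    have "mag F 0 * 2 powi bias F = 2 powi ((- bias F - int p + 1) + bias F)"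
      unfolding mag0 by (subst power_int_add) auto
    then show ?thesis by (simp add: mult.assoc)
  qed
  have repN: "representable F (of_int N * 2 powi (1 - int p))"
    using bias_large Nle k_pow m0 by (intro representable_grid[OF F]) (auto simp: N_def)
  have "fv F (vmult F z ?W $ l) (if l = base then of_int N * 2 powi (1 - int p) else if l = base + 1 then S else 0)"
    if l: "l < d" for l
  proof -
    have dims: "dim_row ?W = 2" "l < dim_col ?W" using l by (auto simp: count_attention_def)
    have W: "?W $$ (j, l) = fl (if j = 0 \<and> l = base then 2 powi bias F
       else if j = 1 \<and> l = base + 1 then 2 ^ (p + 1) else 0)" if "j < 2" for j
      using that l by (simp add: count_attention_def)
    consider "l = base" | "l = base + 1" | "l \<noteq> base" "l \<noteq> base + 1" by blast
    then show ?thesis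
    proof cases
      case 1
      have "fv F (?W $$ (j, l)) (if j = 0 then 2 powi bias F else 0)" if "j < 2" for j
        using 1 rep_bias W[OF that] by (auto intro!: fl_fv)
      from fv_single[OF z(1) dims _ this] repN show ?thesis using 1 by (simp add: z NN)
    next
      case 2
      have "fv F (?W $$ (j, l)) (if j = 1 then 2 ^ (p + 1) else 0)" if "j < 2" for j
        using 2 rep_C W[OF that] that by (auto intro!: fl_fv simp: less_2_cases_iff)
      from fv_single[OF z(1) dims _ this] repS show ?thesis using 2 z(3) by (simp add: S_def mult.commute)
    next
      case 3
      have "fv F (?W $$ (j, l)) (if j = 0 then 0 else 0)" if "j < 2" for j
        using 3 W[OF that] by (auto intro!: fl_fv)
      from fv_single[OF z(1) dims _ this] show ?thesis using 3 by simp
    qed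
  qed
  then show ?thesis using spec unfolding attn n_def by blast
qed

end

end

section \<open>From formulas to transformers\<close>

text \<open>A hidden unit with two inputs whose activation is added, weighted, to one output coordinate.\<close>

record gate =
  src1 :: nat
  wt1 :: real
  src2 :: nat
  wt2 :: real
  off :: real
  outw :: real

section \<open>Exact evaluation of gates in the MLP\<close>

context count_format
begin

text \<open>The entries of \<open>w1\<close> are sums, so that a gate may use the same coordinate as
  both of its inputs.\<close>

definition gate_mlp :: "nat \<Rightarrow> nat \<Rightarrow> (nat \<Rightarrow> gate) \<Rightarrow> mlp" where
  "gate_mlp d out g = \<lparr>
     w1 = mat d 4 (\<lambda>(c, h). fl ((if c = src1 (g h) then wt1 (g h) else 0) + (if c = src2 (g h) then wt2 (g h) else 0))),
     b1 = vec 4 (\<lambda>h. fl (off (g h))),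
     w2 = mat 4 d (\<lambda>(h, l). fl (if l = out then outw (g h) else 0)),
     b2 = vec d (\<lambda>l. fl 0)\<rparr>"

definition gate_in :: "fp vec \<Rightarrow> gate \<Rightarrow> real" where
  "gate_in x g = fp_val F (x $ src1 g) * wt1 g + fp_val F (x $ src2 g) * wt2 g"

definition gate_out :: "fp vec \<Rightarrow> gate \<Rightarrow> real" where
  "gate_out x g = max 0 (gate_in x g + off g) * outw g"

text \<open>These conditions make the MLP exact. A pre-activation may be inexact if it is not
  positive, since ReLU then erases the error; the outputs are integers small enough for any sum of
  four to be representable.\<close>

definition gate_ok :: "nat \<Rightarrow> fp vec \<Rightarrow> gate \<Rightarrow> bool" where
  "gate_ok d x g \<longleftrightarrow> src1 g < d \<and> src2 g < d \<and>
     representable F (wt1 g) \<and> representable F (wt2 g) \<and> representable F (wt1 g + wt2 g) \<and>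
     representable F (off g) \<and> representable F (outw g) \<and>
     representable F (fp_val F (x $ src1 g) * wt1 g) \<and> representable F (fp_val F (x $ src2 g) * wt2 g) \<and>
     representable F (gate_in x g) \<and>
     (representable F (gate_in x g + off g) \<or>
       gate_in x g + off g \<le> 0 \<and> \<bar>gate_in x g + off g\<bar> < overflow_bound F) \<and>
     (\<exists>i. gate_out x g = of_int i \<and> \<bar>i\<bar> \<le> 2 * int K + 3)"

lemma four_K: "4 * (2 * int K + 3) \<le> 2 ^ p"
proof -
  have "4 * (2 * K + 3) \<le> 8 * (K + 2) ^ 2" by (simp add: power2_eq_square algebra_simps)
  then have "int (4 * (2 * K + 3)) \<le> int (2 ^ p)" using prec_large by (intro of_nat_mono) linarith
  then show ?thesis by simp
qed

lemma representable_gate_outs: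
  assumes "\<And>h. h < 4 \<Longrightarrow> gate_ok d x (g h)" "J \<subseteq> {..<4::nat}"
  shows "representable F (\<Sum>h\<in>J. gate_out x (g h))"
proof -
  have "\<forall>h<4. \<exists>i. gate_out x (g h) = of_int i \<and> \<bar>i\<bar> \<le> 2 * int K + 3"
    using assms(1) unfolding gate_ok_def by blast
  then obtain i where i: "\<And>h. h < 4 \<Longrightarrow> gate_out x (g h) = of_int (i h) \<and> \<bar>i h\<bar> \<le> 2 * int K + 3" by metis
  have "(\<Sum>h\<in>J. gate_out x (g h)) = of_int (\<Sum>h\<in>J. i h)" using i assms(2) by (auto intro!: sum.cong)
  moreover have "\<bar>\<Sum>h\<in>J. i h\<bar> \<le> 2 ^ p"
  proof -
    have "\<bar>\<Sum>h\<in>J. i h\<bar> \<le> (\<Sum>h\<in>J. \<bar>i h\<bar>)" by (rule sum_abs)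
    also have "\<dots> \<le> of_nat (card J) * (2 * int K + 3)" using i assms(2) by (intro sum_bounded_above) auto
    also have "\<dots> \<le> 4 * (2 * int K + 3)"
      using card_mono[OF _ assms(2)] by (intro mult_right_mono) auto
    finally show ?thesis using four_K by linarith
  qed
  ultimately show ?thesis using representable_int by metis
qed

lemma mlp_gate:
  assumes x: "fin_row d x" and ok: "\<And>h. h < 4 \<Longrightarrow> gate_ok d x (g h)" and l: "l < d"
  shows "fv F (mlp_row F (gate_mlp d out g) x $ l) (if l = out then \<Sum>h<4. gate_out x (g h) else 0)"
proof -
  let ?M = "gate_mlp d out g"
  let ?\<omega> = "\<lambda>h c. (if c = src1 (g h) then wt1 (g h) else 0) + (if c = src2 (g h) then wt2 (g h) else 0)"
  have sum: "(\<Sum>c\<in>J. fp_val F (x $ c) * ?\<omega> h c) =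
     (if src1 (g h) \<in> J then fp_val F (x $ src1 (g h)) * wt1 (g h) else 0) +
     (if src2 (g h) \<in> J then fp_val F (x $ src2 (g h)) * wt2 (g h) else 0)" if "J \<subseteq> {..<d}" for J h
  proof -
    have "finite J" using that finite_subset by blast
    then show ?thesis unfolding distrib_left sum.distrib by (simp add: sum_if_eq)
  qed
  have pre: "fv F (vmult F x (w1 ?M) $ h) (gate_in x (g h))" if h: "h < 4" for h
  proof -
    note okh = ok[OF h, unfolded gate_ok_def]
    have "fv F (vmult F x (w1 ?M) $ h) (\<Sum>c<d. fp_val F (x $ c) * ?\<omega> h c)"
    proof (rule vmult_fv[OF x])
      show "fv F (w1 ?M $$ (c, h)) (?\<omega> h c)" if "c < d" for c
        using that h okh by (auto simp: gate_mlp_def intro!: fl_fv)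
      show "representable F (\<Sum>c\<in>J. fp_val F (x $ c) * ?\<omega> h c)" if "J \<subseteq> {..<d}" for J
        unfolding sum[OF that] using okh by (auto simp: gate_in_def)
    qed (use h in \<open>auto simp: gate_mlp_def\<close>)
    then show ?thesis using sum[of "{..<d}" h] okh by (simp add: gate_in_def)
  qed
  define z where "z = map_vec fp_relu (vadd F (vmult F x (w1 ?M)) (b1 ?M))"
  have dz: "dim_vec z = 4" by (simp add: z_def gate_mlp_def)
  have zfv: "fv F (z $ h) (max 0 (gate_in x (g h) + off (g h)))" if h: "h < 4" for h
  proof -
    note okh = ok[OF h, unfolded gate_ok_def]
    have b: "fv F (fl (off (g h))) (off (g h))" using okh by (intro fl_fv) auto
    have z: "z $ h = fp_relu (fp_add F (vmult F x (w1 ?M) $ h) (fl (off (g h))))"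
      using h by (simp add: z_def vadd_def gate_mlp_def)
    show ?thesis
    proof (cases "representable F (gate_in x (g h) + off (g h))")
      case True
      then show ?thesis unfolding z by (intro fp_relu_fv[OF F] fv_add[OF F] pre[OF h] b)
    next
      \<comment> \<open>Rounding does not cross the float 0, so the rounded pre-activation is still
        not positive and ReLU yields value 0.\<close>
      case False
      let ?r = "gate_in x (g h) + off (g h)"
      have r: "?r \<le> 0" "\<bar>?r\<bar> < overflow_bound F" using False okh by auto
      define y where "y = fp_add F (vmult F x (w1 ?M) $ h) (fl (off (g h)))"
      have y: "y = fp_round F (neg (vmult F x (w1 ?M) $ h) \<and> neg (fl (off (g h)))) ?r"
        unfolding y_def using fp_add_fin[OF F fvD(1)[OF pre[OF h]] fvD(1)[OF b]] fvD(2)[OF pre[OF h]] fvD(2)[OF b] by simp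
      have "fv F y (fp_val F y)" unfolding y using fp_round_fin(1)[OF F r(2)] by (rule fv_self)
      moreover have "fp_val F y \<le> 0" unfolding y by (rule fp_round_le[OF F representable_zero r])
      ultimately show ?thesis unfolding z y_def[symmetric]
        using fp_relu_fv[OF F, of y "fp_val F y"] r(1) by (simp add: max_def split: if_splits)
    qed
  qed
  have zrow: "fin_row 4 z" using dz zfv by (auto simp: fin_row_def fv_def)
  have zval: "fp_val F (z $ h) * outw (g h) = gate_out x (g h)" if "h < 4" for h
    using fvD(2)[OF zfv[OF that]] by (simp add: gate_out_def)
  have "fv F (vmult F z (w2 ?M) $ l) (\<Sum>h<4. fp_val F (z $ h) * (if l = out then outw (g h) else 0))"
  proof (rule vmult_fv[OF zrow])
    show "fv F (w2 ?M $$ (h, l)) (if l = out then outw (g h) else 0)" if "h < 4" for h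
      using that l ok[OF that, unfolded gate_ok_def] by (auto simp: gate_mlp_def intro!: fl_fv)
    show "representable F (\<Sum>h\<in>J. fp_val F (z $ h) * (if l = out then outw (g h) else 0))" if J: "J \<subseteq> {..<4}" for J
    proof (cases "l = out")
      case True
      then have "(\<Sum>h\<in>J. fp_val F (z $ h) * (if l = out then outw (g h) else 0)) = (\<Sum>h\<in>J. gate_out x (g h))"
        using J by (intro sum.cong) (auto simp: zval)
      then show ?thesis using representable_gate_outs[OF ok J] by simp
    qed simp
  qed (use l in \<open>auto simp: gate_mlp_def\<close>)
  moreover have "(\<Sum>h<4. fp_val F (z $ h) * (if l = out then outw (g h) else 0)) =
    (if l = out then \<Sum>h<4. gate_out x (g h) else 0)"
    by (auto simp: zval intro!: sum.cong)
  ultimately have v: "fv F (vmult F z (w2 ?M) $ l) (if l = out then \<Sum>h<4. gate_out x (g h) else 0)" by simp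
  have "mlp_row F ?M x $ l = fp_add F (vmult F z (w2 ?M) $ l) (fl 0)"
  proof -
    have "dim_col (w2 ?M) = d" "b2 ?M $ l = fl 0" using l by (simp_all add: gate_mlp_def)
    then show ?thesis unfolding mlp_row_def z_def[symmetric] using l by (simp add: vadd_def)
  qed
  then show ?thesis using fv_add[OF F v fl_fv[OF representable_zero]] representableI[OF v] by simp
qed

definition null_gate :: gate where
  "null_gate = \<lparr>src1 = 0, wt1 = 0, src2 = 0, wt2 = 0, off = 0, outw = 0\<rparr>"

definition unit_gate :: "nat \<Rightarrow> real \<Rightarrow> nat \<Rightarrow> real \<Rightarrow> real \<Rightarrow> nat \<Rightarrow> gate" where
  "unit_gate a u b v r h = (if h = 0 then \<lparr>src1 = a, wt1 = u, src2 = b, wt2 = v, off = r, outw = 1\<rparr> else null_gate)"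

text \<open>With \<open>N\<close> and \<open>S\<close> as in \<open>count_spec\<close>, the four hidden units compute
  \<open>[N = 0] + [N \<ge> k] - [S = 0]\<close>.\<close>

definition count_gate :: "nat \<Rightarrow> nat \<Rightarrow> nat \<Rightarrow> gate" where
  "count_gate k n h = \<lparr>src1 = (if h = 3 then n + 1 else n),
     wt1 = (if h = 0 then - (2 ^ (p - 1)) else if h = 3 then - 1 else 2 ^ (p - 1)), src2 = 0, wt2 = 0,
     off = (if h = 0 \<or> h = 3 then 1 else if h = 1 then 1 - real k else - real k),
     outw = (if h \<le> 1 then 1 else - 1)\<rparr>"

lemma representable_small: "\<bar>i\<bar> \<le> 4 * (2 * int K + 3) \<Longrightarrow> representable F (of_int i)"
  using four_K by (intro representable_int) linarith

lemma sum4: "(\<Sum>h<(4::nat). f h) = f 0 + f 1 + f 2 + (f 3 :: real)"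
  by (simp add: eval_nat_numeral)

lemma null_gate_ok: "0 < d \<Longrightarrow> gate_ok d x null_gate"
  by (auto simp: gate_ok_def null_gate_def gate_in_def gate_out_def intro!: exI[of _ 0])

lemma null_gate_out [simp]: "gate_out x null_gate = 0"
  by (simp add: gate_out_def null_gate_def)

lemma unit_gate_ok:
  fixes i j u v r :: int
  assumes "0 < d" "a < d" "b < d" "fp_val F (x $ a) = of_int i" "fp_val F (x $ b) = of_int j"
    "\<bar>i\<bar> \<le> 1" "\<bar>j\<bar> \<le> 1" "\<bar>u\<bar> \<le> 1" "\<bar>v\<bar> \<le> 1" "\<bar>r\<bar> \<le> 1"
  shows "gate_ok d x (unit_gate a u b v r h)"
    "(\<Sum>h<4. gate_out x (unit_gate a u b v r h)) = max 0 (of_int (i * u + j * v + r))"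
proof -
  have iu: "\<bar>i * u\<bar> \<le> 1" "\<bar>j * v\<bar> \<le> 1"
    using assms mult_mono[of "\<bar>i\<bar>" 1 "\<bar>u\<bar>" 1] mult_mono[of "\<bar>j\<bar>" 1 "\<bar>v\<bar>" 1] by (auto simp: abs_mult)
  have rep: "representable F (of_int n)" if "\<bar>n\<bar> \<le> 3" for n using that by (intro representable_small) simp
  have in0: "gate_in x (unit_gate a u b v r 0) = of_int (i * u + j * v)"
    using assms by (simp add: gate_in_def unit_gate_def)
  have out0: "gate_out x (unit_gate a u b v r 0) = of_int (max 0 (i * u + j * v + r))"
    using in0 by (simp add: gate_out_def) (simp add: unit_gate_def of_int_max)
  have "gate_ok d x (unit_gate a u b v r 0)"
    unfolding gate_ok_def
  proof (intro conjI)
    show "\<exists>n. gate_out x (unit_gate a u b v r 0) = of_int n \<and> \<bar>n\<bar> \<le> 2 * int K + 3"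
      using iu assms by (intro exI[of _ "max 0 (i * u + j * v + r)"] conjI out0) auto
    have "representable F (of_int (i * u + j * v + r))" using iu assms by (intro rep) auto
    then show "representable F (gate_in x (unit_gate a u b v r 0) + off (unit_gate a u b v r 0)) \<or>
      gate_in x (unit_gate a u b v r 0) + off (unit_gate a u b v r 0) \<le> 0 \<and>
      \<bar>gate_in x (unit_gate a u b v r 0) + off (unit_gate a u b v r 0)\<bar> < overflow_bound F"
      unfolding in0 by (simp add: unit_gate_def)
    show "representable F (gate_in x (unit_gate a u b v r 0))" unfolding in0 using iu by (intro rep) auto
    show "representable F (fp_val F (x $ src1 (unit_gate a u b v r 0)) * wt1 (unit_gate a u b v r 0))"
      using rep[of "i * u"] iu assms by (simp add: unit_gate_def)
    show "representable F (fp_val F (x $ src2 (unit_gate a u b v r 0)) * wt2 (unit_gate a u b v r 0))"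
      using rep[of "j * v"] iu assms by (simp add: unit_gate_def)
    show "representable F (wt1 (unit_gate a u b v r 0) + wt2 (unit_gate a u b v r 0))"
      using rep[of "u + v"] assms by (simp add: unit_gate_def)
  qed (use assms rep[of u] rep[of v] rep[of r] in \<open>auto simp: unit_gate_def\<close>)
  moreover have "unit_gate a u b v r h = null_gate" if "h \<noteq> 0" for h using that by (simp add: unit_gate_def)
  ultimately show "gate_ok d x (unit_gate a u b v r h)" using null_gate_ok[OF assms(1)] by (cases "h = 0") auto
  have "gate_out x (unit_gate a u b v r h) = 0" if "h \<noteq> 0" for h
    using that by (simp add: unit_gate_def)
  then show "(\<Sum>h<4. gate_out x (unit_gate a u b v r h)) = max 0 (of_int (i * u + j * v + r))"
    unfolding sum4 out0 by (simp add: of_int_max)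
qed

text \<open>ReLU of \<open>1 - N\<close> is the indicator of \<open>N = 0\<close>, the difference of
  the ReLUs of \<open>N - k + 1\<close> and \<open>N - k\<close> that of \<open>N \<ge> k\<close>,
  and ReLU of \<open>1 - S\<close> that of \<open>S = 0\<close>, because \<open>S\<close> is 0 or at
  least 1. For large \<open>S\<close> the number \<open>1 - S\<close> may be inexact, which ReLU
  forgives.\<close>

lemma count_gate_ok:
  assumes d: "n + 1 < d" and k: "1 \<le> k" "k \<le> K" and spec: "count_spec k cnt N S"
    and N: "fp_val F (x $ n) = of_int N * 2 powi (1 - int p)" and S: "fp_val F (x $ (n + 1)) = S"
  shows "h < 4 \<Longrightarrow> gate_ok d x (count_gate k n h)"
    "(\<Sum>h<4. gate_out x (count_gate k n h)) = of_bool (k \<le> cnt)"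
proof -
  have Nb: "0 \<le> N" "N \<le> 2 * int k + 2" and Sp: "representable F S" "0 \<le> S" "S \<le> 2 ^ (2 * p + 2)"
    and S01: "S = 0 \<or> 1 \<le> S"
    using spec k unfolding count_spec_def by (auto simp: Suc_le_eq)
  have scale: "fp_val F (x $ n) * 2 ^ (p - 1) = of_int N"
  proof -
    have "int (p - 1) = int p - 1" using prec_pos[OF F] by (simp add: of_nat_diff)
    then have "(2::real) ^ (p - 1) = 2 powi (int p - 1)" by (metis power_int_of_nat)
    then have "2 powi (1 - int p) * (2::real) ^ (p - 1) = 2 powi (1 - int p + (int p - 1))"
      by (subst power_int_add) auto
    then show ?thesis unfolding N by simp
  qed
  have rep: "representable F (of_int i)" if "\<bar>i\<bar> \<le> 4 * int K + 6" for i
  proof -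
    have "4 * int K + 6 \<le> 4 * (2 * int K + 3)" by simp
    with that show ?thesis by (intro representable_small) (rule order_trans)
  qed
  have repP: "representable F (2 ^ (p - 1))" using bias_large by (intro representable_nat_pow) auto
  have gin: "gate_in x (count_gate k n h) = (if h = 0 then - of_int N else if h = 3 then - S else of_int N)" for h
    using scale S by (simp add: gate_in_def count_gate_def)
  have gout: "gate_out x (count_gate k n 0) = of_int (max 0 (1 - N))"
    "gate_out x (count_gate k n 1) = of_int (max 0 (N - int k + 1))"
    "gate_out x (count_gate k n 2) = of_int (- max 0 (N - int k))"
    "gate_out x (count_gate k n 3) = of_int (if S = 0 then - 1 else 0)"
    unfolding gate_out_def gin using S01 by (auto simp: count_gate_def algebra_simps max_def)
  show "gate_ok d x (count_gate k n h)" if h: "h < 4" for h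
  proof -
    have cases: "h = 0 \<or> h = 1 \<or> h = 2 \<or> h = 3" using h by linarith
    have o: "\<exists>i. gate_out x (count_gate k n h) = of_int i \<and> \<bar>i\<bar> \<le> 2 * int K + 3"
    proof -
      define i where "i = (if h = 0 then max 0 (1 - N) else if h = 1 then max 0 (N - int k + 1)
        else if h = 2 then - max 0 (N - int k) else if S = 0 then - 1 else 0)"
      have "gate_out x (count_gate k n h) = of_int i" using cases gout by (auto simp: i_def)
      moreover have "\<bar>i\<bar> \<le> 2 * int K + 3" using Nb k by (auto simp: i_def max_def)
      ultimately show ?thesis by blast
    qed
    have inrep: "representable F (gate_in x (count_gate k n h))"
      unfolding gin using Sp(1) rep[of N] Nb k by auto
    have ovf: "\<bar>1 - S\<bar> < overflow_bound F"
    proof (rule no_overflow)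
      show "representable F (2 ^ (2 * p + 2))" using bias_large by (intro representable_nat_pow) simp
      have "(1::real) \<le> 2 ^ (2 * p + 2)" by (rule one_le_power) simp
      then show "\<bar>1 - S\<bar> \<le> 2 ^ (2 * p + 2)" using Sp by linarith
    qed
    have act: "representable F (gate_in x (count_gate k n h) + off (count_gate k n h)) \<or>
      gate_in x (count_gate k n h) + off (count_gate k n h) \<le> 0 \<and>
      \<bar>gate_in x (count_gate k n h) + off (count_gate k n h)\<bar> < overflow_bound F"
    proof -
      consider "h = 0" | "h = 1" | "h = 2" | "h = 3" using cases by blast
      then show ?thesis
      proof cases
        case 1 then show ?thesis unfolding gin using rep[of "1 - N"] Nb k by (simp add: count_gate_def)
      next
        case 2 then show ?thesis unfolding gin using rep[of "N + (1 - int k)"] Nb k by (simp add: count_gate_def)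
      next
        case 3 then show ?thesis unfolding gin using rep[of "N - int k"] Nb k by (simp add: count_gate_def)
      next
        case 4
        show ?thesis
        proof (cases "S = 0")
          case True then show ?thesis using 4 unfolding gin by (simp add: count_gate_def)
        next
          case False
          then show ?thesis using 4 S01 ovf unfolding gin by (simp add: count_gate_def abs_minus_commute)
        qed
      qed
    qed
    have "representable F (1 - real k)" "representable F (real k)"
      using rep[of "1 - int k"] rep[of "int k"] k by auto
    then show ?thesis
      unfolding gate_ok_def using o inrep act d repP Sp(1) rep[of N] Nb k scale S cases
      by (auto simp: count_gate_def)
  qed
  show "(\<Sum>h<4. gate_out x (count_gate k n h)) = of_bool (k \<le> cnt)"
  proof -
    have "max 0 (1 - N) + max 0 (N - int k + 1) + (- max 0 (N - int k)) + (if S = 0 then - 1 else 0) =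
      of_bool (k \<le> cnt)"
      using spec k unfolding count_spec_def by (cases "cnt = 0"; cases "k \<le> cnt") (auto simp: max_def)
    then have "of_int (max 0 (1 - N) + max 0 (N - int k + 1) + (- max 0 (N - int k)) + (if S = 0 then - 1 else 0)) =
      (of_bool (k \<le> cnt) :: real)" by (metis of_int_of_bool)
    then show ?thesis unfolding sum4 gout by (simp only: of_int_add)
  qed
qed

text \<open>At every coordinate one of the summands is 0, so the residual addition does not
  round.\<close>

lemma vadd_fv:
  assumes a: "dim_vec a = d" "\<And>l. l < d \<Longrightarrow> fv F (a $ l) (\<alpha> l)" and y: "fin_row d y"
    and z: "\<And>l. l < d \<Longrightarrow> \<alpha> l = 0 \<or> fp_val F (y $ l) = 0"
  shows "fin_row d (vadd F a y)" "\<And>l. l < d \<Longrightarrow> fp_val F (vadd F a y $ l) = \<alpha> l + fp_val F (y $ l)"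
proof -
  have "fv F (vadd F a y $ l) (\<alpha> l + fp_val F (y $ l))" if l: "l < d" for l
  proof -
    have yl: "fv F (y $ l) (fp_val F (y $ l))" using y l by (simp add: fin_row_def fv_def)
    have "representable F (\<alpha> l + fp_val F (y $ l))"
      using z[OF l] representableI[OF yl] representableI[OF a(2)[OF l]] by auto
    then show ?thesis using fv_add[OF F a(2)[OF l] yl] a(1) l by (simp add: vadd_def)
  qed
  then show "fin_row d (vadd F a y)" "\<And>l. l < d \<Longrightarrow> fp_val F (vadd F a y $ l) = \<alpha> l + fp_val F (y $ l)"
    using a(1) by (auto simp: fin_row_def fv_def)
qed

end

text \<open>Layer \<open>i\<close> will read the truth values of the children of
  \<open>L ! i\<close>, which earlier layers must have written.\<close>

definition well_ordered :: "'a gptl list \<Rightarrow> bool" where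
  "well_ordered L \<longleftrightarrow> (\<forall>i<length L. \<forall>\<chi>\<in>children (L ! i). \<exists>j<i. L ! j = \<chi>)"

lemma well_ordered_append: "well_ordered L \<Longrightarrow> well_ordered L' \<Longrightarrow> well_ordered (L @ L')"
  unfolding well_ordered_def
proof (intro allI impI ballI)
  fix i \<chi>
  assume L: "\<forall>i<length L. \<forall>\<chi>\<in>children (L ! i). \<exists>j<i. L ! j = \<chi>"
    and L': "\<forall>i<length L'. \<forall>\<chi>\<in>children (L' ! i). \<exists>j<i. L' ! j = \<chi>"
    and i: "i < length (L @ L')" and \<chi>: "\<chi> \<in> children ((L @ L') ! i)"
  show "\<exists>j<i. (L @ L') ! j = \<chi>"
  proof (cases "i < length L")
    case True
    with L \<chi> obtain j where "j < i" "L ! j = \<chi>" by (auto simp: nth_append)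
    then show ?thesis using True by (intro exI[of _ j]) (auto simp: nth_append)
  next
    case False
    then have "i - length L < length L'" "\<chi> \<in> children (L' ! (i - length L))"
      using i \<chi> by (auto simp: nth_append)
    with L' obtain j where "j < i - length L" "L' ! j = \<chi>" by blast
    then show ?thesis using False by (intro exI[of _ "length L + j"]) (auto simp: nth_append)
  qed
qed

lemma well_ordered_snoc:
  assumes "well_ordered L" "children \<psi> \<subseteq> set L" shows "well_ordered (L @ [\<psi>])"
  unfolding well_ordered_def
proof (intro allI impI ballI)
  fix i \<chi> assume i: "i < length (L @ [\<psi>])" and \<chi>: "\<chi> \<in> children ((L @ [\<psi>]) ! i)"
  show "\<exists>j<i. (L @ [\<psi>]) ! j = \<chi>"
  proof (cases "i < length L")
    case True
    with assms(1) \<chi> obtain j where "j < i" "L ! j = \<chi>" by (auto simp: nth_append well_ordered_def)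
    then show ?thesis using True by (intro exI[of _ j]) (auto simp: nth_append)
  next
    case False
    then have "i = length L" using i by simp
    with assms(2) \<chi> have "\<chi> \<in> set L" by auto
    then obtain j where "j < length L" "L ! j = \<chi>" by (auto simp: in_set_conv_nth)
    then show ?thesis using \<open>i = length L\<close> by (intro exI[of _ j]) (auto simp: nth_append)
  qed
qed

lemma well_ordered_subformulas: "well_ordered (subformulas \<phi>)"
proof (induction \<phi>)
  case (And \<phi> \<psi>)
  have "well_ordered ((subformulas \<phi> @ subformulas \<psi>) @ [And \<phi> \<psi>])"
    using And subformulas_self by (intro well_ordered_snoc well_ordered_append) auto
  then show ?case by simp
qed (auto intro!: well_ordered_snoc simp: subformulas_self, auto simp: well_ordered_def)

section \<open>A transformer with one layer per formula of a list\<close>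

locale formula_transformer = count_format F fexp c K for F fexp c K +
  fixes L \<phi>s :: "'a gptl list"
  assumes L: "well_ordered L" and \<phi>s: "set \<phi>s \<subseteq> set L" "\<phi>s \<noteq> []"
    and thresholds: "\<And>\<psi>. \<psi> \<in> set L \<Longrightarrow> threshold \<psi> \<le> K" and K1: "1 \<le> K"
begin

text \<open>Coordinate 0 of a row is constantly 1. Formula \<open>L ! j\<close> owns the coordinates from \<open>5 * j + 1\<close>
  to \<open>5 * j + 5\<close>: its truth value, the two readings of the counting head on the prefix, and those of
  the counting head on the suffix.\<close>

definition M :: nat where "M = length L"
definition d :: nat where "d = 5 * M + 1"

abbreviation bit_at :: "nat \<Rightarrow> nat" where "bit_at j \<equiv> 5 * j + 1"

definition idx :: "'a gptl \<Rightarrow> nat" where "idx \<psi> = (LEAST j. j < M \<and> L ! j = \<psi>)"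

text \<open>Every layer contains counting heads. For formulas that count nothing they run on the
  constant coordinate 0, and no gate reads the result.\<close>

definition source :: "'a gptl \<Rightarrow> nat" where
  "source \<psi> = (case \<psi> of GPre k \<phi> \<Rightarrow> bit_at (idx \<phi>) | PSuf k \<phi> \<Rightarrow> bit_at (idx \<phi>) | _ \<Rightarrow> 0)"

text \<open>Counting is specified for positive thresholds; threshold 0 and formulas without a
  threshold get the harmless value 1.\<close>

definition goal :: "'a gptl \<Rightarrow> nat" where "goal \<psi> = max 1 (threshold \<psi>)"

definition counter :: "nat \<Rightarrow> nat \<Rightarrow> attention" where
  "counter i base = count_attention d (source (L ! i)) ((goal (L ! i) + 1) div 2) base"

text \<open>With \<open>k = 0\<close> a counting formula is always true, and the unit copies the
  constant coordinate 0. Atoms are written by the embedding; the bit of \<open>Bot\<close> stays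
  0.\<close>

definition gates :: "nat \<Rightarrow> nat \<Rightarrow> gate" where
  "gates i = (case L ! i of
       Neg \<phi> \<Rightarrow> unit_gate (bit_at (idx \<phi>)) (of_int (- 1)) 0 (of_int 0) (of_int 1)
     | And \<phi> \<psi> \<Rightarrow> unit_gate (bit_at (idx \<phi>)) (of_int 1) (bit_at (idx \<psi>)) (of_int 1) (of_int (- 1))
     | GPre k \<phi> \<Rightarrow> if k = 0 then unit_gate 0 (of_int 1) 0 (of_int 0) (of_int 0) else count_gate k (5 * i + 2)
     | PSuf k \<phi> \<Rightarrow> if k = 0 then unit_gate 0 (of_int 1) 0 (of_int 0) (of_int 0) else count_gate k (5 * i + 4)
     | _ \<Rightarrow> (\<lambda>h. null_gate))"

definition mlp_at :: "nat \<Rightarrow> mlp" where "mlp_at i = gate_mlp d (bit_at i) (gates i)"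

text \<open>Layer \<open>i\<close> evaluates \<open>L ! i\<close>, in the encoder at prefix vertices
  and in the decoder at suffix vertices. Self-attention of the encoder and cross-attention of the
  decoder both count over the prefix and write to the same coordinates, so one MLP serves both
  sides.\<close>

definition T :: "'a transformer" where
  "T = \<lparr>tfmt = F, dim_model = d, dim_key = 1, dim_val = 2, dim_ff = 4, dim_out = length \<phi>s,
     emb = (\<lambda>l. vec d (\<lambda>c. fl (of_bool (c = 0 \<or> (\<exists>j a. c = bit_at j \<and> L ! j = Atom a \<and> l = Some a))))),
     encoder = map (\<lambda>i. \<lparr>enc_self = counter i (5 * i + 2), enc_mlp = mlp_at i\<rparr>) [0..<M],
     decoder = map (\<lambda>i. \<lparr>dec_self = counter i (5 * i + 4), dec_cross = counter i (5 * i + 2),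
       dec_mlp = mlp_at i\<rparr>) [0..<M],
     w_out = mat d (length \<phi>s) (\<lambda>(c, o'). fl (if c = bit_at (idx (\<phi>s ! o')) then 1 else 0)),
     b_out = vec (length \<phi>s) (\<lambda>o'. fl 0)\<rparr>"

lemma tfmt_T: "tfmt T = F"
  by (simp add: T_def)

lemma emb_T: "emb T l = vec d (\<lambda>c. fl (of_bool (c = 0 \<or> (\<exists>j a. c = bit_at j \<and> L ! j = Atom a \<and> l = Some a))))"
  by (simp add: T_def)

lemma M_pos: "0 < M" and d_pos: "0 < d"
  using \<phi>s by (auto simp: M_def d_def)

lemma idx_props:
  assumes "i \<le> M" "\<exists>j<i. L ! j = \<psi>" shows "idx \<psi> < i" "L ! idx \<psi> = \<psi>"
proof -
  from assms(2) obtain j where j: "j < i" "L ! j = \<psi>" by blast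
  then have *: "j < M \<and> L ! j = \<psi>" using assms(1) by simp
  have "idx \<psi> \<le> j" unfolding idx_def using * by (rule Least_le)
  then show "idx \<psi> < i" using j by simp
  show "L ! idx \<psi> = \<psi>" using LeastI[of "\<lambda>j. j < M \<and> L ! j = \<psi>", OF *] by (simp add: idx_def)
qed

lemma idx_child:
  assumes "i < M" "\<chi> \<in> children (L ! i)" shows "idx \<chi> < i" "L ! idx \<chi> = \<chi>"
proof -
  have "\<exists>j<i. L ! j = \<chi>" using assms L unfolding well_ordered_def M_def by blast
  from idx_props[OF less_imp_le[OF assms(1)] this] show "idx \<chi> < i" "L ! idx \<chi> = \<chi>" .
qed

lemma source_less: "i < M \<Longrightarrow> source (L ! i) < d"
  using idx_child[of i] by (cases "L ! i") (fastforce simp: source_def d_def)+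

lemma goal_props:
  assumes "i < M" shows "1 \<le> goal (L ! i)" "goal (L ! i) \<le> K"
  using thresholds[of "L ! i"] K1 assms by (auto simp: goal_def M_def)

lemma is_transformer_T: "is_transformer \<Sigma> T"
proof -
  have att: "wf_attention T (counter i base)" for i base
    by (auto simp: wf_attention_def counter_def count_attention_def count_head_def T_def fmat_iff)
  have mlp: "wf_mlp T (mlp_at i)" for i
    by (auto simp: wf_mlp_def mlp_at_def gate_mlp_def T_def fmat_iff fvec_iff)
  have emb: "emb T l \<in> fvec F d" for l by (auto simp: T_def fvec_iff)
  show ?thesis
    unfolding is_transformer_def
  proof (intro conjI ballI)
    show "valid_fmt (tfmt T)" using F by (simp add: T_def)
    show "1 \<le> dim_model T" using d_pos by (simp add: T_def)
    show "1 \<le> dim_out T" using \<phi>s(2) by (simp add: T_def Suc_le_eq)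
    show "emb T ` labels \<Sigma> \<subseteq> fvec (tfmt T) (dim_model T)" using emb by (auto simp: T_def)
    show "encoder T \<noteq> []" "decoder T \<noteq> []" using M_pos by (auto simp: T_def)
    show "wf_attention T (enc_self E)" "wf_mlp T (enc_mlp E)" if "E \<in> set (encoder T)" for E
      using that att mlp unfolding T_def by auto
    show "wf_attention T (dec_self E)" "wf_attention T (dec_cross E)" "wf_mlp T (dec_mlp E)"
      if "E \<in> set (decoder T)" for E
      using that att mlp unfolding T_def by auto
  qed (auto simp: T_def fmat_iff fvec_iff)
qed

text \<open>Bits of non-atomic formulas not yet evaluated are required to be 0, so that the MLP
  later writes into an empty coordinate; atoms hold from the start.\<close>

definition settled :: "nat \<Rightarrow> 'a graph \<Rightarrow> nat \<Rightarrow> fp vec \<Rightarrow> bool" where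
  "settled i G u x \<longleftrightarrow> fin_row d x \<and> fp_val F (x $ 0) = 1 \<and>
     (\<forall>j<M. fp_val F (x $ bit_at j) = of_bool ((j < i \<or> (\<exists>a. L ! j = Atom a)) \<and> sat G u (L ! j)))"

text \<open>Readings of layers already passed are left unspecified: stale values remain in the row,
  but nothing reads them again.\<close>

definition row_inv :: "nat \<Rightarrow> 'a graph \<Rightarrow> nat \<Rightarrow> fp vec \<Rightarrow> bool" where
  "row_inv i G u x \<longleftrightarrow> settled i G u x \<and>
     (\<forall>j<M. i \<le> j \<longrightarrow> (\<forall>r\<in>{2..5}. fp_val F (x $ (5 * j + r)) = 0))"

definition reading :: "nat \<Rightarrow> nat \<Rightarrow> nat \<Rightarrow> fp vec \<Rightarrow> bool" where
  "reading k n base x \<longleftrightarrow> (\<exists>N S. count_spec k n N S \<and>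
     fp_val F (x $ base) = of_int N * 2 powi (1 - int (prec F)) \<and> fp_val F (x $ (base + 1)) = S)"

text \<open>\<open>zero\<close> is asked for \<open>i < j\<close> only, since the heads have just
  filled the coordinates of layer \<open>i\<close>. The addition to the old row is exact because the
  bit of \<open>L ! i\<close> is still 0, or belongs to an atom, for which the gates output
  0.\<close>

lemma mlp_step:
  assumes i: "i < M" and x: "settled i G u x"
    and zero: "\<And>j r. j < M \<Longrightarrow> i < j \<Longrightarrow> r \<in> {2..5} \<Longrightarrow> fp_val F (x $ (5 * j + r)) = 0"
    and pre: "\<And>k \<phi>. L ! i = GPre k \<phi> \<Longrightarrow> 1 \<le> k \<Longrightarrow> reading k (card {v. v < bos G \<and> sat G v \<phi>}) (5 * i + 2) x"
    and suf: "\<And>k \<phi>. L ! i = PSuf k \<phi> \<Longrightarrow> 1 \<le> k \<Longrightarrow>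
      reading k (card {v \<in> suffix_vertices G. v \<le> u \<and> sat G v \<phi>}) (5 * i + 4) x"
  shows "row_inv (Suc i) G u (vadd F (mlp_row F (mlp_at i) x) x)"
proof -
  have fin: "fin_row d x" and x0: "fp_val F (x $ 0) = 1" using x by (auto simp: settled_def)
  have bits: "fp_val F (x $ bit_at j) = of_bool (sat G u (L ! j))" if "j < i" for j
    using x that i by (simp add: settled_def)
  have i_d: "5 * i + 5 < d" using i by (auto simp: d_def)
  have thr: "threshold (L ! i) \<le> K" using thresholds[of "L ! i"] i by (simp add: M_def)
  define out where "out = (\<Sum>h<4. gate_out x (gates i h))"
  have gates: "(\<forall>h<4. gate_ok d x (gates i h)) \<and>
    out = of_bool ((\<nexists>a. L ! i = Atom a) \<and> sat G u (L ! i))"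
  proof (cases "L ! i")
    case Bot
    then show ?thesis using null_gate_ok[OF d_pos] by (simp add: gates_def out_def)
  next
    case (Atom a)
    then show ?thesis using null_gate_ok[OF d_pos] by (simp add: gates_def out_def)
  next
    case (Neg \<phi>)
    have c: "idx \<phi> < i" "L ! idx \<phi> = \<phi>" using idx_child[OF i, of \<phi>] Neg by auto
    have a: "bit_at (idx \<phi>) < d" using c i_d by simp
    have v: "fp_val F (x $ bit_at (idx \<phi>)) = of_int (of_bool (sat G u \<phi>))" "fp_val F (x $ 0) = of_int 1"
      using bits[OF c(1)] c(2) x0 by auto
    note g = unit_gate_ok[OF d_pos a d_pos v, of "- 1" 0 1]
    show ?thesis unfolding gates_def out_def Neg using g by simp
  next
    case (And \<phi> \<psi>)
    have c: "idx \<phi> < i" "L ! idx \<phi> = \<phi>" "idx \<psi> < i" "L ! idx \<psi> = \<psi>"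
      using idx_child[OF i, of \<phi>] idx_child[OF i, of \<psi>] And by auto
    have a: "bit_at (idx \<phi>) < d" "bit_at (idx \<psi>) < d" using c i_d by auto
    have v: "fp_val F (x $ bit_at (idx \<phi>)) = of_int (of_bool (sat G u \<phi>))"
      "fp_val F (x $ bit_at (idx \<psi>)) = of_int (of_bool (sat G u \<psi>))"
      using bits[OF c(1)] bits[OF c(3)] c by auto
    note g = unit_gate_ok[OF d_pos a v, of 1 1 "- 1"]
    show ?thesis unfolding gates_def out_def And using g by simp
  next
    case (GPre k \<phi>)
    show ?thesis
    proof (cases "k = 0")
      case True
      have v: "fp_val F (x $ 0) = of_int 1" using x0 by simp
      note g = unit_gate_ok[OF d_pos d_pos d_pos v v, of 1 0 0]
      show ?thesis unfolding gates_def out_def GPre using g True by simp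
    next
      case False
      then have k: "1 \<le> k" "k \<le> K" using thr GPre by auto
      obtain N S where NS: "count_spec k (card {v. v < bos G \<and> sat G v \<phi>}) N S"
        "fp_val F (x $ (5 * i + 2)) = of_int N * 2 powi (1 - int (prec F))" "fp_val F (x $ (5 * i + 2 + 1)) = S"
        using pre[OF GPre k(1)] unfolding reading_def by blast
      have "5 * i + 2 + 1 < d" using i_d by simp
      note g = count_gate_ok[OF this k NS]
      show ?thesis unfolding gates_def out_def GPre using g False by simp
    qed
  next
    case (PSuf k \<phi>)
    show ?thesis
    proof (cases "k = 0")
      case True
      have v: "fp_val F (x $ 0) = of_int 1" using x0 by simp
      note g = unit_gate_ok[OF d_pos d_pos d_pos v v, of 1 0 0]
      show ?thesis unfolding gates_def out_def PSuf using g True by simp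
    next
      case False
      then have k: "1 \<le> k" "k \<le> K" using thr PSuf by auto
      obtain N S where NS: "count_spec k (card {v \<in> suffix_vertices G. v \<le> u \<and> sat G v \<phi>}) N S"
        "fp_val F (x $ (5 * i + 4)) = of_int N * 2 powi (1 - int (prec F))" "fp_val F (x $ (5 * i + 4 + 1)) = S"
        using suf[OF PSuf k(1)] unfolding reading_def by blast
      have "5 * i + 4 + 1 < d" using i_d by simp
      note g = count_gate_ok[OF this k NS]
      show ?thesis unfolding gates_def out_def PSuf using g False by simp
    qed
  qed
  then have ok: "\<And>h. h < 4 \<Longrightarrow> gate_ok d x (gates i h)"
    and out: "out = of_bool ((\<nexists>a. L ! i = Atom a) \<and> sat G u (L ! i))" by auto
  define \<alpha> where "\<alpha> l = (if l = bit_at i then out else 0)" for l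
  have m: "fv F (mlp_row F (mlp_at i) x $ l) (\<alpha> l)" if "l < d" for l
    unfolding mlp_at_def \<alpha>_def out_def by (rule mlp_gate[OF fin _ that]) (rule ok)
  have dm: "dim_vec (mlp_row F (mlp_at i) x) = d" by (simp add: mlp_at_def gate_mlp_def)
  have xi: "fp_val F (x $ bit_at i) = of_bool ((\<exists>a. L ! i = Atom a) \<and> sat G u (L ! i))"
    using x i by (simp add: settled_def)
  have z: "\<alpha> l = 0 \<or> fp_val F (x $ l) = 0" for l
    using xi out by (auto simp: \<alpha>_def)
  have res: "fin_row d (vadd F (mlp_row F (mlp_at i) x) x)"
    "\<And>l. l < d \<Longrightarrow> fp_val F (vadd F (mlp_row F (mlp_at i) x) x $ l) = \<alpha> l + fp_val F (x $ l)"
    by (rule vadd_fv[OF dm m fin z]; assumption)+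
  show ?thesis
    unfolding row_inv_def settled_def
  proof (intro conjI allI impI ballI)
    show "fin_row d (vadd F (mlp_row F (mlp_at i) x) x)" by (rule res(1))
    show "fp_val F (vadd F (mlp_row F (mlp_at i) x) x $ 0) = 1"
      using res(2)[OF d_pos] x0 by (simp add: \<alpha>_def)
    fix j assume j: "j < M"
    then have jd: "bit_at j < d" by (simp add: d_def)
    show "fp_val F (vadd F (mlp_row F (mlp_at i) x) x $ bit_at j) =
      of_bool ((j < Suc i \<or> (\<exists>a. L ! j = Atom a)) \<and> sat G u (L ! j))"
    proof (cases "j = i")
      case True
      then show ?thesis using res(2)[OF jd] xi out by (auto simp: \<alpha>_def)
    next
      case False
      then have "(j < Suc i) = (j < i)" by auto
      then show ?thesis using res(2)[OF jd] x j False by (simp add: \<alpha>_def settled_def)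
    qed
  next
    fix j r assume j: "j < M" "Suc i \<le> j" and r: "r \<in> {2..5::nat}"
    have "5 * j + r < d" using j r by (auto simp: d_def)
    moreover have "5 * j + r \<noteq> bit_at i" using j r by auto
    ultimately show "fp_val F (vadd F (mlp_row F (mlp_at i) x) x $ (5 * j + r)) = 0"
      using res(2)[of "5 * j + r"] zero[of j r] j r by (simp add: \<alpha>_def)
  qed
qed

text \<open>\<open>us\<close> lists the vertices of the rows \<open>xs\<close>. These rows may be at
  a later stage \<open>m\<close> than the querying one, since the decoder attends to finished
  encoder rows. The two written coordinates are 0 beforehand, which keeps the residual addition
  exact.\<close>

lemma counter_step:
  assumes i: "i < M" and y: "fin_row d y" "fp_val F (y $ 0) = 1"
    and base: "base + 1 < d" "fp_val F (y $ base) = 0" "fp_val F (y $ (base + 1)) = 0"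
    and us: "length us = length xs"
    and xs: "\<And>j. j < length xs \<Longrightarrow> settled m G (us ! j) (xs ! j)" "i \<le> m"
  defines "y' \<equiv> vadd F (attn_row fexp T (counter i base) xs y) y"
  shows "fin_row d y'"
    "\<And>l. l < d \<Longrightarrow> l \<noteq> base \<Longrightarrow> l \<noteq> base + 1 \<Longrightarrow> fp_val F (y' $ l) = fp_val F (y $ l)"
    "\<And>k \<phi>. L ! i \<in> {GPre k \<phi>, PSuf k \<phi>} \<Longrightarrow> 1 \<le> k \<Longrightarrow>
      reading k (length (filter (\<lambda>u. sat G u \<phi>) us)) base y'"
proof -
  let ?P = "\<lambda>x. fp_val F (x $ source (L ! i)) = 1"
  have val01: "fp_val F (xs ! j $ source (L ! i)) =
    of_bool (case L ! i of GPre k \<phi> \<Rightarrow> sat G (us ! j) \<phi> | PSuf k \<phi> \<Rightarrow> sat G (us ! j) \<phi> | _ \<Rightarrow> True)"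
    if j: "j < length xs" for j
  proof -
    have s: "settled m G (us ! j) (xs ! j)" using xs(1)[OF j] .
    have b: "fp_val F (xs ! j $ bit_at (idx \<phi>)) = of_bool (sat G (us ! j) \<phi>)" if "\<phi> \<in> children (L ! i)" for \<phi>
      using idx_child[OF i that] s xs(2) i by (simp add: settled_def)
    show ?thesis using b s by (cases "L ! i") (auto simp: source_def settled_def)
  qed
  have xsP: "fin_row d x \<and> fp_val F (x $ 0) = 1 \<and> fp_val F (x $ source (L ! i)) = of_bool (?P x)" if "x \<in> set xs" for x
  proof -
    from that obtain j where "j < length xs" "x = xs ! j" by (auto simp: in_set_conv_nth)
    then show ?thesis using xs(1)[of j] val01[of j] by (auto simp: settled_def)
  qed
  have T: "tfmt T = F" "dim_key T = 1" "dim_val T = 2" by (simp_all add: T_def)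
  obtain N S where NS: "count_spec (goal (L ! i)) (length (filter ?P xs)) N S"
    "\<And>l. l < d \<Longrightarrow> fv F (attn_row fexp T (counter i base) xs y $ l)
       (if l = base then of_int N * 2 powi (1 - int (prec F)) else if l = base + 1 then S else 0)"
    using attention_count[OF T source_less[OF i] goal_props[OF i] refl xsP y, where base = base]
    unfolding counter_def by blast
  define \<alpha> where "\<alpha> l = (if l = base then of_int N * 2 powi (1 - int (prec F)) else if l = base + 1 then S else 0)" for l
  have dm: "dim_vec (attn_row fexp T (counter i base) xs y) = d"
    by (simp add: counter_def count_attention_def)
  have a: "fv F (attn_row fexp T (counter i base) xs y $ l) (\<alpha> l)" if "l < d" for l
    using NS(2)[OF that] by (simp add: \<alpha>_def)
  have z: "\<alpha> l = 0 \<or> fp_val F (y $ l) = 0" for l using base by (simp add: \<alpha>_def)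
  have res: "fin_row d (vadd F (attn_row fexp T (counter i base) xs y) y)"
    "\<And>l. l < d \<Longrightarrow> fp_val F (vadd F (attn_row fexp T (counter i base) xs y) y $ l) = \<alpha> l + fp_val F (y $ l)"
    by (rule vadd_fv[OF dm a y(1) z]; assumption)+
  show "fin_row d y'" unfolding y'_def by (rule res(1))
  show "fp_val F (y' $ l) = fp_val F (y $ l)" if "l < d" "l \<noteq> base" "l \<noteq> base + 1" for l
    unfolding y'_def using res(2)[OF that(1)] that by (simp add: \<alpha>_def)
  show "reading k (length (filter (\<lambda>u. sat G u \<phi>) us)) base y'"
    if \<psi>: "L ! i \<in> {GPre k \<phi>, PSuf k \<phi>}" and k: "1 \<le> k" for k \<phi>
  proof -
    have "goal (L ! i) = k" using \<psi> k by (auto simp: goal_def)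
    moreover have "length (filter ?P xs) = length (filter (\<lambda>u. sat G u \<phi>) us)"
    proof -
      have "?P (xs ! j) = sat G (us ! j) \<phi>" if "j < length xs" for j
        using val01[OF that] \<psi> by auto
      then show ?thesis unfolding length_filter_conv_card us by (intro arg_cong[of _ _ card]) auto
    qed
    ultimately have "count_spec k (length (filter (\<lambda>u. sat G u \<phi>) us)) N S" using NS(1) by simp
    moreover have "fp_val F (y' $ base) = of_int N * 2 powi (1 - int (prec F))"
      unfolding y'_def using res(2)[of base] base by (simp add: \<alpha>_def)
    moreover have "fp_val F (y' $ (base + 1)) = S"
      unfolding y'_def using res(2)[of "base + 1"] base by (simp add: \<alpha>_def)
    ultimately show ?thesis unfolding reading_def by blast
  qed
qed

lemma filter_upt_card: "length (filter P [a..<b]) = card {v \<in> {a..<b}. P v}"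
proof -
  have "length (filter P [a..<b]) = card (set (filter P [a..<b]))" by (rule distinct_card[symmetric]) simp
  then show ?thesis unfolding set_filter set_upt .
qed

definition enc_inv :: "nat \<Rightarrow> 'a graph \<Rightarrow> fp vec list \<Rightarrow> bool" where
  "enc_inv i G xs \<longleftrightarrow> length xs = bos G \<and> (\<forall>u<bos G. row_inv i G u (xs ! u))"

definition dec_inv :: "nat \<Rightarrow> 'a graph \<Rightarrow> fp vec list \<Rightarrow> bool" where
  "dec_inv i G ys \<longleftrightarrow> length ys = length G - bos G \<and> (\<forall>r<length G - bos G. row_inv i G (bos G + r) (ys ! r))"

lemma count_spec_zero: "1 \<le> k \<Longrightarrow> count_spec k 0 0 0"
  by (simp add: count_spec_def)

lemma enc_step:
  assumes i: "i < M" and xs: "enc_inv i G xs"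
  shows "enc_inv (Suc i) G (enc_rows fexp T (encoder T ! i) xs)"
proof -
  have E: "encoder T ! i = \<lparr>enc_self = counter i (5 * i + 2), enc_mlp = mlp_at i\<rparr>" using i by (simp add: T_def)
  have len: "length xs = bos G" using xs by (simp add: enc_inv_def)
  have "row_inv (Suc i) G u (enc_row fexp T (encoder T ! i) xs (xs ! u))" if u: "u < bos G" for u
  proof -
    let ?y = "xs ! u" and ?b = "5 * i + 2"
    have inv: "row_inv i G v (xs ! v)" if "v < bos G" for v using xs that by (simp add: enc_inv_def)
    have zero: "fp_val F (?y $ (5 * j + r)) = 0" if "j < M" "i \<le> j" "r \<in> {2..5}" for j r
      using inv[OF u] that by (simp add: row_inv_def)
    have y: "fin_row d ?y" "fp_val F (?y $ 0) = 1" using inv[OF u] by (auto simp: row_inv_def settled_def)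
    have b: "?b + 1 < d" "fp_val F (?y $ ?b) = 0" "fp_val F (?y $ (?b + 1)) = 0"
      using i zero[of i 2] zero[of i 3] by (auto simp: d_def numeral_eq_Suc)
    have s: "settled i G ([0..<bos G] ! j) (xs ! j)" if "j < length xs" for j
      using inv[of j] that len by (simp add: row_inv_def)
    define y' where "y' = vadd F (attn_row fexp T (counter i ?b) xs ?y) ?y"
    note st = counter_step[where us = "[0..<bos G]", OF i y b _ s order_refl, folded y'_def]
    have us: "length [0..<bos G] = length xs" using len by simp
    have keep: "fp_val F (y' $ l) = fp_val F (?y $ l)" if "l < d" "l \<noteq> ?b" "l \<noteq> ?b + 1" for l
      using st(2)[OF us] that by blast
    have "row_inv (Suc i) G u (vadd F (mlp_row F (mlp_at i) y') y')"
    proof (rule mlp_step[OF i])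
      have "fp_val F (y' $ bit_at j) = fp_val F (?y $ bit_at j)" if "j < M" for j
      proof (rule keep)
        show "bit_at j < d" using that by (simp add: d_def)
        show "bit_at j \<noteq> ?b" "bit_at j \<noteq> ?b + 1" by presburger+
      qed
      moreover have "fp_val F (y' $ 0) = 1" using keep[OF d_pos] y by simp
      moreover have "fin_row d y'" using st(1)[OF us] by blast
      ultimately show "settled i G u y'"
        using inv[OF u] by (simp add: row_inv_def settled_def)
      show "fp_val F (y' $ (5 * j + r)) = 0" if "j < M" "i < j" "r \<in> {2..5}" for j r
        using keep[of "5 * j + r"] zero[of j r] that by (auto simp: d_def)
      show "reading k (card {v. v < bos G \<and> sat G v \<phi>}) ?b y'" if "L ! i = GPre k \<phi>" "1 \<le> k" for k \<phi>
      proof -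
        have "{v. v < bos G \<and> sat G v \<phi>} = {v \<in> {0..<bos G}. sat G v \<phi>}" by auto
        then show ?thesis using st(3)[OF us, of k \<phi>] that by (simp add: filter_upt_card)
      qed
      show "reading k (card {v \<in> suffix_vertices G. v \<le> u \<and> sat G v \<phi>}) (5 * i + 4) y'"
        if "L ! i = PSuf k \<phi>" "1 \<le> k" for k \<phi>
      proof -
        \<comment> \<open>No suffix vertex lies at or before a prefix vertex, and the untouched zero
          coordinates are a valid reading of the count 0.\<close>
        have e: "{v \<in> suffix_vertices G. v \<le> u \<and> sat G v \<phi>} = {}" using u by (auto simp: suffix_vertices_def)
        have e5: "5 * i + 4 + 1 = 5 * i + 5" by simp
        have "fp_val F (y' $ (5 * i + 4)) = 0" using keep[of "5 * i + 4"] zero[of i 4] i by (simp add: d_def)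
        moreover have "fp_val F (y' $ (5 * i + 4 + 1)) = 0"
          unfolding e5 using keep[of "5 * i + 5"] zero[of i 5] i by (simp add: d_def)
        ultimately show ?thesis unfolding reading_def e using count_spec_zero[OF that(2)]
          by (intro exI[of _ 0]) simp
      qed
    qed
    then show ?thesis by (simp add: enc_row_def E y'_def Let_def tfmt_T)
  qed
  then show ?thesis using len by (simp add: enc_inv_def enc_rows_def)
qed

lemma dec_step:
  assumes i: "i < M" and xs: "enc_inv M G xs" and ys: "dec_inv i G ys"
  shows "dec_inv (Suc i) G (dec_rows fexp T xs (decoder T ! i) ys)"
proof -
  have E: "decoder T ! i = \<lparr>dec_self = counter i (5 * i + 4), dec_cross = counter i (5 * i + 2), dec_mlp = mlp_at i\<rparr>"
    using i by (simp add: T_def)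
  have lenx: "length xs = bos G" using xs by (simp add: enc_inv_def)
  have len: "length ys = length G - bos G" using ys by (simp add: dec_inv_def)
  have "row_inv (Suc i) G (bos G + r) (dec_row fexp T (decoder T ! i) xs (take (Suc r) ys) (ys ! r))"
    if r: "r < length G - bos G" for r
  proof -
    let ?y = "ys ! r" and ?a = "5 * i + 4" and ?b = "5 * i + 2"
    let ?u = "bos G + r"
    have inv: "row_inv i G (bos G + j) (ys ! j)" if "j < length G - bos G" for j using ys that by (simp add: dec_inv_def)
    have zero: "fp_val F (?y $ (5 * j + q)) = 0" if "j < M" "i \<le> j" "q \<in> {2..5}" for j q
      using inv[OF r] that by (simp add: row_inv_def)
    have y: "fin_row d ?y" "fp_val F (?y $ 0) = 1" using inv[OF r] by (auto simp: row_inv_def settled_def)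
    have a: "?a + 1 < d" "fp_val F (?y $ ?a) = 0" "fp_val F (?y $ (?a + 1)) = 0"
      using i zero[of i 4] zero[of i 5] by (auto simp: d_def numeral_eq_Suc)
    have us: "length [bos G..<Suc ?u] = length (take (Suc r) ys)" using r len by (simp del: upt_Suc)
    have s: "settled i G ([bos G..<Suc ?u] ! j) (take (Suc r) ys ! j)" if "j < length (take (Suc r) ys)" for j
      using inv[of j] that len r by (simp add: row_inv_def del: upt_Suc)
    define y' where "y' = vadd F (attn_row fexp T (counter i ?a) (take (Suc r) ys) ?y) ?y"
    note st = counter_step[where us = "[bos G..<Suc ?u]", OF i y a us s order_refl, folded y'_def]
    have keep: "fp_val F (y' $ l) = fp_val F (?y $ l)" if "l < d" "l \<noteq> ?a" "l \<noteq> ?a + 1" for l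
      using st(2) that by blast
    have y': "fin_row d y'" "fp_val F (y' $ 0) = 1"
      using st(1) keep[OF d_pos] y by auto
    have b: "?b + 1 < d" "fp_val F (y' $ ?b) = 0" "fp_val F (y' $ (?b + 1)) = 0"
      using keep[of ?b] keep[of "?b + 1"] i zero[of i 2] zero[of i 3] by (auto simp: d_def numeral_eq_Suc)
    have us': "length [0..<bos G] = length xs" using lenx by simp
    \<comment> \<open>The encoder rows come from its last layer, hence \<open>M\<close> in place of
      \<open>i\<close>.\<close>
    have s': "settled M G ([0..<bos G] ! j) (xs ! j)" if "j < length xs" for j
      using xs that lenx by (simp add: row_inv_def enc_inv_def)
    define y'' where "y'' = vadd F (attn_row fexp T (counter i ?b) xs y') y'"
    note st' = counter_step[where us = "[0..<bos G]", OF i y' b us' s' less_imp_le[OF i], folded y''_def]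
    have keep': "fp_val F (y'' $ l) = fp_val F (y' $ l)" if "l < d" "l \<noteq> ?b" "l \<noteq> ?b + 1" for l
      using st'(2) that by blast
    have keep2: "fp_val F (y'' $ l) = fp_val F (?y $ l)"
      if "l < d" "l \<noteq> ?a" "l \<noteq> ?a + 1" "l \<noteq> ?b" "l \<noteq> ?b + 1" for l
      using keep[of l] keep'[of l] that by simp
    have "row_inv (Suc i) G ?u (vadd F (mlp_row F (mlp_at i) y'') y'')"
    proof (rule mlp_step[OF i])
      have "fp_val F (y'' $ bit_at j) = fp_val F (?y $ bit_at j)" if "j < M" for j
      proof (rule keep2)
        show "bit_at j < d" using that by (simp add: d_def)
        show "bit_at j \<noteq> ?b" "bit_at j \<noteq> ?b + 1" "bit_at j \<noteq> ?a" "bit_at j \<noteq> ?a + 1" by presburger+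
      qed
      moreover have "fp_val F (y'' $ 0) = 1" using keep2[OF d_pos] y by simp
      moreover have "fin_row d y''" using st'(1) by blast
      ultimately show "settled i G ?u y''"
        using inv[OF r] by (simp add: row_inv_def settled_def)
      show "fp_val F (y'' $ (5 * j + q)) = 0" if "j < M" "i < j" "q \<in> {2..5}" for j q
        using keep2[of "5 * j + q"] zero[of j q] that by (auto simp: d_def)
      show "reading k (card {v. v < bos G \<and> sat G v \<phi>}) ?b y''" if "L ! i = GPre k \<phi>" "1 \<le> k" for k \<phi>
      proof -
        have "{v. v < bos G \<and> sat G v \<phi>} = {v \<in> {0..<bos G}. sat G v \<phi>}" by auto
        then show ?thesis using st'(3)[of k \<phi>] that by (simp add: filter_upt_card)
      qed
      show "reading k (card {v \<in> suffix_vertices G. v \<le> ?u \<and> sat G v \<phi>}) ?a y''"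
        if "L ! i = PSuf k \<phi>" "1 \<le> k" for k \<phi>
      proof -
        have e: "{v \<in> suffix_vertices G. v \<le> ?u \<and> sat G v \<phi>} = {v \<in> {bos G..<Suc ?u}. sat G v \<phi>}"
          using r by (auto simp: suffix_vertices_def)
        have "fp_val F (y'' $ ?a) = fp_val F (y' $ ?a)" "fp_val F (y'' $ (?a + 1)) = fp_val F (y' $ (?a + 1))"
          using keep'[of ?a] keep'[of "?a + 1"] a by auto
        then show ?thesis using st(3)[of k \<phi>] that unfolding reading_def e filter_upt_card by simp
      qed
    qed
    then show ?thesis by (simp add: dec_row_def E y'_def y''_def Let_def tfmt_T)
  qed
  then show ?thesis using len by (simp add: dec_inv_def dec_rows_def)
qed

lemma emb_row_inv:
  assumes "u < length G" shows "row_inv 0 G u (emb T (G ! u))"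
proof -
  have e: "fv F (emb T (G ! u) $ l) (of_bool (l = 0 \<or> (\<exists>j a. l = bit_at j \<and> L ! j = Atom a \<and> G ! u = Some a)))"
    if "l < d" for l
    unfolding emb_T using that by (simp only: index_vec fl_fv[OF representable_of_bool])
  show ?thesis
    unfolding row_inv_def settled_def
  proof (intro conjI allI impI ballI)
    show "fin_row d (emb T (G ! u))" using fvD(1)[OF e] by (auto simp: fin_row_def T_def)
    show "fp_val F (emb T (G ! u) $ 0) = 1" using fvD(2)[OF e[OF d_pos]] by simp
    fix j assume j: "j < M"
    then have "bit_at j < d" by (simp add: d_def)
    from fvD(2)[OF e[OF this]]
    show "fp_val F (emb T (G ! u) $ bit_at j) = of_bool ((j < 0 \<or> (\<exists>a. L ! j = Atom a)) \<and> sat G u (L ! j))"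
      by auto
    fix r assume r: "r \<in> {2..5::nat}"
    then have "5 * j + r < d" using j by (auto simp: d_def)
    moreover have "5 * j + r \<noteq> bit_at j'" for j' using r by (auto simp: numeral_eq_Suc) presburger+
    ultimately show "fp_val F (emb T (G ! u) $ (5 * j + r)) = 0" using fvD(2)[OF e[of "5 * j + r"]] r by auto
  qed
qed

lemma fold_invariant:
  assumes "I 0 x" "\<And>i x. i < length Ls \<Longrightarrow> I i x \<Longrightarrow> I (Suc i) (f (Ls ! i) x)"
  shows "I (length Ls) (fold f Ls x)"
  using assms
proof (induction Ls rule: rev_induct)
  case (snoc l Ls)
  have "I (length Ls) (fold f Ls x)"
    using snoc.prems(2) by (intro snoc.IH[OF snoc.prems(1)]) (metis length_append_singleton less_SucI nth_append)
  then show ?case using snoc.prems(2)[of "length Ls" "fold f Ls x"] by (simp add: nth_append)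
qed simp

lemma formula_transformer_correct:
  "is_transformer \<Sigma> T \<and> equivalent \<Sigma> (featurewise_output fexp T) (\<lambda>G v. Some (tuple_output \<phi>s G v))"
proof
  show T: "is_transformer \<Sigma> T" by (rule is_transformer_T)
  have TF: "tfmt T = F" by (simp add: T_def)
  interpret t: transformer T fexp c \<Sigma>
    using F exp_ax T by unfold_locales (simp_all add: TF)
  have lenE: "length (encoder T) = M" "length (decoder T) = M" by (simp_all add: T_def)
  show "equivalent \<Sigma> (featurewise_output fexp T) (\<lambda>G v. Some (tuple_output \<phi>s G v))"
    unfolding equivalent_def
  proof (intro allI impI ballI)
    fix G v assume G: "two_sorted \<Sigma> G" and v: "v \<in> suffix_vertices G"
    have bos: "bos G < length G" by (rule bos_props(1)[OF G])
    have "enc_inv 0 G (map (emb T) (take (bos G) G))"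
      using bos emb_row_inv by (auto simp: enc_inv_def)
    then have enc: "enc_inv M G (t.enc_out G)"
      unfolding t.enc_out_def using fold_invariant[of "\<lambda>i. enc_inv i G" _ "encoder T" "enc_rows fexp T"] enc_step lenE by simp
    have "dec_inv 0 G (map (emb T) (drop (bos G) G))"
      using bos emb_row_inv by (auto simp: dec_inv_def)
    then have dec: "dec_inv M G (t.dec_out G)"
      unfolding t.dec_out_def
      using fold_invariant[of "\<lambda>i. dec_inv i G" _ "decoder T" "dec_rows fexp T (t.enc_out G)"] dec_step[OF _ enc] lenE by simp
    define y where "y = t.dec_out G ! (v - bos G)"
    have "v - bos G < length G - bos G" "bos G + (v - bos G) = v" using v by (auto simp: suffix_vertices_def)
    then have y: "row_inv M G v y" using dec by (metis dec_inv_def y_def)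
    then have fin: "fin_row d y" by (simp add: row_inv_def settled_def)
    define z where "z = vadd F (vmult F y (w_out T)) (b_out T)"
    have dz: "dim_vec z = length \<phi>s" by (simp add: z_def T_def)
    have out: "fv F (z $ o') (of_bool (sat G v (\<phi>s ! o')))" if o': "o' < length \<phi>s" for o'
    proof -
      have "\<phi>s ! o' \<in> set L" using \<phi>s(1) o' by auto
      then have "\<exists>j<M. L ! j = \<phi>s ! o'" by (auto simp: in_set_conv_nth M_def)
      from idx_props[OF order_refl this] have idx: "idx (\<phi>s ! o') < M" "L ! idx (\<phi>s ! o') = \<phi>s ! o'" .
      have val: "fp_val F (y $ bit_at (idx (\<phi>s ! o'))) = of_bool (sat G v (\<phi>s ! o'))"
        using y idx by (simp add: row_inv_def settled_def)
      have "fv F (vmult F y (w_out T) $ o') (fp_val F (y $ bit_at (idx (\<phi>s ! o'))) * 1)"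
      proof (rule fv_single[OF fin])
        show "bit_at (idx (\<phi>s ! o')) < d" using idx by (simp add: d_def)
        show "fv F (w_out T $$ (j, o')) (if j = bit_at (idx (\<phi>s ! o')) then 1 else 0)" if "j < d" for j
          using that o' by (auto simp: T_def intro!: fl_fv)
      qed (use o' val in \<open>auto simp: T_def\<close>)
      then have w: "fv F (vmult F y (w_out T) $ o') (of_bool (sat G v (\<phi>s ! o')))" by (simp only: val mult_1_right)
      have "z $ o' = fp_add F (vmult F y (w_out T) $ o') (fl 0)"
        using o' by (simp add: z_def vadd_def T_def)
      then show ?thesis using fv_add[OF F w fl_fv[OF representable_zero]] by simp
    qed
    have rep: "represents F x q \<longleftrightarrow> q = r" if "fv F x r" for x q r
      using that by (cases x) (auto simp: represents_def fv_def fin_floats_def)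
    have "transformer_output fexp T G v = list_of_vec z"
      using t.transformer_output_rows[OF G v] by (simp add: TF y_def z_def)
    moreover have "list_of_vec z = map (\<lambda>o'. z $ o') [0..<length \<phi>s]"
      using dz by (intro nth_equalityI) (auto simp: list_of_vec_index)
    ultimately have to: "transformer_output fexp T G v = map (\<lambda>o'. z $ o') [0..<length \<phi>s]" by simp
    have "featurewise F (map (\<lambda>o'. z $ o') [0..<length \<phi>s]) =
      Some (map (\<lambda>o'. represents F (z $ o') 1) [0..<length \<phi>s])"
      unfolding featurewise_def using rep[OF out] by auto
    moreover have "map (\<lambda>o'. represents F (z $ o') 1) [0..<length \<phi>s] = map (sat G v) \<phi>s"
      using rep[OF out] by (intro nth_equalityI) auto
    ultimately show "featurewise_output fexp T G v = Some (tuple_output \<phi>s G v)"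
      by (simp add: featurewise_output_def to TF tuple_output_def)
  qed
qed

end

lemma formulas_to_transformer:
  assumes \<phi>s: "is_formula_tuple \<Sigma> \<phi>s" and ex: "\<And>F. valid_fmt F \<Longrightarrow> exp_approx c F (fexp F)"
  shows "\<exists>T. is_transformer \<Sigma> T \<and> equivalent \<Sigma> (featurewise_output fexp T) (\<lambda>G v. Some (tuple_output \<phi>s G v))"
proof -
  define L where "L = concat (map subformulas \<phi>s)"
  define K where "K = Suc (Max (threshold ` set L))"
  define q where "q = 8 * (K + 2) ^ 2"
  \<comment> \<open>\<open>q < 2 ^ q\<close> makes the precision large enough, and
    \<open>2 * q + 20\<close> exponent bits give the bias \<open>2 ^ (2 * q + 19) - 1\<close>, which
    exceeds \<open>2 * q + 10\<close>.\<close>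
  define F where "F = \<lparr>prec = q, ebits = 2 * q + 20\<rparr>"
  have q: "1 \<le> q" by (simp add: q_def)
  have F: "valid_fmt F" using q by (simp add: valid_fmt_def F_def)
  have "well_ordered (concat (map subformulas \<psi>s))" for \<psi>s :: "'a gptl list"
    by (induction \<psi>s) (auto simp: well_ordered_subformulas intro!: well_ordered_append, simp add: well_ordered_def)
  then have L: "well_ordered L" by (simp add: L_def)
  have sub: "set \<phi>s \<subseteq> set L" using subformulas_self by (auto simp: L_def)
  interpret formula_transformer F fexp c K L \<phi>s
  proof unfold_locales
    show "valid_fmt F" by (rule F)
    show "exp_approx c F (fexp F)" by (rule ex[OF F])
    show "2 * int (prec F) + 10 \<le> bias F"
    proof -
      have "2 * q + 19 < 2 ^ (2 * q + 19)" by (rule less_exp)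
      then have "int (2 * q + 19) < int (2 ^ (2 * q + 19))" by (simp only: of_nat_less_iff)
      moreover have "int (2 ^ (2 * q + 19)) = bias F + 1"
        unfolding bias_def F_def by (simp add: add.commute)
      moreover have "prec F = q" by (simp add: F_def)
      ultimately show ?thesis by simp
    qed
    show "8 * (K + 2) ^ 2 \<le> 2 ^ prec F"
      using less_exp[of q] by (simp add: F_def q_def)
    show "well_ordered L" by (rule L)
    show "set \<phi>s \<subseteq> set L" by (rule sub)
    show "\<phi>s \<noteq> []" using \<phi>s by (simp add: is_formula_tuple_def)
    show "threshold \<psi> \<le> K" if "\<psi> \<in> set L" for \<psi>
      unfolding K_def using that by (intro le_SucI Max_ge) auto
    show "1 \<le> K" by (simp add: K_def)
  qed
  show ?thesis using formula_transformer_correct by blast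
qed

theorem theorem7:
  fixes \<Sigma> :: "'a set"
    and c :: nat
    and fexp :: "fmt \<Rightarrow> fp \<Rightarrow> fp"
    and nanb :: "fmt \<Rightarrow> bool list"
  assumes "finite \<Sigma>"
    and "\<And>F. valid_fmt F \<Longrightarrow> exp_approx c F (fexp F)"
    and "\<And>F. valid_fmt F \<Longrightarrow> length (nanb F) = prec F + ebits F + 1"
  shows
    "(\<forall>T. is_transformer \<Sigma> T \<longrightarrow>
        (\<exists>\<phi>s. is_formula_tuple \<Sigma> \<phi>s \<and>
          equivalent \<Sigma> (bitwise_output fexp nanb T) (tuple_output \<phi>s))) \<and>
     (\<forall>T. is_transformer \<Sigma> T \<longrightarrow>
        (\<exists>A. is_automaton \<Sigma> A \<and>
          equivalent \<Sigma> (bitwise_output fexp nanb T) (automaton_output A))) \<and>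
     (\<forall>\<phi>s. is_formula_tuple \<Sigma> \<phi>s \<longrightarrow>
        (\<exists>T. is_transformer \<Sigma> T \<and>
          equivalent \<Sigma> (featurewise_output fexp T) (\<lambda>G v. Some (tuple_output \<phi>s G v)))) \<and>
     (\<forall>A. is_automaton \<Sigma> A \<longrightarrow>
        (\<exists>T. is_transformer \<Sigma> T \<and>
          equivalent \<Sigma> (featurewise_output fexp T) (\<lambda>G v. Some (automaton_output A G v)))) \<and>
     (\<forall>\<phi>s. is_formula_tuple \<Sigma> \<phi>s \<longrightarrow>
        (\<exists>A. is_automaton \<Sigma> A \<and> equivalent \<Sigma> (tuple_output \<phi>s) (automaton_output A))) \<and>
     (\<forall>A. is_automaton \<Sigma> A \<longrightarrow>
        (\<exists>\<phi>s. is_formula_tuple \<Sigma> \<phi>s \<and> equivalent \<Sigma> (automaton_output A) (tuple_output \<phi>s)))"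
proof -
  have tf: "\<exists>\<phi>s. is_formula_tuple \<Sigma> \<phi>s \<and>
      equivalent \<Sigma> (bitwise_output fexp nanb T) (tuple_output \<phi>s)" if T: "is_transformer \<Sigma> T" for T
  proof -
    have F: "valid_fmt (tfmt T)" using T by (simp add: is_transformer_def)
    interpret transformer T fexp c \<Sigma>
      using F assms(2)[OF F] T by unfold_locales
    show ?thesis using transformer_to_formulas[where nanb = nanb, OF assms(1) assms(3)[OF F]] .
  qed
  have ta: "\<exists>A. is_automaton \<Sigma> A \<and> equivalent \<Sigma> (bitwise_output fexp nanb T) (automaton_output A)"
    if T: "is_transformer \<Sigma> T" for T
    using tf[OF T] formulas_to_automaton by (fastforce simp: equivalent_def)
  have at: "\<exists>T. is_transformer \<Sigma> T \<and>
      equivalent \<Sigma> (featurewise_output fexp T) (\<lambda>G v. Some (automaton_output A G v))"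
    if A: "is_automaton \<Sigma> A" for A
  proof -
    from automaton_to_formulas[OF assms(1) A] obtain \<phi>s where \<phi>s: "is_formula_tuple \<Sigma> \<phi>s"
      "equivalent \<Sigma> (automaton_output A) (tuple_output \<phi>s)" by blast
    from formulas_to_transformer[OF \<phi>s(1) assms(2)] \<phi>s(2) show ?thesis
      by (auto simp: equivalent_def)
  qed
  show ?thesis
    using tf ta formulas_to_transformer[OF _ assms(2)] at formulas_to_automaton automaton_to_formulas[OF assms(1)]
    by blast
qed

end
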